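(* Let $A$ be a unital $\sigma$-C*-algebra and let $H=l^2(A)$ be the standard Hilbert $A$-module. Then any unitary element $u\in\mathcal{Q}(H)=\mathcal{L}(H)/\mathcal{K}(H)$ whose class in ${\rm RK}_0(A)$ is trivial can be lifted to a unitary in $\mathcal{L}(H)$, i.e. there is a unitary $w\in\mathcal{L}(H)$ whose image in $\mathcal{Q}(H)$ is $u$.
   Context: A $\sigma$-C*-algebra is a complete Hausdorff topological $*$-algebra over $\mathbb{C}$ whose topology is determined by countably many continuous C*-seminorms; equivalently $A\cong\varprojlim_n A_n$ is a countable inverse limit (as topological $*$-algebras) of C*-algebras, and the connecting maps may be taken surjective. For a unital $\sigma$-C*-algebra $A$, $l^2(A)=\{\xi\in\prod_{k\ge1}A:\ \sum_k\xi_k^*\xi_k \text{ converges in } A\}$ with inner product $\langle\xi,\eta\rangle=\sum_k\xi_k^*\eta_k$ is the standard Hilbert $A$-module. Put $H=l^2(A)$, $H_n=l^2(A_n)$. $\mathcal{L}(H)\cong\varprojlim_n\mathcal{L}(H_n)$ is the $\sigma$-C*-algebra of bounded adjointable $A$-module maps on $H$, topologized by the seminorms $\|t\|_n$ = operator norm of the operator induced by $t$ on $H_n$; $\mathcal{K}(H)\cong\varprojlim_n\mathcal{K}(H_n)$ is the closed two-sided ideal of compact operators; $\mathcal{Q}(H)=\mathcal{L}(H)/\mathcal{K}(H)$ with the quotient topology. The representable K-theory group is ${\rm RK}_0(A)=U\mathcal{Q}(H)/U_0\mathcal{Q}(H)$, where $UB$ is the unitary group of $B$ and $U_0B$ is the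 path component of $1$ in $UB$. The class of a unitary $u\in\mathcal{Q}(H)$ in ${\rm RK}_0(A)$ is its image in this quotient. *)

theory Defs
  imports "HOL-Analysis.Analysis" "HOL-Algebra.QuotRing"
begin

section \<open>Topological star-algebras\<close>

record 'a tsalg = "'a ring" +
  cscale :: "complex \<Rightarrow> 'a \<Rightarrow> 'a"
  star :: "'a \<Rightarrow> 'a"
  tpl :: "'a topology"

text \<open>The locale \<^locale>\<open>ring\<close> of HOL-Algebra is a ring with one in which one and zero may
  coincide, so all algebras below are unital and the zero algebra is included.\<close>

locale star_algebra = Ring.ring A for A :: "('a, 'b) tsalg_scheme" (structure) +
  assumes cscale_closed: "x \<in> carrier A \<Longrightarrow> cscale A c x \<in> carrier A"
    and cscale_one: "x \<in> carrier A \<Longrightarrow> cscale A 1 x = x"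
    and cscale_cscale: "x \<in> carrier A \<Longrightarrow> cscale A c (cscale A d x) = cscale A (c * d) x"
    and cscale_add_left: "x \<in> carrier A \<Longrightarrow> cscale A (c + d) x = cscale A c x \<oplus> cscale A d x"
    and cscale_add_right: "\<lbrakk>x \<in> carrier A; y \<in> carrier A\<rbrakk> \<Longrightarrow>
      cscale A c (x \<oplus> y) = cscale A c x \<oplus> cscale A c y"
    and cscale_mult_left: "\<lbrakk>x \<in> carrier A; y \<in> carrier A\<rbrakk> \<Longrightarrow>
      cscale A c x \<otimes> y = cscale A c (x \<otimes> y)"
    and cscale_mult_right: "\<lbrakk>x \<in> carrier A; y \<in> carrier A\<rbrakk> \<Longrightarrow>
      x \<otimes> cscale A c y = cscale A c (x \<otimes> y)"
    and star_closed: "x \<in> carrier A \<Longrightarrow> star A x \<in> carrier A"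
    and star_star: "x \<in> carrier A \<Longrightarrow> star A (star A x) = x"
    and star_add: "\<lbrakk>x \<in> carrier A; y \<in> carrier A\<rbrakk> \<Longrightarrow>
      star A (x \<oplus> y) = star A x \<oplus> star A y"
    and star_mult: "\<lbrakk>x \<in> carrier A; y \<in> carrier A\<rbrakk> \<Longrightarrow>
      star A (x \<otimes> y) = star A y \<otimes> star A x"
    and star_cscale: "x \<in> carrier A \<Longrightarrow> star A (cscale A c x) = cscale A (cnj c) (star A x)"

locale topological_star_algebra = star_algebra +
  assumes topspace_carrier: "topspace (tpl A) = carrier A"
    and continuous_add:
      "continuous_map (prod_topology (tpl A) (tpl A)) (tpl A) (\<lambda>(x, y). x \<oplus> y)"
    and continuous_mult:
      "continuous_map (prod_topology (tpl A) (tpl A)) (tpl A) (\<lambda>(x, y). x \<otimes> y)"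
    and continuous_cscale:
      "continuous_map (prod_topology euclidean (tpl A)) (tpl A) (\<lambda>(c, x). cscale A c x)"
    and continuous_star: "continuous_map (tpl A) (tpl A) (star A)"

definition cstar_seminorm :: "('a, 'b) tsalg_scheme \<Rightarrow> ('a \<Rightarrow> real) \<Rightarrow> bool" where
  "cstar_seminorm A p \<longleftrightarrow>
    (\<forall>x\<in>carrier A. 0 \<le> p x) \<and>
    (\<forall>x\<in>carrier A. \<forall>y\<in>carrier A. p (x \<oplus>\<^bsub>A\<^esub> y) \<le> p x + p y) \<and>
    (\<forall>c. \<forall>x\<in>carrier A. p (cscale A c x) = cmod c * p x) \<and>
    (\<forall>x\<in>carrier A. \<forall>y\<in>carrier A. p (x \<otimes>\<^bsub>A\<^esub> y) \<le> p x * p y) \<and>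
    (\<forall>x\<in>carrier A. p (star A x \<otimes>\<^bsub>A\<^esub> x) = (p x)\<^sup>2)"

definition continuous_cstar_seminorm :: "('a, 'b) tsalg_scheme \<Rightarrow> ('a \<Rightarrow> real) \<Rightarrow> bool" where
  "continuous_cstar_seminorm A p \<longleftrightarrow>
    cstar_seminorm A p \<and> continuous_map (tpl A) euclideanreal p"

definition seminorm_topology :: "('a, 'b) ring_scheme \<Rightarrow> ('a \<Rightarrow> real) set \<Rightarrow> 'a topology" where
  "seminorm_topology B P = topology_generated_by
    {{y \<in> carrier B. p (y \<ominus>\<^bsub>B\<^esub> x) < e} | p x e. p \<in> P \<and> x \<in> carrier B \<and> 0 < e}"

definition cauchy_filter :: "('a, 'b) tsalg_scheme \<Rightarrow> 'a filter \<Rightarrow> bool" where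
  "cauchy_filter A F \<longleftrightarrow> F \<noteq> bot \<and> F \<le> principal (carrier A) \<and>
    (\<forall>U. openin (tpl A) U \<and> \<zero>\<^bsub>A\<^esub> \<in> U \<longrightarrow>
      (\<exists>S. eventually (\<lambda>x. x \<in> S) F \<and> (\<forall>x\<in>S. \<forall>y\<in>S. x \<ominus>\<^bsub>A\<^esub> y \<in> U)))"

locale sigma_cstar_algebra = topological_star_algebra +
  assumes Hausdorff: "Hausdorff_space (tpl A)"
    and complete: "cauchy_filter A F \<Longrightarrow> \<exists>l. limitin (tpl A) (\<lambda>x. x) l F"
    and countably_many_seminorms: "\<exists>p :: nat \<Rightarrow> 'a \<Rightarrow> real.
      (\<forall>n. cstar_seminorm A (p n)) \<and> tpl A = seminorm_topology A (range p)"


section \<open>Unitaries and quotients\<close>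

definition unitaries :: "('a, 'b) tsalg_scheme \<Rightarrow> 'a set" where
  "unitaries B = {u \<in> carrier B. star B u \<otimes>\<^bsub>B\<^esub> u = \<one>\<^bsub>B\<^esub> \<and> u \<otimes>\<^bsub>B\<^esub> star B u = \<one>\<^bsub>B\<^esub>}"

definition unitary_group :: "('a, 'b) tsalg_scheme \<Rightarrow> 'a monoid" where
  "unitary_group B = \<lparr>carrier = unitaries B, mult = mult B, one = one B\<rparr>"

definition unitary_component :: "('a, 'b) tsalg_scheme \<Rightarrow> 'a set" where
  "unitary_component B = path_component_of_set (subtopology (tpl B) (unitaries B)) \<one>\<^bsub>B\<^esub>"

definition quotient_topology :: "'a topology \<Rightarrow> ('a \<Rightarrow> 'b) \<Rightarrow> 'b topology" where
  "quotient_topology X f =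
    topology (\<lambda>V. V \<subseteq> f ` topspace X \<and> openin X {x \<in> topspace X. f x \<in> V})"

lemma openin_quotient_topology:
  "openin (quotient_topology X f) V \<longleftrightarrow>
    V \<subseteq> f ` topspace X \<and> openin X {x \<in> topspace X. f x \<in> V}"
proof -
  have "istopology (\<lambda>V. V \<subseteq> f ` topspace X \<and> openin X {x \<in> topspace X. f x \<in> V})"
    unfolding istopology_def
  proof (intro conjI allI impI)
    fix S T
    assume "S \<subseteq> f ` topspace X \<and> openin X {x \<in> topspace X. f x \<in> S}"
      and "T \<subseteq> f ` topspace X \<and> openin X {x \<in> topspace X. f x \<in> T}"
    moreover have "{x \<in> topspace X. f x \<in> S \<inter> T} =
        {x \<in> topspace X. f x \<in> S} \<inter> {x \<in> topspace X. f x \<in> T}"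
      by blast
    ultimately show "S \<inter> T \<subseteq> f ` topspace X" "openin X {x \<in> topspace X. f x \<in> S \<inter> T}"
      by auto
  next
    fix \<K>
    assume K: "\<forall>K\<in>\<K>. K \<subseteq> f ` topspace X \<and> openin X {x \<in> topspace X. f x \<in> K}"
    then show "\<Union>\<K> \<subseteq> f ` topspace X"
      by blast
    have "{x \<in> topspace X. f x \<in> \<Union>\<K>} = (\<Union>K\<in>\<K>. {x \<in> topspace X. f x \<in> K})"
      by blast
    with K show "openin X {x \<in> topspace X. f x \<in> \<Union>\<K>}"
      by auto
  qed
  then show ?thesis
    by (simp add: quotient_topology_def topology_inverse')
qed

lemma topspace_quotient_topology: "topspace (quotient_topology X f) = f ` topspace X"
proof -
  have "{x \<in> topspace X. f x \<in> f ` topspace X} = topspace X"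
    by blast
  then have "openin (quotient_topology X f) (f ` topspace X)"
    by (simp add: openin_quotient_topology)
  then show ?thesis
    by (meson openin_quotient_topology openin_subset openin_topspace subset_antisym)
qed

lemma quotient_map_quotient_topology: "quotient_map X (quotient_topology X f) f"
  by (auto simp: quotient_map_def topspace_quotient_topology openin_quotient_topology)

text \<open>\<^const>\<open>FactRing\<close> with the scalar multiplication and involution induced on cosets, in the
  style of \<^const>\<open>rcoset_mult\<close>, and the quotient topology.\<close>

definition quotient_tsalg :: "('a, 'b) tsalg_scheme \<Rightarrow> 'a set \<Rightarrow> 'a set tsalg" where
  "quotient_tsalg B I =
    \<lparr>carrier = carrier (B Quot I), mult = mult (B Quot I), one = one (B Quot I),
     zero = zero (B Quot I), add = add (B Quot I),
     cscale = (\<lambda>c X. \<Union>x\<in>X. I +>\<^bsub>B\<^esub> cscale B c x),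
     star = (\<lambda>X. \<Union>x\<in>X. I +>\<^bsub>B\<^esub> star B x),
     tpl = quotient_topology (tpl B) (\<lambda>x. I +>\<^bsub>B\<^esub> x)\<rparr>"


section \<open>The standard Hilbert module\<close>

text \<open>The coordinates of a vector are indexed by all of \<^typ>\<open>nat\<close>, starting at 0.\<close>

definition l2 :: "('a, 'b) tsalg_scheme \<Rightarrow> (nat \<Rightarrow> 'a) set" where
  "l2 A = {\<xi>. (\<forall>k. \<xi> k \<in> carrier A) \<and>
    (\<exists>s. limitin (tpl A) (\<lambda>n. \<Oplus>\<^bsub>A\<^esub>k\<in>{..<n}. star A (\<xi> k) \<otimes>\<^bsub>A\<^esub> \<xi> k) s sequentially)}"

definition l2_inner :: "('a, 'b) tsalg_scheme \<Rightarrow> (nat \<Rightarrow> 'a) \<Rightarrow> (nat \<Rightarrow> 'a) \<Rightarrow> 'a" where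
  "l2_inner A \<xi> \<eta> =
    (THE s. limitin (tpl A) (\<lambda>n. \<Oplus>\<^bsub>A\<^esub>k\<in>{..<n}. star A (\<xi> k) \<otimes>\<^bsub>A\<^esub> \<eta> k) s sequentially)"

definition l2_add :: "('a, 'b) tsalg_scheme \<Rightarrow> (nat \<Rightarrow> 'a) \<Rightarrow> (nat \<Rightarrow> 'a) \<Rightarrow> nat \<Rightarrow> 'a" where
  "l2_add A \<xi> \<eta> = (\<lambda>k. \<xi> k \<oplus>\<^bsub>A\<^esub> \<eta> k)"

definition l2_act :: "('a, 'b) tsalg_scheme \<Rightarrow> (nat \<Rightarrow> 'a) \<Rightarrow> 'a \<Rightarrow> nat \<Rightarrow> 'a" where
  "l2_act A \<xi> a = (\<lambda>k. \<xi> k \<otimes>\<^bsub>A\<^esub> a)"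

definition l2_cscale :: "('a, 'b) tsalg_scheme \<Rightarrow> complex \<Rightarrow> (nat \<Rightarrow> 'a) \<Rightarrow> nat \<Rightarrow> 'a" where
  "l2_cscale A c \<xi> = (\<lambda>k. cscale A c (\<xi> k))"

definition l2_zero :: "('a, 'b) tsalg_scheme \<Rightarrow> nat \<Rightarrow> 'a" where
  "l2_zero A = (\<lambda>k. \<zero>\<^bsub>A\<^esub>)"

definition l2_seminorm :: "('a, 'b) tsalg_scheme \<Rightarrow> ('a \<Rightarrow> real) \<Rightarrow> (nat \<Rightarrow> 'a) \<Rightarrow> real" where
  "l2_seminorm A p \<xi> = sqrt (p (l2_inner A \<xi> \<xi>))"


section \<open>Adjointable and compact operators\<close>

type_synonym 'a l2_op = "(nat \<Rightarrow> 'a) \<Rightarrow> nat \<Rightarrow> 'a"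

text \<open>Operators are extensional functions on \<^term>\<open>l2 A\<close>, so equality of operators is equality
  in HOL.\<close>

definition is_adjoint :: "('a, 'b) tsalg_scheme \<Rightarrow> 'a l2_op \<Rightarrow> 'a l2_op \<Rightarrow> bool" where
  "is_adjoint A t s \<longleftrightarrow> s \<in> l2 A \<rightarrow>\<^sub>E l2 A \<and>
    (\<forall>\<xi>\<in>l2 A. \<forall>\<eta>\<in>l2 A. l2_inner A (t \<xi>) \<eta> = l2_inner A \<xi> (s \<eta>))"

definition module_map :: "('a, 'b) tsalg_scheme \<Rightarrow> 'a l2_op \<Rightarrow> bool" where
  "module_map A t \<longleftrightarrow>
    (\<forall>\<xi>\<in>l2 A. \<forall>\<eta>\<in>l2 A. t (l2_add A \<xi> \<eta>) = l2_add A (t \<xi>) (t \<eta>)) \<and>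
    (\<forall>\<xi>\<in>l2 A. \<forall>a\<in>carrier A. t (l2_act A \<xi> a) = l2_act A (t \<xi>) a)"

definition bounded_op :: "('a, 'b) tsalg_scheme \<Rightarrow> 'a l2_op \<Rightarrow> bool" where
  "bounded_op A t \<longleftrightarrow> (\<forall>p. continuous_cstar_seminorm A p \<longrightarrow>
    (\<exists>C. \<forall>\<xi>\<in>l2 A. l2_seminorm A p (t \<xi>) \<le> C * l2_seminorm A p \<xi>))"

definition adjointable_ops :: "('a, 'b) tsalg_scheme \<Rightarrow> 'a l2_op set" where
  "adjointable_ops A =
    {t \<in> l2 A \<rightarrow>\<^sub>E l2 A. module_map A t \<and> bounded_op A t \<and> (\<exists>s. is_adjoint A t s)}"

text \<open>For a continuous C*-seminorm \<open>p\<close>, this is the norm of the operator induced by \<open>t\<close> on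
  the standard Hilbert module over the C*-algebra \<open>A / ker p\<close>: the vectors of \<^term>\<open>l2 A\<close> map
  onto that module, and \<^term>\<open>l2_seminorm A p\<close> is the pullback of its norm.\<close>

definition op_seminorm :: "('a, 'b) tsalg_scheme \<Rightarrow> ('a \<Rightarrow> real) \<Rightarrow> 'a l2_op \<Rightarrow> real" where
  "op_seminorm A p t = Sup {l2_seminorm A p (t \<xi>) | \<xi>. \<xi> \<in> l2 A \<and> l2_seminorm A p \<xi> \<le> 1}"

definition L_ring :: "('a, 'b) tsalg_scheme \<Rightarrow> 'a l2_op ring" where
  "L_ring A =
    \<lparr>carrier = adjointable_ops A,
     mult = compose (l2 A),
     one = (\<lambda>\<xi>\<in>l2 A. \<xi>),
     zero = (\<lambda>\<xi>\<in>l2 A. l2_zero A),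
     add = (\<lambda>s t. \<lambda>\<xi>\<in>l2 A. l2_add A (s \<xi>) (t \<xi>))\<rparr>"

text \<open>The topology is given by all continuous C*-seminorms of \<open>A\<close>. For any presentation of \<open>A\<close>
  as an inverse limit of a sequence of C*-algebras with surjective connecting maps, the seminorms
  coming from the sequence are cofinal among these and determine the same topology.\<close>

definition L_alg :: "('a, 'b) tsalg_scheme \<Rightarrow> 'a l2_op tsalg" where
  "L_alg A =
    \<lparr>carrier = carrier (L_ring A), mult = mult (L_ring A), one = one (L_ring A),
     zero = zero (L_ring A), add = add (L_ring A),
     cscale = (\<lambda>c t. \<lambda>\<xi>\<in>l2 A. l2_cscale A c (t \<xi>)),
     star = (\<lambda>t. THE s. is_adjoint A t s),
     tpl = seminorm_topology (L_ring A) {op_seminorm A p | p. continuous_cstar_seminorm A p}\<rparr>"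

definition rank_one :: "('a, 'b) tsalg_scheme \<Rightarrow> (nat \<Rightarrow> 'a) \<Rightarrow> (nat \<Rightarrow> 'a) \<Rightarrow> 'a l2_op" where
  "rank_one A \<xi> \<eta> = (\<lambda>\<zeta>\<in>l2 A. l2_act A \<xi> (l2_inner A \<eta> \<zeta>))"

inductive_set finite_rank :: "('a, 'b) tsalg_scheme \<Rightarrow> 'a l2_op set"
  for A :: "('a, 'b) tsalg_scheme" where
  rank_one: "\<lbrakk>\<xi> \<in> l2 A; \<eta> \<in> l2 A\<rbrakk> \<Longrightarrow> rank_one A \<xi> \<eta> \<in> finite_rank A"
| add: "\<lbrakk>s \<in> finite_rank A; t \<in> finite_rank A\<rbrakk> \<Longrightarrow> s \<oplus>\<^bsub>L_alg A\<^esub> t \<in> finite_rank A"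
| cscale: "t \<in> finite_rank A \<Longrightarrow> cscale (L_alg A) c t \<in> finite_rank A"

definition K_ideal :: "('a, 'b) tsalg_scheme \<Rightarrow> 'a l2_op set" where
  "K_ideal A = Abstract_Topology.closure_of (tpl (L_alg A)) (finite_rank A)"

definition Q_alg :: "('a, 'b) tsalg_scheme \<Rightarrow> 'a l2_op set tsalg" where
  "Q_alg A = quotient_tsalg (L_alg A) (K_ideal A)"


section \<open>Representable K-theory\<close>

definition RK0 :: "('a, 'b) tsalg_scheme \<Rightarrow> 'a l2_op set set monoid" where
  "RK0 A = unitary_group (Q_alg A) Mod unitary_component (Q_alg A)"

definition RK0_class :: "('a, 'b) tsalg_scheme \<Rightarrow> 'a l2_op set \<Rightarrow> 'a l2_op set set" where
  "RK0_class A u = unitary_component (Q_alg A) #>\<^bsub>unitary_group (Q_alg A)\<^esub> u"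

end

theory Submission
  imports Defs "HOL-Library.Poly_Mapping"
begin

text \<open>A path from \<open>1\<close> to \<open>u\<close> in the unitary group of \<open>Q(H)\<close> is lifted one seminorm at a time. If a path
  of unitaries of \<open>Q(H)\<close> stays near \<open>1\<close> for the seminorm number \<open>n\<close>, a product of exponentials
  \<open>e\<^bsup>ih\<^esup>\<close> with self-adjoint \<open>h \<in> L(H)\<close> follows it closely for the seminorm number \<open>n + 1\<close>; multiplying
  by exponentials with \<open>h \<in> K(H)\<close>, which the quotient does not see, keeps the endpoint of the
  product near \<open>1\<close> for the seminorm number \<open>n\<close> in \<open>L(H)\<close> itself. Dividing the path by this product
  and repeating, the infinite product of the endpoints converges to a unitary lift of \<open>u\<close>.

  That \<open>L(H)\<close> has the required structure rests on the Cauchy-Schwarz inequality in \<open>l\<^sup>2(A)\<close>, that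
  is, on the positivity of \<open>x\<^sup>* x\<close> for C*-seminorms. Arguments about a single C*-seminorm are carried
  out in the free star-algebra over the carrier, a type of class \<^class>\<open>real_algebra_1\<close>, and transported
  along the evaluation homomorphism.\<close>

section \<open>Order and positivity determined by one C*-seminorm, without spectra or
  completeness\<close>

section \<open>Positivity for C*-seminorms\<close>

text \<open>The standard argument for C*-algebras lifts \<open>u\<close> over each stage of the
  inverse limit separately, but lifts chosen independently need not be compatible. Hence each stage
  may only multiply the previous lift by a unitary that is already near 1 for the earlier seminorm.
  Following the path in the quotient does not ensure this: the endpoint is near 1 only modulo
  compact operators. The correction by exponentials from \<open>K\<close> closes this gap, after
  every small step and while the distance is still in the range where a first-order logarithm is
  accurate. Drift and correction balance at the radius 8\<epsilon>; the bound \<epsilon> \<le>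
  1/1000 makes the quadratic errors negligible, and summable radii make the product converge. The
  abstract part works on a free algebra whose seminorms do not separate points, so unitarity,
  exponentials and limits are understood up to elements on which all seminorms vanish. Positivity is
  treated for a single seminorm, for which the algebra may be incomplete, so points of the spectrum
  are replaced by approximate eigenvectors.\<close>

locale complex_star_ring =
  fixes st :: "'t::real_algebra_1 \<Rightarrow> 't" and J :: 't
  assumes st_add: "st (x + y) = st x + st y"
    and st_mult: "st (x * y) = st y * st x"
    and st_st [simp]: "st (st x) = x"
    and st_scaleR: "st (r *\<^sub>R x) = r *\<^sub>R st x"
    and st_J: "st J = - J"
    and J_J: "J * J = -1"
    and J_comm: "x * J = J * x"
begin

lemma J_J_left: "J * (J * x) = - x"
  by (metis J_J mult.assoc mult_minus1)

lemma J_left_comm: "x * (J * y) = J * (x * y)"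
  by (metis J_comm mult.assoc)

lemma st_zero [simp]: "st 0 = 0"
  using st_scaleR[of 0 0] by simp

lemma st_minus: "st (- x) = - st x"
  using st_scaleR[of "-1" x] by simp

lemma st_diff: "st (x - y) = st x - st y"
  using st_add[of x "-y"] by (simp add: st_minus)

lemma st_one [simp]: "st 1 = 1"
  by (metis mult_1 mult_1_right st_mult st_st)

lemma st_power: "st (x ^ n) = st x ^ n"
  by (induction n) (simp_all add: st_mult power_commutes)

lemma st_sum: "st (sum f F) = (\<Sum>k\<in>F. st (f k))"
  by (induction F rule: infinite_finite_induct) (simp_all add: st_add)

lemmas st_simps = st_add st_mult st_scaleR st_minus st_diff st_power st_J

end

text \<open>\<open>J\<close> plays the role of the imaginary unit, since the type class supplies
  real scalars only; \<open>p_scaleR\<close> and \<open>p_J\<close> together are the part of complex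
  homogeneity that is used. The seminorm may have a kernel.\<close>

locale cstar_seminormed = complex_star_ring st J
  for st :: "'t::real_algebra_1 \<Rightarrow> 't" and J +
  fixes p :: "'t \<Rightarrow> real"
  assumes p_nonneg [simp]: "0 \<le> p x"
    and p_add: "p (x + y) \<le> p x + p y"
    and p_scaleR: "p (r *\<^sub>R x) = \<bar>r\<bar> * p x"
    and p_J: "p (J * x) = p x"
    and p_mult: "p (x * y) \<le> p x * p y"
    and p_star: "p (st x * x) = (p x)\<^sup>2"
begin

lemma p_zero [simp]: "p 0 = 0"
  using p_scaleR[of 0 0] by simp

lemma p_minus [simp]: "p (- x) = p x"
  using p_scaleR[of "-1" x] by simp

lemma p_diff: "p (x - y) \<le> p x + p y"
  using p_add[of x "-y"] by simp

lemma p_commute: "p (x - y) = p (y - x)"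
  by (metis minus_diff_eq p_minus)

lemma p_triangle: "p (x - z) \<le> p (x - y) + p (y - z)"
  using p_add[of "x - y" "y - z"] by simp

lemma p_st [simp]: "p (st x) = p x"
proof -
  have *: "p x \<le> p (st x)" for x
  proof (cases "p x = 0")
    case False
    have "p x * p x \<le> p (st x) * p x"
      using p_mult[of "st x" x] p_star[of x] by (simp add: power2_eq_square)
    then show ?thesis
      using False p_nonneg[of x] by (simp add: mult_le_cancel_right)
  qed simp
  show ?thesis using *[of x] *[of "st x"] by simp
qed

lemma p_one: "p 1 \<le> 1"
proof -
  have "p 1 = p 1 * p 1"
    using p_star[of 1] by (simp add: power2_eq_square)
  then show ?thesis by (metis mult_cancel_right1 order_refl zero_le_one)
qed

lemma p_mult_le: "\<lbrakk>p x \<le> a; p y \<le> b\<rbrakk> \<Longrightarrow> p (x * y) \<le> a * b"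
  by (meson mult_mono order_trans p_mult p_nonneg)

lemma p_sa_sq: "st x = x \<Longrightarrow> p (x * x) = (p x)\<^sup>2"
  using p_star[of x] by simp

lemma p_power: "p (x ^ n) \<le> p x ^ n"
proof (induction n)
  case 0 show ?case using p_one by simp
next
  case (Suc n) then show ?case by (simp add: p_mult_le)
qed

text \<open>Iterating the C*-identity on a self-adjoint element gives equality at powers of two.
  This replaces the spectral radius formula.\<close>

lemma p_sa_power2: "st x = x \<Longrightarrow> p (x ^ (2 ^ k)) = p x ^ (2 ^ k)"
proof (induction k)
  case (Suc k)
  have "x ^ 2 ^ Suc k = x ^ 2 ^ k * x ^ 2 ^ k"
    by (simp add: power_add[symmetric] mult_2)
  then have "p (x ^ 2 ^ Suc k) = (p (x ^ 2 ^ k))\<^sup>2"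
    using p_sa_sq[of "x ^ 2 ^ k"] Suc.prems by (simp add: st_power)
  then show ?case
    using Suc by (simp add: power_mult[symmetric] mult.commute)
qed simp

text \<open>The two squares are \<open>z\<^sup>* z\<close> for \<open>z = a + i b\<close>, and \<open>a\<close> is the real part of \<open>z\<close>.\<close>

lemma two_squares:
  assumes "st a = a" "st b = b" "a * b = b * a"
  shows "(p a)\<^sup>2 \<le> p (a * a + b * b)"
proof -
  define z where "z = a + J * b"
  have z: "st z = a - J * b"
    using assms by (simp add: z_def st_simps J_comm)
  have "st z * z = a * a + b * b"
    unfolding z using assms
    by (simp add: z_def algebra_simps J_J_left J_left_comm[of a] J_left_comm[of b] mult.assoc)
  then have 1: "(p z)\<^sup>2 = p (a * a + b * b)"
    using p_star[of z] by simp
  have "z + st z = 2 *\<^sub>R a"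
    unfolding z by (simp add: z_def scaleR_2)
  then have "2 * p a \<le> p z + p z"
    using p_add[of z "st z"] by (simp add: p_scaleR)
  then show ?thesis using 1 by (smt (verit) p_nonneg power_mono)
qed

subsection \<open>Positive elements\<close>

text \<open>In a C*-algebra, the condition \<open>\<parallel>1 - s y\<parallel> \<le> 1 + O(s\<^sup>2)\<close> says that the spectrum of \<open>y\<close> is contained in
  \<open>[0, \<infinity>)\<close>. In this form it is stable under sums and does not refer to spectra.\<close>

definition pos :: "'t \<Rightarrow> bool" where
  "pos y \<longleftrightarrow> st y = y \<and> (\<exists>C. \<exists>s0>0. \<forall>s. 0 \<le> s \<and> s \<le> s0 \<longrightarrow> p (1 - s *\<^sub>R y) \<le> 1 + C * s\<^sup>2)"

lemma pos_sa: "pos y \<Longrightarrow> st y = y"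
  by (simp add: pos_def)

lemma posI:
  assumes "st y = y" "s0 > 0" "\<And>s. 0 \<le> s \<Longrightarrow> s \<le> s0 \<Longrightarrow> p (1 - s *\<^sub>R y) \<le> 1 + C * s\<^sup>2"
  shows "pos y"
  using assms unfolding pos_def by blast

text \<open>The element \<open>1 - s *\<^sub>R (x + y)\<close> is the average of
  \<open>1 - (2 * s) *\<^sub>R x\<close> and \<open>1 - (2 * s) *\<^sub>R y\<close>, so the two
  bounds are averaged; doubling \<open>s\<close> multiplies the quadratic errors by four.\<close>

lemma pos_add:
  assumes "pos x" "pos y"
  shows "pos (x + y)"
proof -
  obtain C s0 where 1: "s0 > 0" "\<And>s. 0 \<le> s \<Longrightarrow> s \<le> s0 \<Longrightarrow> p (1 - s *\<^sub>R x) \<le> 1 + C * s\<^sup>2"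
    using assms(1) unfolding pos_def by blast
  obtain D s1 where 2: "s1 > 0" "\<And>s. 0 \<le> s \<Longrightarrow> s \<le> s1 \<Longrightarrow> p (1 - s *\<^sub>R y) \<le> 1 + D * s\<^sup>2"
    using assms(2) unfolding pos_def by blast
  show ?thesis
  proof (rule posI[where C = "2 * C + 2 * D" and ?s0.0 = "min s0 s1 / 2"])
    show "st (x + y) = x + y" using assms by (simp add: pos_sa st_add)
    show "0 < min s0 s1 / 2" using 1 2 by simp
    fix s :: real assume s: "0 \<le> s" "s \<le> min s0 s1 / 2"
    have "2 *\<^sub>R (1 - s *\<^sub>R (x + y)) = (1 - (2 * s) *\<^sub>R x) + (1 - (2 * s) *\<^sub>R y)"
      by (simp add: algebra_simps scaleR_2)
    then have "2 * p (1 - s *\<^sub>R (x + y)) \<le> p (1 - (2 * s) *\<^sub>R x) + p (1 - (2 * s) *\<^sub>R y)"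
      using p_add p_scaleR[of 2 "1 - s *\<^sub>R (x + y)"] by (metis abs_numeral)
    also have "\<dots> \<le> (1 + C * (2 * s)\<^sup>2) + (1 + D * (2 * s)\<^sup>2)"
      using 1(2)[of "2 * s"] 2(2)[of "2 * s"] s by (intro add_mono) auto
    finally show "p (1 - s *\<^sub>R (x + y)) \<le> 1 + (2 * C + 2 * D) * s\<^sup>2"
      by (simp add: power2_eq_square algebra_simps)
  qed
qed

lemma pos_zero [simp]: "pos 0"
  by (rule posI[where C = 0 and ?s0.0 = 1]) (use p_one in auto)

lemma pos_sum: "(\<And>k. k \<in> F \<Longrightarrow> pos (f k)) \<Longrightarrow> pos (sum f F)"
  by (induction F rule: infinite_finite_induct) (auto intro: pos_add)

lemma pos_scaleR:
  assumes "pos x" "0 \<le> r"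
  shows "pos (r *\<^sub>R x)"
proof -
  obtain C s0 where 1: "s0 > 0" "\<And>s. 0 \<le> s \<Longrightarrow> s \<le> s0 \<Longrightarrow> p (1 - s *\<^sub>R x) \<le> 1 + C * s\<^sup>2"
    using assms(1) unfolding pos_def by blast
  show ?thesis
  proof (rule posI[where C = "C * r\<^sup>2" and ?s0.0 = "s0 / (r + 1)"])
    show "st (r *\<^sub>R x) = r *\<^sub>R x" using assms by (simp add: pos_sa st_scaleR)
    show "0 < s0 / (r + 1)" using 1 assms by simp
    fix s :: real assume s: "0 \<le> s" "s \<le> s0 / (r + 1)"
    have "s * (r + 1) \<le> s0" using s assms by (simp add: pos_le_divide_eq)
    then have "s * r \<le> s0" using s by (simp add: algebra_simps)
    then show "p (1 - s *\<^sub>R r *\<^sub>R x) \<le> 1 + C * r\<^sup>2 * s\<^sup>2"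
      using 1(2)[of "s * r"] s assms by (simp add: power_mult_distrib mult_ac)
  qed
qed

text \<open>For small \<open>s\<close> the element
  \<open>1 - s *\<^sub>R (r *\<^sub>R 1 - y)\<close> is
  \<open>(1 - s * r) *\<^sub>R 1 + s *\<^sub>R y\<close> with a nonnegative first coefficient, so
  its seminorm is at most 1 without any quadratic error.\<close>

lemma pos_bounded:
  assumes "st y = y" "p y \<le> r"
  shows "pos (r *\<^sub>R 1 - y)"
proof (rule posI[where C = 0 and ?s0.0 = "1 / (r + 1)"])
  have r: "r \<ge> 0" using assms(2) p_nonneg[of y] by linarith
  show "st (r *\<^sub>R 1 - y) = r *\<^sub>R 1 - y" using assms by (simp add: st_simps)
  show "0 < 1 / (r + 1)" using r by simp
  fix s :: real assume s: "0 \<le> s" "s \<le> 1 / (r + 1)"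
  have "s * (r + 1) \<le> 1" using s r by (simp add: pos_le_divide_eq)
  then have sr: "s * r \<le> 1" using s by (simp add: algebra_simps)
  have "1 - s *\<^sub>R (r *\<^sub>R 1 - y) = (1 - s * r) *\<^sub>R 1 + s *\<^sub>R y"
    by (simp add: algebra_simps)
  then have "p (1 - s *\<^sub>R (r *\<^sub>R 1 - y)) \<le> (1 - s * r) * p 1 + s * p y"
    using p_add[of "(1 - s * r) *\<^sub>R 1" "s *\<^sub>R y"] sr s by (simp add: p_scaleR)
  also have "\<dots> \<le> (1 - s * r) * 1 + s * r"
    by (intro add_mono mult_left_mono) (use p_one sr s assms in auto)
  finally show "p (1 - s *\<^sub>R (r *\<^sub>R 1 - y)) \<le> 1 + 0 * s\<^sup>2" by simp
qed

lemma pos_square: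
  assumes "st h = h"
  shows "pos (h * h)"
proof (rule posI[where C = "(p (h * h))\<^sup>2" and ?s0.0 = 1])
  show "st (h * h) = h * h" using assms by (simp add: st_mult)
  fix s :: real assume s: "0 \<le> s" "s \<le> 1"
  define a where "a = 1 - s *\<^sub>R (h * h)"
  \<comment> \<open>The factor \<open>sqrt (2 * s)\<close> makes \<open>b * b\<close> cancel the
    linear term of \<open>a * a\<close>, leaving \<open>1 + s^2 h^4\<close>, so that
    \<open>two_squares\<close> bounds \<open>a\<close> with a quadratic error.\<close>
  define b where "b = sqrt (2 * s) *\<^sub>R h"
  have b: "b * b = s *\<^sub>R (h * h) + s *\<^sub>R (h * h)"
    using s by (simp add: b_def scaleR_add_left[symmetric])
  have "(p a)\<^sup>2 \<le> p (a * a + b * b)"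
    by (rule two_squares)
      (use assms in \<open>simp_all add: a_def b_def st_simps algebra_simps mult.assoc\<close>)
  also have "a * a + b * b = 1 + (s * s) *\<^sub>R ((h * h) * (h * h))"
    unfolding b a_def by (simp add: algebra_simps)
  also have "p \<dots> \<le> 1 + (s * s) * (p (h * h) * p (h * h))"
  proof (rule order_trans[OF p_add add_mono[OF p_one]])
    show "p ((s * s) *\<^sub>R (h * h * (h * h))) \<le> s * s * (p (h * h) * p (h * h))"
      unfolding p_scaleR by (simp add: mult_left_mono p_mult)
  qed
  also have "\<dots> \<le> (1 + (p (h * h))\<^sup>2 * s\<^sup>2)\<^sup>2"
  proof -
    have "1 + t \<le> (1 + t)\<^sup>2" if "t \<ge> 0" for t :: real
      using that by (simp add: power2_eq_square algebra_simps)
    moreover have "(s * s) * (p (h * h) * p (h * h)) = (p (h * h))\<^sup>2 * s\<^sup>2"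
      by (simp add: power2_eq_square)
    ultimately show ?thesis by (metis mult_nonneg_nonneg zero_le_power2)
  qed
  finally show "p (1 - s *\<^sub>R (h * h)) \<le> 1 + (p (h * h))\<^sup>2 * s\<^sup>2"
    unfolding a_def[symmetric] by (rule power2_le_imp_le) simp
qed simp

text \<open>Write \<open>(1 + s * l) *\<^sub>R x\<close> as \<open>(1 - s *\<^sub>R y) * x\<close>
  plus \<open>s *\<^sub>R (l *\<^sub>R x + y * x)\<close>. Dividing by \<open>s\<close> and letting
  \<open>s\<close> tend to 0 removes the quadratic error allowed in \<open>pos\<close>. The estimate
  is a substitute for an inverse of \<open>y + l\<close>.\<close>

lemma lower_bound:
  assumes "pos y" "0 \<le> l"
  shows "l * p x \<le> p (l *\<^sub>R x + y * x)"
proof -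
  obtain C s0 where 1: "s0 > 0" "\<And>s. 0 \<le> s \<Longrightarrow> s \<le> s0 \<Longrightarrow> p (1 - s *\<^sub>R y) \<le> 1 + C * s\<^sup>2"
    using assms(1) unfolding pos_def by blast
  have *: "l * p x - p (l *\<^sub>R x + y * x) \<le> C * s * p x" if s: "0 < s" "s \<le> s0" for s
  proof -
    have "(1 + s * l) *\<^sub>R x = (1 - s *\<^sub>R y) * x + s *\<^sub>R (l *\<^sub>R x + y * x)"
      by (simp add: algebra_simps)
    then have "(1 + s * l) * p x \<le> p ((1 - s *\<^sub>R y) * x) + s * p (l *\<^sub>R x + y * x)"
      using p_add[of "(1 - s *\<^sub>R y) * x" "s *\<^sub>R (l *\<^sub>R x + y * x)"] p_scaleR[of "1 + s * l" x] s assms(2)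
      by (simp add: p_scaleR)
    also have "p ((1 - s *\<^sub>R y) * x) \<le> (1 + C * s\<^sup>2) * p x"
      by (rule p_mult_le) (use 1(2)[of s] s in auto)
    finally have "s * (l * p x - p (l *\<^sub>R x + y * x)) \<le> s * (C * s * p x)"
      by (simp add: algebra_simps power2_eq_square)
    then show ?thesis using s by simp
  qed
  have "((\<lambda>s. C * s * p x) \<longlongrightarrow> C * 0 * p x) (at_right 0)"
    by (intro tendsto_intros)
  moreover have "\<forall>\<^sub>F s in at_right 0. l * p x - p (l *\<^sub>R x + y * x) \<le> C * s * p x"
    unfolding eventually_at_right_field using 1(1) * by (intro exI[of _ s0]) auto
  ultimately have "l * p x - p (l *\<^sub>R x + y * x) \<le> C * 0 * p x"
    using tendsto_lowerbound by (metis trivial_limit_at_right_real)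
  then show ?thesis by simp
qed

text \<open>Elements of norm 1 behave like numbers in \<open>[-1, 1]\<close>: the geometric sum of \<open>c\<^sup>2\<close>,
  written as \<open>\<Prod>(1 + c\<^bsup>2\<cdot>2^i\<^esup>)\<close>, grows because \<open>1 + F\<^sup>2\<close> dominates \<open>2 F\<close> by the two squares
  \<open>(1 + F\<^sup>2)\<^sup>2 = (2 F)\<^sup>2 + (1 - F\<^sup>2)\<^sup>2\<close>.\<close>

lemma near_eigenvector_unit:
  assumes c: "st c = c" "p c = 1" and k: "\<kappa> > 0"
  obtains g where "st g = g" "g * c = c * g" "p g > 0" "p ((1 - c * c) * g) \<le> \<kappa> * p g"
proof -
  define F where "F i = c ^ (2 ^ i)" for i :: nat
  define S where "S k = (\<Prod>i\<leftarrow>[0..<k]. 1 + F i * F i)" for k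
  have S0: "S 0 = 1" by (simp add: S_def)
  have SSuc: "S (Suc k) = S k * (1 + F k * F k)" for k by (simp add: S_def)
  have com: "S k * c = c * S k" for k
  proof (induction k)
    case (Suc k)
    have "F k * c = c * F k" by (simp add: F_def power_commutes)
    then have "F k * F k * c = c * (F k * F k)" by (metis mult.assoc)
    then show ?case using Suc unfolding SSuc by (simp add: algebra_simps) (metis mult.assoc)
  qed (simp add: S0)
  have comn: "S k * c ^ n = c ^ n * S k" for k n
    by (simp add: com power_commuting_commutes)
  have sa: "st (S k) = S k" for k
  proof (induction k)
    case (Suc k)
    have "(1 + F k * F k) * S k = S k * (1 + F k * F k)"
      using comn[of k "2 ^ k"] by (simp add: F_def algebra_simps) (metis mult.assoc)
    then show ?case using Suc c by (simp add: SSuc st_simps F_def)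
  qed (simp add: S0)
  have tele: "(1 - c * c) * S k = 1 - c ^ (2 * 2 ^ k)" for k
  proof (induction k)
    case (Suc k)
    have FF: "F k * F k = c ^ (2 * 2 ^ k)" by (simp add: F_def power_add[symmetric] mult_2)
    have "(1 - c * c) * S (Suc k) = (1 - c ^ (2 * 2 ^ k)) * (1 + c ^ (2 * 2 ^ k))"
      unfolding SSuc by (simp add: mult.assoc[symmetric] Suc FF)
    also have "\<dots> = 1 - c ^ (2 * 2 ^ k) * c ^ (2 * 2 ^ k)" by (simp add: algebra_simps)
    also have "\<dots> = 1 - c ^ (2 * 2 ^ Suc k)"
      by (simp add: power_add[symmetric])
    finally show ?case .
  qed (simp add: S0 power2_eq_square)
  \<comment> \<open>\<open>c ^ n\<close> is a factor of \<open>c ^ (2 ^ n)\<close>, whose seminorm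
    is exactly 1, so no power of \<open>c\<close> can be small.\<close>
  have pow1: "p (c ^ n) = 1" for n
  proof (rule antisym)
    show "p (c ^ n) \<le> 1" using p_power[of c n] c by simp
    have n: "n \<le> 2 ^ n" by (simp add: less_imp_le)
    have "1 = p (c ^ n * c ^ (2 ^ n - n))"
      using p_sa_power2[of c n] c n by (simp add: power_add[symmetric])
    also have "\<dots> \<le> p (c ^ n) * 1"
      by (rule p_mult_le) (use p_power[of c "2 ^ n - n"] c in auto)
    finally show "1 \<le> p (c ^ n)" by simp
  qed
  have dom: "2 * p (f * g) \<le> p ((1 + f * f) * g)"
    if "st f = f" "st g = g" "f * g = g * f" for f g
  proof -
    have ffg: "f * f * g = g * (f * f)" using that(3) by (metis mult.assoc)
    have "(p (2 *\<^sub>R (f * g)))\<^sup>2 \<le> p ((2 *\<^sub>R (f * g)) * (2 *\<^sub>R (f * g)) + ((1 - f * f) * g) * ((1 - f * f) * g))"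
    proof (rule two_squares)
      have "f * g * (f * f * g) = f * f * g * (f * g)"
        using that(3) ffg by (metis mult.assoc)
      then show "2 *\<^sub>R (f * g) * ((1 - f * f) * g) = (1 - f * f) * g * (2 *\<^sub>R (f * g))"
        using that(3) by (simp add: algebra_simps)
    qed (use that ffg in \<open>simp_all add: st_simps algebra_simps\<close>)
    also have "(2 *\<^sub>R (f * g)) * (2 *\<^sub>R (f * g)) = 4 *\<^sub>R (f * f * g * g)"
      using that(3) by simp (metis mult.assoc)
    also have "((1 - f * f) * g) * ((1 - f * f) * g) = (1 - f * f) * (1 - f * f) * g * g"
      using ffg by (simp add: algebra_simps) (metis mult.assoc)
    also have "4 *\<^sub>R (f * f * g * g) + (1 - f * f) * (1 - f * f) * g * g
        = ((1 + f * f) * (1 + f * f)) * g * g"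
    proof -
      have "4 *\<^sub>R (f * f) + (1 - f * f) * (1 - f * f) = (1 + f * f) * (1 + f * f)"
        by (simp add: algebra_simps) (metis (no_types) scaleR_2 scaleR_left_distrib one_add_one numeral_Bit0 add.assoc)
      then have "(4 *\<^sub>R (f * f) + (1 - f * f) * (1 - f * f)) * g * g = (1 + f * f) * (1 + f * f) * g * g"
        by simp
      then show ?thesis by (simp add: distrib_right)
    qed
    also have "\<dots> = ((1 + f * f) * g) * ((1 + f * f) * g)"
      using ffg by (simp add: algebra_simps) (metis mult.assoc)
    also have "p \<dots> = (p ((1 + f * f) * g))\<^sup>2"
      by (rule p_sa_sq) (use that ffg in \<open>simp add: st_simps algebra_simps\<close>)
    finally have "p (2 *\<^sub>R (f * g)) \<le> p ((1 + f * f) * g)"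
      by (rule power2_le_imp_le) simp
    then show ?thesis by (simp add: p_scaleR)
  qed
  \<comment> \<open>Each factor \<open>1 + F i * F i\<close> is traded for
    \<open>2 *\<^sub>R F i\<close> by \<open>dom\<close>; the product of the \<open>F i\<close> with
    \<open>i < k\<close> is \<open>c ^ (2 ^ k - 1)\<close>. The spare power \<open>c ^ m\<close>
    lets the induction absorb the factors already traded.\<close>
  have grow: "2 ^ k * p (c ^ (2 ^ k - 1) * c ^ m) \<le> p (S k * c ^ m)" for k m
  proof (induction k arbitrary: m)
    case (Suc k)
    have e: "(2 ^ Suc k - 1 :: nat) = (2 ^ k - 1) + 2 ^ k" by simp
    have "2 ^ Suc k * p (c ^ (2 ^ Suc k - 1) * c ^ m) = 2 * (2 ^ k * p (c ^ (2 ^ k - 1) * c ^ (2 ^ k + m)))"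
    proof -
      have "c ^ (2 ^ Suc k - 1) * c ^ m = c ^ (2 ^ k - 1) * c ^ (2 ^ k + m)"
        by (subst e) (simp only: power_add mult.assoc)
      then show ?thesis by simp
    qed
    also have "\<dots> \<le> 2 * p (S k * c ^ (2 ^ k + m))"
      using Suc[of "2 ^ k + m"] by simp
    also have "S k * c ^ (2 ^ k + m) = F k * (S k * c ^ m)"
      by (metis F_def comn mult.assoc power_add)
    also have "2 * p (F k * (S k * c ^ m)) \<le> p ((1 + F k * F k) * (S k * c ^ m))"
    proof (rule dom)
      have "F k * S k = S k * F k" "F k * c ^ m = c ^ m * F k"
        using comn[of k "2 ^ k"] by (simp_all add: F_def power_add[symmetric] add.commute)
      then show "F k * (S k * c ^ m) = S k * c ^ m * F k" by (metis mult.assoc)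
    qed (use c sa comn in \<open>simp_all add: st_simps F_def\<close>)
    also have "(1 + F k * F k) * (S k * c ^ m) = S (Suc k) * c ^ m"
    proof -
      have "F k * S k = S k * F k" using comn[of k "2 ^ k"] by (simp add: F_def)
      then have "(1 + F k * F k) * S k = S k * (1 + F k * F k)"
        by (simp add: algebra_simps) (metis mult.assoc)
      then show ?thesis unfolding SSuc by (simp add: mult.assoc[symmetric])
    qed
    finally show ?case .
  qed (simp add: S0)
  \<comment> \<open>Telescoping bounds \<open>(1 - c * c) * S k\<close> by 2 for every
    \<open>k\<close>, while \<open>S k\<close> itself grows at least like
    \<open>2 ^ k\<close>.\<close>
  obtain k where kk: "2 / \<kappa> < 2 ^ k"
    using real_arch_pow[of 2 "2 / \<kappa>"] by auto
  have big: "2 ^ k \<le> p (S k)" using grow[of k 0] pow1 by simp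
  have "p ((1 - c * c) * S k) \<le> p 1 + p (c ^ (2 * 2 ^ k))"
    unfolding tele by (rule p_diff)
  also have "\<dots> \<le> 2" using p_one pow1 by simp
  also have "\<dots> \<le> \<kappa> * 2 ^ k" using kk k by (simp add: field_simps)
  also have "\<dots> \<le> \<kappa> * p (S k)" using big k by simp
  finally show thesis
    using that[of "S k"] sa com big by (smt (verit) zero_less_power)
qed

text \<open>In the commutative C*-algebra generated by \<open>c\<close>, a function \<open>g\<close>
  concentrated where \<open>c * c\<close> is close to its maximum would do. Here it comes from the
  case of norm 1 by scaling \<open>c\<close> to \<open>(1 / r) *\<^sub>R c\<close> and normalising
  \<open>g\<close>.\<close>

lemma near_eigenvector:
  assumes c: "st c = c" "p c > 0" and k: "\<kappa> > 0"
  obtains g where "st g = g" "g * c = c * g" "p g = 1"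
    "p (((p c)\<^sup>2 *\<^sub>R 1 - c * c) * g) \<le> \<kappa>"
proof -
  define r where "r = p c"
  have r: "r > 0" using c r_def by simp
  obtain g where g: "st g = g" "g * ((1 / r) *\<^sub>R c) = ((1 / r) *\<^sub>R c) * g" "p g > 0"
    and gk: "p ((1 - ((1 / r) *\<^sub>R c) * ((1 / r) *\<^sub>R c)) * g) \<le> (\<kappa> / r\<^sup>2) * p g"
    by (rule near_eigenvector_unit[of "(1 / r) *\<^sub>R c" "\<kappa> / r\<^sup>2"])
      (use c r k in \<open>auto simp: st_simps p_scaleR r_def\<close>)
  have gc: "g * c = c * g" using g(2) r by simp
  have "(r\<^sup>2 *\<^sub>R 1 - c * c) * g = r\<^sup>2 *\<^sub>R ((1 - ((1 / r) *\<^sub>R c) * ((1 / r) *\<^sub>R c)) * g)"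
    using r by (simp add: algebra_simps power2_eq_square)
  then have "p ((r\<^sup>2 *\<^sub>R 1 - c * c) * g) \<le> r\<^sup>2 * ((\<kappa> / r\<^sup>2) * p g)"
    using gk by (metis abs_power2 mult_left_mono p_scaleR zero_le_power2)
  then have 1: "p ((r\<^sup>2 *\<^sub>R 1 - c * c) * g) \<le> \<kappa> * p g" using r by simp
  show thesis
  proof (rule that[of "(1 / p g) *\<^sub>R g"])
    have "p (((p c)\<^sup>2 *\<^sub>R 1 - c * c) * (1 / p g) *\<^sub>R g) = (1 / p g) * p ((r\<^sup>2 *\<^sub>R 1 - c * c) * g)"
      using g(3) by (simp only: mult_scaleR_right p_scaleR r_def) simp
    also have "\<dots> \<le> (1 / p g) * (\<kappa> * p g)"
      by (rule mult_left_mono[OF 1]) (use g(3) in simp)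
    finally show "p (((p c)\<^sup>2 *\<^sub>R 1 - c * c) * (1 / p g) *\<^sub>R g) \<le> \<kappa>"
      using g(3) by simp
  qed (use g gc in \<open>auto simp: st_simps p_scaleR\<close>)
qed

text \<open>If \<open>p c > r\<close>, take \<open>g\<close> of norm 1 on which
  \<open>(p c)^2 - c^2\<close> is nearly 0. Both factors \<open>p c + c\<close> and
  \<open>p c - c\<close> are bounded below by \<open>p c - r\<close> in the sense of
  \<open>lower_bound\<close>, so their product cannot be that small on \<open>g\<close>.\<close>

lemma pos_norm_le:
  assumes "pos (r *\<^sub>R 1 - c)" "pos (r *\<^sub>R 1 + c)" "0 \<le> r"
  shows "p c \<le> r"
proof (rule ccontr)
  assume "\<not> p c \<le> r"
  then have pc: "p c > r" by simp
  have sc: "st c = c" using pos_sa[OF assms(2)] by (simp add: st_simps)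
  obtain g where g: "p g = 1" "p (((p c)\<^sup>2 *\<^sub>R 1 - c * c) * g) \<le> (p c - r)\<^sup>2 / 2"
    by (rule near_eigenvector[of c "(p c - r)\<^sup>2 / 2"]) (use sc pc assms(3) in auto)
  define z where "z = (p c) *\<^sub>R g + c * g"
  have "(p c - r) * p g \<le> p ((p c - r) *\<^sub>R g + (r *\<^sub>R 1 + c) * g)"
    by (rule lower_bound) (use assms pc in auto)
  also have "(p c - r) *\<^sub>R g + (r *\<^sub>R 1 + c) * g = z" by (simp add: z_def algebra_simps)
  finally have 1: "(p c - r) \<le> p z" using g by simp
  have "(p c - r) * p z \<le> p ((p c - r) *\<^sub>R z + (r *\<^sub>R 1 - c) * z)"
    by (rule lower_bound) (use assms pc in auto)
  also have "(p c - r) *\<^sub>R z + (r *\<^sub>R 1 - c) * z = ((p c)\<^sup>2 *\<^sub>R 1 - c * c) * g"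
    by (simp add: z_def algebra_simps power2_eq_square)
  finally have "(p c - r) * (p c - r) \<le> (p c - r)\<^sup>2 / 2"
    using g 1 pc by (smt (verit) mult_left_mono)
  moreover have "(p c - r)\<^sup>2 > 0" using pc by simp
  ultimately show False by (simp add: power2_eq_square)
qed

text \<open>With \<open>K = p y\<close> the element \<open>c = K *\<^sub>R 1 - y\<close> is
  positive, and \<open>p c \<le> K\<close> would make \<open>y\<close> positive. So
  \<open>p c - K\<close> is positive, and approximate eigenvectors of \<open>c\<close> for its top
  value \<open>p c\<close> are approximate eigenvectors of \<open>y\<close> for
  \<open>K - p c < 0\<close>.\<close>

lemma not_pos_eigenvector:
  assumes y: "st y = y" "\<not> pos y"
  obtains \<alpha> where "\<alpha> > 0"
    "\<And>\<kappa>. \<kappa> > 0 \<Longrightarrow> \<exists>g. st g = g \<and> g * y = y * g \<and> p g = 1 \<and> p (\<alpha> *\<^sub>R g + y * g) \<le> \<kappa>"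
proof -
  define K where "K = p y"
  define c where "c = K *\<^sub>R 1 - y"
  define \<alpha> where "\<alpha> = p c - K"
  have K: "K \<ge> 0" by (simp add: K_def)
  have sc: "st c = c" using y by (simp add: c_def st_simps)
  have posc: "pos c" unfolding c_def by (rule pos_bounded) (use y K_def in auto)
  have a: "\<alpha> > 0"
  proof (rule ccontr)
    assume "\<not> \<alpha> > 0"
    then have "p c \<le> K" by (simp add: \<alpha>_def)
    with sc have "pos (K *\<^sub>R 1 - c)" by (rule pos_bounded)
    then show False using y by (simp add: c_def)
  qed
  then have pc: "p c > 0" using K by (simp add: \<alpha>_def)
  show thesis
  proof (rule that[OF a])
    fix \<kappa> :: real assume k: "\<kappa> > 0"
    obtain g where g: "st g = g" "g * c = c * g" "p g = 1"
      and gk: "p (((p c)\<^sup>2 *\<^sub>R 1 - c * c) * g) \<le> \<kappa> * p c"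
      by (rule near_eigenvector[of c "\<kappa> * p c"]) (use sc pc k in auto)
    have ac: "\<alpha> *\<^sub>R g + y * g = p c *\<^sub>R g - c * g"
      by (simp add: \<alpha>_def c_def algebra_simps)
    \<comment> \<open>Since \<open>c\<close> is positive, the factor \<open>p c + c\<close> can be
      cancelled, so \<open>c\<close> itself, and not only its square, is close to \<open>p c\<close>
      on \<open>g\<close>.\<close>
    have "p c * p (p c *\<^sub>R g - c * g) \<le> p (p c *\<^sub>R (p c *\<^sub>R g - c * g) + c * (p c *\<^sub>R g - c * g))"
      by (rule lower_bound) (use posc in auto)
    also have "p c *\<^sub>R (p c *\<^sub>R g - c * g) + c * (p c *\<^sub>R g - c * g) = ((p c)\<^sup>2 *\<^sub>R 1 - c * c) * g"
      by (simp add: algebra_simps power2_eq_square)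
    finally have "p c * p (p c *\<^sub>R g - c * g) \<le> p c * \<kappa>" using gk by (simp add: mult.commute)
    then have "p (\<alpha> *\<^sub>R g + y * g) \<le> \<kappa>" using pc ac by simp
    moreover have "g * y = y * g" using g(2) by (simp add: c_def algebra_simps)
    ultimately show "\<exists>g. st g = g \<and> g * y = y * g \<and> p g = 1 \<and> p (\<alpha> *\<^sub>R g + y * g) \<le> \<kappa>"
      using g by blast
  qed
qed

text \<open>The nonzero spectra of \<open>st z * z\<close> and \<open>z * st z\<close> agree:
  \<open>z\<close> carries an approximate eigenvector \<open>g\<close> of the first for a negative
  value to one of the second. Positivity there forces \<open>z * g\<close> to be small, hence
  \<open>st z * (z * g)\<close> as well, which contradicts the eigenvalue equation.\<close>

lemma pos_swap:
  assumes "pos (z * st z + e *\<^sub>R 1)" "0 \<le> e"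
  shows "pos (st z * z + e *\<^sub>R 1)"
proof (rule ccontr)
  assume np: "\<not> pos (st z * z + e *\<^sub>R 1)"
  obtain \<alpha> where a: "\<alpha> > 0" and ex: "\<And>\<kappa>. \<kappa> > 0 \<Longrightarrow>
      \<exists>g. st g = g \<and> g * (st z * z + e *\<^sub>R 1) = (st z * z + e *\<^sub>R 1) * g \<and> p g = 1 \<and>
        p (\<alpha> *\<^sub>R g + (st z * z + e *\<^sub>R 1) * g) \<le> \<kappa>"
    by (rule not_pos_eigenvector[OF _ np]) (simp_all add: st_simps)
  \<comment> \<open>Chosen so that the errors add up to
    \<open>d * (1 + (p z)^2 / \<alpha>) = \<alpha> / 2\<close>, which is below
    \<open>\<alpha> + e\<close>.\<close>
  define d where "d = \<alpha> / (2 * (1 + (p z)\<^sup>2 / \<alpha>))"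
  have q: "1 + (p z)\<^sup>2 / \<alpha> > 0" using a by (smt (verit) divide_nonneg_pos zero_le_power2)
  have d: "d > 0" using a q by (simp add: d_def)
  obtain g where g: "p g = 1" "p (\<alpha> *\<^sub>R g + (st z * z + e *\<^sub>R 1) * g) \<le> d"
    using ex[OF d] by blast
  have "\<alpha> * p (z * g) \<le> p (\<alpha> *\<^sub>R (z * g) + (z * st z + e *\<^sub>R 1) * (z * g))"
    by (rule lower_bound) (use assms a in auto)
  also have "\<alpha> *\<^sub>R (z * g) + (z * st z + e *\<^sub>R 1) * (z * g) = z * (\<alpha> *\<^sub>R g + (st z * z + e *\<^sub>R 1) * g)"
    by (simp add: algebra_simps)
  also have "p \<dots> \<le> p z * d" by (rule p_mult_le) (use g in auto)
  finally have zg: "p (z * g) \<le> p z * d / \<alpha>" using a by (simp add: field_simps)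
  have "(\<alpha> + e) = p ((\<alpha> + e) *\<^sub>R g)" using a assms g by (simp add: p_scaleR)
  also have "(\<alpha> + e) *\<^sub>R g = (\<alpha> *\<^sub>R g + (st z * z + e *\<^sub>R 1) * g) - st z * (z * g)"
    by (simp add: algebra_simps)
  also have "p \<dots> \<le> d + p z * (p z * d / \<alpha>)"
    by (rule order_trans[OF p_diff add_mono[OF g(2)]]) (rule p_mult_le, use zg in auto)
  also have "\<dots> = d * (1 + (p z)\<^sup>2 / \<alpha>)" by (simp add: algebra_simps power2_eq_square)
  also have "\<dots> = \<alpha> / 2" using q unfolding d_def by (metis less_irrefl nonzero_mult_divide_mult_cancel_right times_divide_eq_left)
  finally show False using a assms by simp
qed

text \<open>If \<open>x\<^sup>* x\<close> had an approximate eigenvector \<open>g\<close> for \<open>- \<alpha> < 0\<close>, then \<open>z = x g\<close> would have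
  \<open>z\<^sup>* z \<approx> - \<alpha> g\<^sup>2\<close>; but \<open>z\<^sup>* z + z z\<^sup>*\<close> is a sum of two squares, so \<open>z z\<^sup>*\<close>, and with it
  \<open>z\<^sup>* z\<close>, would be almost positive.\<close>

theorem pos_star_mult: "pos (st x * x)"
proof (rule ccontr)
  assume np: "\<not> pos (st x * x)"
  obtain \<alpha> where a: "\<alpha> > 0" and ex: "\<And>\<kappa>. \<kappa> > 0 \<Longrightarrow>
      \<exists>g. st g = g \<and> g * (st x * x) = (st x * x) * g \<and> p g = 1 \<and> p (\<alpha> *\<^sub>R g + (st x * x) * g) \<le> \<kappa>"
    by (rule not_pos_eigenvector[OF _ np]) (simp_all add: st_simps)
  define d where "d = \<alpha> / 4"
  have d: "d > 0" using a by (simp add: d_def)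
  obtain g where g: "st g = g" "g * (st x * x) = (st x * x) * g" "p g = 1"
    and gd: "p (\<alpha> *\<^sub>R g + (st x * x) * g) \<le> d" using ex[OF d] by blast
  define e where "e = g * (\<alpha> *\<^sub>R g + (st x * x) * g)"
  define z where "z = x * g"
  have pe: "p e \<le> d" unfolding e_def using p_mult_le[of g 1, OF _ gd] g by simp
  have se: "st e = e" unfolding e_def using g(1) by (simp add: st_simps distrib_left distrib_right mult.assoc)
  have zz: "st z * z = e - \<alpha> *\<^sub>R (g * g)"
    unfolding z_def e_def using g by (simp add: st_simps algebra_simps)
  define a1 where "a1 = (1/2) *\<^sub>R (z + st z)"
  define b1 where "b1 = - ((1/2) *\<^sub>R (J * (z - st z)))"
  have sa1: "st a1 = a1" "st b1 = b1"
    by (simp_all add: a1_def b1_def st_simps J_comm algebra_simps)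
  have z_ab: "z = a1 + J * b1"
    by (simp add: a1_def b1_def J_J_left scaleR_add_right[symmetric] scaleR_diff_right[symmetric]
        scaleR_half_double)
  then have sz: "st z = a1 - J * b1" using sa1 by (simp add: st_simps J_comm)
  have sum: "z * st z = 2 *\<^sub>R (a1 * a1) + 2 *\<^sub>R (b1 * b1) - st z * z"
  proof -
    have "(a1 + J * b1) * (a1 - J * b1) + (a1 - J * b1) * (a1 + J * b1)
        = 2 *\<^sub>R (a1 * a1) + 2 *\<^sub>R (b1 * b1)"
      by (simp add: distrib_left distrib_right left_diff_distrib right_diff_distrib mult.assoc
          J_J_left J_left_comm[of a1] J_left_comm[of b1] scaleR_2)
    then show ?thesis by (metis add_diff_cancel_right' sz z_ab)
  qed
  have "pos ((2 *\<^sub>R (a1 * a1) + 2 *\<^sub>R (b1 * b1) + \<alpha> *\<^sub>R (g * g)) + (d *\<^sub>R 1 - e))"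
    by (intro pos_add pos_scaleR pos_square pos_bounded) (use sa1 g a se pe in auto)
  also have "(2 *\<^sub>R (a1 * a1) + 2 *\<^sub>R (b1 * b1) + \<alpha> *\<^sub>R (g * g)) + (d *\<^sub>R 1 - e) = z * st z + d *\<^sub>R 1"
    unfolding sum zz by simp
  finally have "pos (st z * z + d *\<^sub>R 1)"
    by (rule pos_swap) (use d in auto)
  then have "pos ((st z * z + d *\<^sub>R 1) + (d *\<^sub>R 1 - e))"
    by (rule pos_add) (use se pe in \<open>auto intro: pos_bounded\<close>)
  also have "(st z * z + d *\<^sub>R 1) + (d *\<^sub>R 1 - e) = d *\<^sub>R 1 - (\<alpha> *\<^sub>R (g * g) - d *\<^sub>R 1)"
    unfolding zz by simp
  finally have 1: "pos (d *\<^sub>R 1 - (\<alpha> *\<^sub>R (g * g) - d *\<^sub>R 1))" .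
  \<comment> \<open>Together with \<open>1\<close> this places
    \<open>\<alpha> *\<^sub>R (g * g)\<close> between 0 and \<open>2 * d\<close>, while its seminorm
    is \<open>\<alpha> = 4 * d\<close>.\<close>
  have "pos (\<alpha> *\<^sub>R (g * g))" by (intro pos_scaleR pos_square) (use g a in auto)
  then have 2: "pos (d *\<^sub>R 1 + (\<alpha> *\<^sub>R (g * g) - d *\<^sub>R 1))" by simp
  have 3: "p (\<alpha> *\<^sub>R (g * g) - d *\<^sub>R 1) \<le> d"
    by (rule pos_norm_le[OF 1 2]) (use d in simp)
  have "\<alpha> = p (\<alpha> *\<^sub>R (g * g))" using g a p_sa_sq[of g] by (simp add: p_scaleR)
  also have "\<dots> \<le> p (\<alpha> *\<^sub>R (g * g) - d *\<^sub>R 1) + p (d *\<^sub>R 1)"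
    using p_add[of "\<alpha> *\<^sub>R (g * g) - d *\<^sub>R 1" "d *\<^sub>R 1"] by simp
  also have "\<dots> \<le> d + d * 1"
    by (intro add_mono 3) (use d p_one in \<open>simp add: p_scaleR\<close>)
  finally show False using a d_def by simp
qed

text \<open>With \<open>t = p (a + d)\<close> both \<open>a\<close> and
  \<open>t *\<^sub>R 1 - a\<close> are positive, so \<open>a - (t/2) *\<^sub>R 1\<close> lies
  between \<open>- t/2\<close> and \<open>t/2\<close> and \<open>pos_norm_le\<close>
  applies.\<close>

lemma pos_norm_mono:
  assumes "pos a" "pos d"
  shows "p a \<le> p (a + d)"
proof -
  define t where "t = p (a + d)"
  have t: "t \<ge> 0" by (simp add: t_def)
  have sb: "st (a + d) = a + d" using assms by (simp add: pos_sa st_add)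
  have "pos ((t *\<^sub>R 1 - (a + d)) + d)"
    by (intro pos_add pos_bounded) (use assms sb t_def in auto)
  moreover have "t *\<^sub>R (1 :: 't) = (t/2) *\<^sub>R 1 + (t/2) *\<^sub>R 1"
    by (simp flip: scaleR_add_left)
  ultimately have 1: "pos ((t/2) *\<^sub>R 1 - (a - (t/2) *\<^sub>R 1))"
    by (simp add: algebra_simps)
  have 2: "pos ((t/2) *\<^sub>R 1 + (a - (t/2) *\<^sub>R 1))" using assms by simp
  have 3: "p (a - (t/2) *\<^sub>R 1) \<le> t/2" by (rule pos_norm_le[OF 1 2]) (use t in simp)
  have "p a \<le> p (a - (t/2) *\<^sub>R 1) + p ((t/2) *\<^sub>R 1)"
    using p_add[of "a - (t/2) *\<^sub>R 1" "(t/2) *\<^sub>R 1"] by simp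
  also have "\<dots> \<le> t/2 + t/2 * 1" by (intro add_mono 3) (use t p_one in \<open>simp add: p_scaleR mult_left_le\<close>)
  finally show ?thesis by (simp add: t_def)
qed

section \<open>Cauchy-Schwarz and triangle inequality for finite sums with values in the
  algebra\<close>

lemma gram_mono:
  assumes "F \<subseteq> G" "finite G"
  shows "p (\<Sum>k\<in>F. st (x k) * x k) \<le> p (\<Sum>k\<in>G. st (x k) * x k)"
proof -
  have "(\<Sum>k\<in>G. st (x k) * x k) = (\<Sum>k\<in>F. st (x k) * x k) + (\<Sum>k\<in>G - F. st (x k) * x k)"
    using assms by (metis add.commute sum.subset_diff)
  then show ?thesis by (simp add: pos_norm_mono pos_sum pos_star_mult)
qed

text \<open>Expand the positive element \<open>D\<close> built from
  \<open>y k - l *\<^sub>R (x k * c)\<close>, where \<open>c\<close> is the inner product itself: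
  \<open>st c * c\<close> appears with factor \<open>2 * l\<close>, and monotonicity of the seminorm
  allows \<open>D\<close> to be dropped. What remains is a quadratic inequality in the real
  parameter \<open>l\<close>.\<close>

theorem gram_cauchy_schwarz:
  assumes "finite F"
  shows "(p (\<Sum>k\<in>F. st (x k) * y k))\<^sup>2 \<le> p (\<Sum>k\<in>F. st (x k) * x k) * p (\<Sum>k\<in>F. st (y k) * y k)"
proof -
  define c where "c = (\<Sum>k\<in>F. st (x k) * y k)"
  define X where "X = (\<Sum>k\<in>F. st (x k) * x k)"
  define Y where "Y = (\<Sum>k\<in>F. st (y k) * y k)"
  have sc: "st c = (\<Sum>k\<in>F. st (y k) * x k)" by (simp add: c_def st_sum st_mult)
  have *: "2 * l * (p c)\<^sup>2 \<le> p Y + l\<^sup>2 * ((p c)\<^sup>2 * p X)" if l: "l > 0" for l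
  proof -
    define D where "D = (\<Sum>k\<in>F. st (y k - l *\<^sub>R (x k * c)) * (y k - l *\<^sub>R (x k * c)))"
    have "D = (\<Sum>k\<in>F. st (y k) * y k - l *\<^sub>R ((st (y k) * x k) * c) - l *\<^sub>R (st c * (st (x k) * y k))
        + (l * l) *\<^sub>R (st c * (st (x k) * x k) * c))"
      unfolding D_def by (rule sum.cong) (simp_all add: st_simps algebra_simps)
    also have "\<dots> = Y - l *\<^sub>R (st c * c) - l *\<^sub>R (st c * c) + (l * l) *\<^sub>R (st c * X * c)"
      unfolding sum.distrib sum_subtractf scaleR_sum_right[symmetric]
        sum_distrib_left[symmetric] sum_distrib_right[symmetric]
        sc[symmetric] c_def[symmetric] X_def[symmetric] Y_def[symmetric] by simp
    finally have "D = Y - l *\<^sub>R (st c * c) - l *\<^sub>R (st c * c) + (l * l) *\<^sub>R (st c * X * c)" .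
    moreover have "(2 * l) *\<^sub>R (st c * c) = l *\<^sub>R (st c * c) + l *\<^sub>R (st c * c)"
      by (simp flip: scaleR_add_left)
    ultimately have D: "(2 * l) *\<^sub>R (st c * c) + D = Y + (l * l) *\<^sub>R (st c * X * c)"
      by simp
    have "2 * l * (p c)\<^sup>2 = p ((2 * l) *\<^sub>R (st c * c))" using l by (simp add: p_scaleR p_star)
    also have "\<dots> \<le> p ((2 * l) *\<^sub>R (st c * c) + D)"
      by (rule pos_norm_mono)
        (use l in \<open>auto simp: D_def intro!: pos_scaleR pos_sum pos_star_mult\<close>)
    also have "\<dots> \<le> p Y + l\<^sup>2 * ((p c * p X) * p c)"
      unfolding D
    proof (rule order_trans[OF p_add add_left_mono])
      show "p ((l * l) *\<^sub>R (st c * X * c)) \<le> l\<^sup>2 * (p c * p X * p c)"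
        unfolding p_scaleR using p_mult_le[OF p_mult_le[of "st c" "p c" X "p X"], of c "p c"]
        by (simp add: power2_eq_square mult_left_mono)
    qed
    finally show ?thesis by (simp add: power2_eq_square mult_ac)
  qed
  have "(p c)\<^sup>2 \<le> p X * p Y"
  proof (cases "p X > 0")
    case True
    \<comment> \<open>This value of \<open>l\<close> is optimal in the quadratic inequality.\<close>
    have "2 * (1 / p X) * (p c)\<^sup>2 \<le> p Y + (1 / p X)\<^sup>2 * ((p c)\<^sup>2 * p X)"
      using *[of "1 / p X"] True by simp
    then show ?thesis using True by (simp add: field_simps power2_eq_square)
  next
    case False
    then have X0: "p X = 0" using p_nonneg[of X] by linarith
    have "(p c)\<^sup>2 = 0"
    proof (rule ccontr)
      assume n: "(p c)\<^sup>2 \<noteq> 0"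
      \<comment> \<open>For \<open>p X = 0\<close> the inequality bounds a linear function of
        \<open>l\<close> by \<open>p Y\<close>; this \<open>l\<close> exceeds the bound.\<close>
      have "(p Y + 1) / (p c)\<^sup>2 > 0"
        using n p_nonneg[of Y] by (intro divide_pos_pos) (auto simp: add_nonneg_pos)
      then have "2 * ((p Y + 1) / (p c)\<^sup>2) * (p c)\<^sup>2 \<le> p Y"
        using *[of "(p Y + 1) / (p c)\<^sup>2"] by (simp only: X0) simp
      moreover have "2 * ((p Y + 1) / (p c)\<^sup>2) * (p c)\<^sup>2 = 2 * (p Y + 1)" using n by simp
      ultimately have "2 * (p Y + 1) \<le> p Y" by metis
      then show False using p_nonneg[of Y] by simp
    qed
    then show ?thesis using X0 by simp
  qed
  then show ?thesis by (simp add: c_def X_def Y_def)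
qed

lemma gram_triangle:
  assumes "finite F"
  shows "sqrt (p (\<Sum>k\<in>F. st (x k + y k) * (x k + y k)))
    \<le> sqrt (p (\<Sum>k\<in>F. st (x k) * x k)) + sqrt (p (\<Sum>k\<in>F. st (y k) * y k))"
proof -
  define c where "c = (\<Sum>k\<in>F. st (x k) * y k)"
  define X where "X = (\<Sum>k\<in>F. st (x k) * x k)"
  define Y where "Y = (\<Sum>k\<in>F. st (y k) * y k)"
  have sc: "st c = (\<Sum>k\<in>F. st (y k) * x k)" by (simp add: c_def st_sum st_mult)
  have "(\<Sum>k\<in>F. st (x k + y k) * (x k + y k)) = X + c + (st c + Y)"
    unfolding sc unfolding X_def Y_def c_def sum.distrib[symmetric]
    by (rule sum.cong) (simp_all add: st_add distrib_left distrib_right add.assoc)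
  then have "p (\<Sum>k\<in>F. st (x k + y k) * (x k + y k)) \<le> (p X + p c) + (p c + p Y)"
    using p_add[of "X + c" "st c + Y"] p_add[of X c] p_add[of "st c" Y] by simp
  also have "p c \<le> sqrt (p X) * sqrt (p Y)"
    unfolding real_sqrt_mult[symmetric]
    by (rule real_le_rsqrt) (use gram_cauchy_schwarz[OF assms, of x y] in \<open>simp add: c_def X_def Y_def\<close>)
  also have "p X + sqrt (p X) * sqrt (p Y) + (sqrt (p X) * sqrt (p Y) + p Y) = (sqrt (p X) + sqrt (p Y))\<^sup>2"
    by (simp add: power2_eq_square algebra_simps)
  finally have "p (\<Sum>k\<in>F. st (x k + y k) * (x k + y k)) \<le> (sqrt (p X) + sqrt (p Y))\<^sup>2"
    by simp
  then have "sqrt (p (\<Sum>k\<in>F. st (x k + y k) * (x k + y k))) \<le> sqrt (p X) + sqrt (p Y)"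
    by (intro real_le_lsqrt) simp_all
  then show ?thesis unfolding X_def Y_def .
qed

end

section \<open>Noncommutative star-polynomials over a type and their evaluation in a
  star-algebra\<close>

section \<open>The free star-algebra\<close>

text \<open>The letter \<open>(a, True)\<close> is the formal adjoint of the letter \<open>(a, False)\<close>.\<close>

datatype 'a star_word = Star_Word (letters: "('a \<times> bool) list")

instantiation star_word :: (type) monoid_add
begin
definition "0 = Star_Word []"
definition "v + w = Star_Word (letters v @ letters w)"
instance by standard (auto simp: zero_star_word_def plus_star_word_def)
end

lemma letters_zero [simp]: "letters 0 = []"
  by (simp add: zero_star_word_def)

lemma letters_add [simp]: "letters (v + w) = letters v @ letters w"
  by (simp add: plus_star_word_def)

type_synonym 'a free_star = "'a star_word \<Rightarrow>\<^sub>0 complex"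

lemma poly_mapping_monomials_induct [case_names single zero add]:
  fixes f :: "'k \<Rightarrow>\<^sub>0 'c::comm_monoid_add"
  assumes "\<And>k v. P (Poly_Mapping.single k v)" "P 0" "\<And>f g. P f \<Longrightarrow> P g \<Longrightarrow> P (f + g)"
  shows "P f"
proof -
  have "P (\<Sum>k\<in>F. Poly_Mapping.single k (Poly_Mapping.lookup f k))" for F
    by (induction F rule: infinite_finite_induct) (auto intro: assms)
  moreover have "f = (\<Sum>k\<in>Poly_Mapping.keys f. Poly_Mapping.single k (Poly_Mapping.lookup f k))"
    by (rule poly_mapping_eqI)
      (auto simp: lookup_sum lookup_single when_def sum.delta in_keys_iff)
  ultimately show ?thesis by metis
qed

lemma single_central:
  fixes f :: "'k::monoid_add \<Rightarrow>\<^sub>0 'c::semiring_0"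
  assumes "\<And>d. c * d = d * c"
  shows "Poly_Mapping.single 0 c * f = f * Poly_Mapping.single 0 c"
  by (induction f rule: poly_mapping_monomials_induct)
    (simp_all add: mult_single distrib_left distrib_right assms)

text \<open>Scalars act through constant polynomials, so the algebra laws reduce to ring laws and to
  the centrality of real constants.\<close>

instantiation poly_mapping :: (monoid_add, real_algebra_1) real_algebra_1
begin

definition scaleR_poly_mapping :: "real \<Rightarrow> ('a \<Rightarrow>\<^sub>0 'b) \<Rightarrow> 'a \<Rightarrow>\<^sub>0 'b" where
  "scaleR r f = Poly_Mapping.single 0 (of_real r) * f"

instance
proof
  fix a b :: real and x y :: "'a \<Rightarrow>\<^sub>0 'b"
  have central: "Poly_Mapping.single 0 (of_real a) * z = z * Poly_Mapping.single 0 (of_real a)"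
    for z :: "'a \<Rightarrow>\<^sub>0 'b"
    by (rule single_central) (simp add: of_real_def)
  show "a *\<^sub>R (x + y) = a *\<^sub>R x + a *\<^sub>R y"
    by (simp add: scaleR_poly_mapping_def distrib_left)
  show "(a + b) *\<^sub>R x = a *\<^sub>R x + b *\<^sub>R x"
    by (simp add: scaleR_poly_mapping_def distrib_right single_add)
  show "a *\<^sub>R b *\<^sub>R x = (a * b) *\<^sub>R x"
    by (simp add: scaleR_poly_mapping_def mult_single mult.assoc[symmetric])
  show "1 *\<^sub>R x = x"
    by (simp add: scaleR_poly_mapping_def)
  show "a *\<^sub>R x * y = a *\<^sub>R (x * y)"
    by (simp add: scaleR_poly_mapping_def mult.assoc)
  show "x * a *\<^sub>R y = a *\<^sub>R (x * y)"
    unfolding scaleR_poly_mapping_def by (metis central mult.assoc)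
qed

end

definition flip_word :: "'a star_word \<Rightarrow> 'a star_word" where
  "flip_word w = Star_Word (rev (map (\<lambda>(a, b). (a, \<not> b)) (letters w)))"

lemma flip_flip_word [simp]: "flip_word (flip_word w) = w"
  by (simp add: flip_word_def rev_map comp_def case_prod_unfold)

lemma flip_word_add: "flip_word (v + w) = flip_word w + flip_word v"
  by (simp add: flip_word_def plus_star_word_def)

lemma flip_word_zero [simp]: "flip_word 0 = 0"
  by (simp add: flip_word_def zero_star_word_def)

lift_definition free_adj :: "'a free_star \<Rightarrow> 'a free_star" is "\<lambda>f w. cnj (f (flip_word w))"
proof -
  fix f :: "'a star_word \<Rightarrow> complex"
  assume "finite {w. f w \<noteq> 0}"
  moreover have "{w. cnj (f (flip_word w)) \<noteq> 0} \<subseteq> flip_word ` {w. f w \<noteq> 0}"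
    by (auto simp: image_iff) (metis flip_flip_word)
  ultimately show "finite {w. cnj (f (flip_word w)) \<noteq> 0}"
    by (meson finite_imageI finite_subset)
qed

lemma free_adj_add: "free_adj (f + g) = free_adj f + free_adj g"
  by (rule poly_mapping_eqI) (simp add: free_adj.rep_eq lookup_add)

lemma free_adj_zero [simp]: "free_adj 0 = 0"
  by (rule poly_mapping_eqI) (simp add: free_adj.rep_eq)

lemma free_adj_single: "free_adj (Poly_Mapping.single w c) = Poly_Mapping.single (flip_word w) (cnj c)"
  by (rule poly_mapping_eqI) (auto simp: free_adj.rep_eq lookup_single when_def)

lemma free_adj_mult: "free_adj (f * g) = free_adj g * free_adj f"
proof (induction f rule: poly_mapping_monomials_induct)
  case (single k v)
  show ?case
    by (induction g rule: poly_mapping_monomials_induct)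
      (simp_all add: free_adj_single mult_single flip_word_add free_adj_add distrib_left distrib_right mult.commute)
qed (simp_all add: free_adj_add distrib_left distrib_right)

definition free_J :: "'a free_star" where
  "free_J = Poly_Mapping.single 0 \<i>"

lemma complex_star_ring_free: "complex_star_ring free_adj free_J"
proof
  fix x y :: "'a free_star" and r :: real
  show "free_adj (free_adj x) = x"
    by (rule poly_mapping_eqI) (simp add: free_adj.rep_eq)
  show "free_adj (r *\<^sub>R x) = r *\<^sub>R free_adj x"
    by (simp add: scaleR_poly_mapping_def free_adj_mult free_adj_single single_central mult.commute)
  show "free_adj free_J = - (free_J :: 'a free_star)"
    by (simp add: free_J_def free_adj_single single_uminus)
  show "free_J * free_J = (- 1 :: 'a free_star)"
    by (simp add: free_J_def mult_single single_uminus)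
  show "x * free_J = free_J * x"
    unfolding free_J_def by (rule single_central[symmetric]) (simp add: mult.commute)
qed (fact free_adj_add free_adj_mult)+

definition gen :: "'a \<Rightarrow> 'a free_star" where
  "gen a = Poly_Mapping.single (Star_Word [(a, False)]) 1"

context star_algebra
begin

lemma cscale_zero_left: "x \<in> carrier A \<Longrightarrow> cscale A 0 x = \<zero>"
  using cscale_add_left[of x 0 0] cscale_closed[of x 0]
  by (metis add.l_cancel_one' add_0)

lemma cscale_zero_right [simp]: "cscale A c \<zero> = \<zero>"
  by (metis cscale_cscale cscale_zero_left mult_zero_right zero_closed)

lemma cscale_minus: "x \<in> carrier A \<Longrightarrow> cscale A (-1) x = \<ominus> x"
proof -
  assume x: "x \<in> carrier A"
  have "cscale A (-1) x \<oplus> x = cscale A (-1 + 1) x"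
    using x cscale_add_left[of x "-1" 1] by (simp add: cscale_one)
  then show ?thesis
    using x by (simp add: cscale_zero_left cscale_closed minus_equality)
qed

lemma star_zero [simp]: "star A \<zero> = \<zero>"
  using star_add[of \<zero> \<zero>] star_closed[of \<zero>] by (metis add.l_cancel_one' r_zero zero_closed)

lemma star_one [simp]: "star A \<one> = \<one>"
  by (metis l_one one_closed r_one star_closed star_mult star_star)

lemma star_minus: "x \<in> carrier A \<Longrightarrow> star A (\<ominus> x) = \<ominus> star A x"
  by (metis add.inv_closed add.inv_equality r_neg star_add star_closed star_zero a_comm)

lemma star_diff: "\<lbrakk>x \<in> carrier A; y \<in> carrier A\<rbrakk> \<Longrightarrow> star A (x \<ominus> y) = star A x \<ominus> star A y"
  by (simp add: a_minus_def star_add star_minus)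

lemma star_finsum:
  "f \<in> F \<rightarrow> carrier A \<Longrightarrow> star A (\<Oplus>k\<in>F. f k) = (\<Oplus>k\<in>F. star A (f k))"
proof (induction F rule: infinite_finite_induct)
  case (insert x F)
  then have "f \<in> F \<rightarrow> carrier A" "f x \<in> carrier A" by auto
  moreover have "(\<lambda>k. star A (f k)) \<in> F \<rightarrow> carrier A" using insert by (auto intro: star_closed)
  ultimately show ?case using insert by (simp add: star_add star_closed finsum_insert)
qed simp_all

text \<open>Letters range over the whole type; those outside the carrier evaluate to zero, so that
  \<open>free_eval\<close> is total and maps into the carrier.\<close>

definition letter_val :: "'a \<times> bool \<Rightarrow> 'a" where
  "letter_val l = (if fst l \<in> carrier A then if snd l then star A (fst l) else fst l else \<zero>)"

definition word_val :: "'a star_word \<Rightarrow> 'a" where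
  "word_val w = foldr (\<lambda>l x. letter_val l \<otimes> x) (letters w) \<one>"

definition free_eval :: "'a free_star \<Rightarrow> 'a" where
  "free_eval f = (\<Oplus>w\<in>Poly_Mapping.keys f. cscale A (Poly_Mapping.lookup f w) (word_val w))"

lemma letter_val_closed [simp]: "letter_val l \<in> carrier A"
  by (simp add: letter_val_def star_closed)

lemma foldr_letter_val_closed [simp]: "foldr (\<lambda>l x. letter_val l \<otimes> x) ls \<one> \<in> carrier A"
  by (induction ls) auto

lemma word_val_closed [simp]: "word_val w \<in> carrier A"
  by (simp add: word_val_def)

lemma foldr_letter_val_append:
  "foldr (\<lambda>l x. letter_val l \<otimes> x) (ls @ ms) \<one>
    = foldr (\<lambda>l x. letter_val l \<otimes> x) ls \<one> \<otimes> foldr (\<lambda>l x. letter_val l \<otimes> x) ms \<one>"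
proof (induction ls)
  case (Cons l ls)
  show ?case
    using foldr_letter_val_closed[of ls] foldr_letter_val_closed[of ms]
    by (simp only: append_Cons foldr_Cons comp_def Cons m_assoc letter_val_closed)
next
  case Nil
  then show ?case using foldr_letter_val_closed[of ms] by (simp only: append_Nil foldr_Nil id_def l_one)
qed

lemma word_val_add: "word_val (v + w) = word_val v \<otimes> word_val w"
  by (simp only: word_val_def letters_add foldr_letter_val_append)

lemma word_val_zero [simp]: "word_val 0 = \<one>"
  by (simp add: word_val_def)

lemma letter_val_flip: "letter_val (a, \<not> b) = star A (letter_val (a, b))"
  by (simp add: letter_val_def star_star)

lemma word_val_flip: "word_val (flip_word w) = star A (word_val w)"
proof -
  have "foldr (\<lambda>l x. letter_val l \<otimes> x) (rev (map (\<lambda>(a, b). (a, \<not> b)) ls)) \<one>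
      = star A (foldr (\<lambda>l x. letter_val l \<otimes> x) ls \<one>)" for ls
  proof (induction ls)
    case (Cons l ls)
    obtain a b where l: "l = (a, b)" by (cases l)
    show ?case
      unfolding l list.map rev.simps foldr_letter_val_append Cons
      by (simp add: letter_val_flip star_mult star_closed)
  qed simp
  then show ?thesis by (simp add: word_val_def flip_word_def)
qed

lemma free_eval_superset:
  assumes "finite W" "Poly_Mapping.keys f \<subseteq> W"
  shows "free_eval f = (\<Oplus>w\<in>W. cscale A (Poly_Mapping.lookup f w) (word_val w))"
  unfolding free_eval_def
  by (rule add.finprod_mono_neutral_cong_left)
    (use assms in \<open>auto simp: cscale_closed cscale_zero_left in_keys_iff\<close>)

lemma free_eval_closed [simp]: "free_eval f \<in> carrier A"
  by (simp add: free_eval_def cscale_closed Pi_def finsum_closed)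

lemma free_eval_zero [simp]: "free_eval 0 = \<zero>"
  by (simp add: free_eval_def)

lemma free_eval_add: "free_eval (f + g) = free_eval f \<oplus> free_eval g"
proof -
  let ?W = "Poly_Mapping.keys f \<union> Poly_Mapping.keys g"
  have "free_eval (f + g) = (\<Oplus>w\<in>?W. cscale A (Poly_Mapping.lookup (f + g) w) (word_val w))"
    by (rule free_eval_superset) (simp_all add: keys_add)
  also have "\<dots> = (\<Oplus>w\<in>?W. cscale A (Poly_Mapping.lookup f w) (word_val w) \<oplus> cscale A (Poly_Mapping.lookup g w) (word_val w))"
    by (simp add: lookup_add cscale_add_left)
  also have "\<dots> = (\<Oplus>w\<in>?W. cscale A (Poly_Mapping.lookup f w) (word_val w)) \<oplus> (\<Oplus>w\<in>?W. cscale A (Poly_Mapping.lookup g w) (word_val w))"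
    by (rule finsum_addf) (auto intro: cscale_closed)
  finally show ?thesis
    by (simp add: free_eval_superset[of ?W f] free_eval_superset[of ?W g])
qed

lemma free_eval_single: "free_eval (Poly_Mapping.single w c) = cscale A c (word_val w)"
proof -
  have "free_eval (Poly_Mapping.single w c)
      = (\<Oplus>v\<in>{w}. cscale A (Poly_Mapping.lookup (Poly_Mapping.single w c) v) (word_val v))"
    by (rule free_eval_superset) (auto split: if_splits)
  then show ?thesis by (simp add: cscale_closed)
qed

lemma free_eval_mult: "free_eval (f * g) = free_eval f \<otimes> free_eval g"
proof (induction f rule: poly_mapping_monomials_induct)
  case (single k v)
  show ?case
    by (induction g rule: poly_mapping_monomials_induct)
      (simp_all add: free_eval_single mult_single word_val_add free_eval_add distrib_left r_distr
        cscale_mult_left cscale_mult_right cscale_cscale cscale_closed mult.commute)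
qed (simp_all add: free_eval_add distrib_right l_distr)

lemma free_eval_adj: "free_eval (free_adj f) = star A (free_eval f)"
  by (induction f rule: poly_mapping_monomials_induct)
    (simp_all add: free_adj_single free_eval_single word_val_flip star_cscale free_adj_add
      free_eval_add star_add)

lemma free_eval_one [simp]: "free_eval 1 = \<one>"
  using free_eval_single[of 0 1] by (simp add: cscale_one)

lemma free_eval_const_mult: "free_eval (Poly_Mapping.single 0 c * f) = cscale A c (free_eval f)"
  by (simp add: free_eval_mult free_eval_single cscale_mult_left)

lemma free_eval_scaleR: "free_eval (r *\<^sub>R f) = cscale A (of_real r) (free_eval f)"
  by (simp add: scaleR_poly_mapping_def free_eval_const_mult)

lemma free_eval_J: "free_eval free_J = cscale A \<i> \<one>"
  by (simp add: free_J_def free_eval_single)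

lemma free_eval_minus: "free_eval (- f) = \<ominus> free_eval f"
  using free_eval_scaleR[of "-1" f] by (simp add: cscale_minus)

lemma free_eval_diff: "free_eval (f - g) = free_eval f \<ominus> free_eval g"
  using free_eval_add[of f "- g"] by (simp add: free_eval_minus a_minus_def)

lemma free_eval_gen [simp]: "a \<in> carrier A \<Longrightarrow> free_eval (gen a) = a"
  by (simp add: gen_def free_eval_single word_val_def letter_val_def cscale_one)

lemma free_eval_sum: "free_eval (sum f F) = (\<Oplus>k\<in>F. free_eval (f k))"
  by (induction F rule: infinite_finite_induct) (simp_all add: free_eval_add)

text \<open>The pulled-back seminorm vanishes on the kernel of the evaluation. This is why the
  type-based locales allow seminorms with a kernel: a relation of \<open>A\<close> becomes the
  vanishing of a seminorm.\<close>

lemma cstar_seminormed_free_eval: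
  assumes "cstar_seminorm A p"
  shows "cstar_seminormed free_adj free_J (\<lambda>f. p (free_eval f))"
proof -
  interpret complex_star_ring free_adj "free_J :: 'a free_star" by (rule complex_star_ring_free)
  show ?thesis
    by standard
      (use assms in \<open>simp_all add: cstar_seminorm_def free_eval_add free_eval_mult free_eval_scaleR
        free_eval_J free_eval_adj cscale_mult_left\<close>)
qed

end

section \<open>Exponentials, quotient seminorms and the lifting of unitary paths in a complete
  star-ring\<close>

section \<open>Lifting unitaries modulo an ideal\<close>

text \<open>Common ground of the C*-seminorms and of the quotient seminorms \<open>q n\<close>
  below. The C*-identity for a quotient seminorm is usually drawn from an approximate unit of the
  ideal, whereas these inequalities follow directly from the infimum; the estimates for exponentials
  are therefore proved at this level.\<close>

locale star_seminormed = complex_star_ring st J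
  for st :: "'t::real_algebra_1 \<Rightarrow> 't" and J +
  fixes r :: "'t \<Rightarrow> real"
  assumes r_nonneg [simp]: "0 \<le> r x"
    and r_add: "r (x + y) \<le> r x + r y"
    and r_scaleR: "r (c *\<^sub>R x) \<le> \<bar>c\<bar> * r x"
    and r_J: "r (J * x) \<le> r x"
    and r_mult: "r (x * y) \<le> r x * r y"
    and r_st: "r (st x) \<le> r x"
    and r_one: "r 1 \<le> 1"
begin

lemma r_zero [simp]: "r 0 = 0"
  using r_scaleR[of 0 0] r_nonneg[of 0] by simp

lemma r_minus [simp]: "r (- x) = r x"
  using r_scaleR[of "-1" x] r_scaleR[of "-1" "-x"] by simp

lemma r_diff: "r (x - y) \<le> r x + r y"
  using r_add[of x "-y"] by simp

lemma r_commute: "r (x - y) = r (y - x)"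
  by (metis minus_diff_eq r_minus)

lemma r_triangle: "r (x - z) \<le> r (x - y) + r (y - z)"
  using r_add[of "x - y" "y - z"] by simp

lemma r_mult_le: "\<lbrakk>r x \<le> a; r y \<le> b\<rbrakk> \<Longrightarrow> r (x * y) \<le> a * b"
  by (meson mult_mono order_trans r_mult r_nonneg)

lemma r_power_le: "r x \<le> b \<Longrightarrow> r (x ^ n) \<le> b ^ n"
  by (induction n) (simp_all add: r_one r_mult_le)

lemma r_power_diff:
  assumes "r x \<le> B" "r y \<le> B" "1 \<le> B"
  shows "r (x ^ M - y ^ M) \<le> real M * B ^ M * r (x - y)"
proof (induction M)
  case (Suc M)
  have "x ^ Suc M - y ^ Suc M = x * (x ^ M - y ^ M) + (x - y) * y ^ M"
    by (simp add: algebra_simps)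
  then have "r (x ^ Suc M - y ^ Suc M) \<le> B * (real M * B ^ M * r (x - y)) + r (x - y) * B ^ M"
    using r_add[of "x * (x ^ M - y ^ M)" "(x - y) * y ^ M"]
      r_mult_le[OF assms(1) Suc] r_mult_le[of "x - y" "r (x - y)", OF _ r_power_le[OF assms(2), of M]]
    by simp
  also have "r (x - y) * B ^ M \<le> r (x - y) * B ^ Suc M"
    by (intro mult_left_mono power_increasing) (use assms in auto)
  finally show ?case by (simp add: algebra_simps)
qed simp

text \<open>Recursively, the remainder is multiplied by \<open>1 + x\<close> and gains
  \<open>real M *\<^sub>R (x * x)\<close>. For \<open>x\<close> of size \<open>r h / M\<close> the
  bound stays below \<open>(r h)^2 * exp (r h)\<close>, which is how it is used.\<close>

lemma r_power_linear:
  "r ((1 + x) ^ M - 1 - real M *\<^sub>R x) \<le> (real M)\<^sup>2 * (r x)\<^sup>2 * (1 + r x) ^ M"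
proof (induction M)
  case (Suc M)
  define a where "a = r x"
  have a: "a \<ge> 0" by (simp add: a_def)
  have x1: "r (1 + x) \<le> 1 + a" using r_add[of 1 x] r_one by (simp add: a_def)
  have "(1 + x) ^ Suc M - 1 - real (Suc M) *\<^sub>R x
      = (1 + x) * ((1 + x) ^ M - 1 - real M *\<^sub>R x) + real M *\<^sub>R (x * x)"
    by (simp add: algebra_simps)
  then have "r ((1 + x) ^ Suc M - 1 - real (Suc M) *\<^sub>R x)
      \<le> (1 + a) * ((real M)\<^sup>2 * a\<^sup>2 * (1 + a) ^ M) + real M * (a * a)"
    using r_add[of "(1 + x) * ((1 + x) ^ M - 1 - real M *\<^sub>R x)" "real M *\<^sub>R (x * x)"]
      r_mult_le[OF x1 Suc] r_scaleR[of "real M" "x * x"]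
      mult_left_mono[OF r_mult[of x x], of "real M"]
    by (simp add: a_def)
  also have "real M * (a * a) \<le> (2 * real M + 1) * a\<^sup>2 * (1 + a) ^ Suc M"
  proof -
    have "real M * (a * a) * 1 \<le> ((2 * real M + 1) * a\<^sup>2) * (1 + a) ^ Suc M"
      by (rule mult_mono) (use a in \<open>auto simp: power2_eq_square intro!: mult_right_mono one_le_power simp del: power_Suc\<close>)
    then show ?thesis by simp
  qed
  finally show ?case
    by (simp add: a_def[symmetric] power2_eq_square algebra_simps)
qed simp

end

lemma (in cstar_seminormed) star_seminormed: "star_seminormed st J p"
  by standard (auto intro: p_add p_mult p_one simp: p_scaleR p_J)

text \<open>The seminorms need not separate points. The zero seminorm \<open>p 0\<close> makes the smallness hypothesis of
  the first lifting step below vacuous.\<close>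

locale complete_star_ring = complex_star_ring st J
  for st :: "'t::real_algebra_1 \<Rightarrow> 't" and J +
  fixes p :: "nat \<Rightarrow> 't \<Rightarrow> real" and K :: "'t set"
  assumes seminormed: "cstar_seminormed st J (p n)"
    and p_Suc: "p n x \<le> p (Suc n) x"
    and p_0: "p 0 x = 0"
    and complete: "(\<And>n e. e > 0 \<Longrightarrow> \<exists>N. \<forall>i\<ge>N. \<forall>j\<ge>N. p n (s i - s j) < e) \<Longrightarrow>
      \<exists>l. \<forall>n. (\<lambda>i. p n (s i - l)) \<longlonglongrightarrow> 0"
    and K_zero: "0 \<in> K"
    and K_add: "x \<in> K \<Longrightarrow> y \<in> K \<Longrightarrow> x + y \<in> K"
    and K_mult_left: "x \<in> K \<Longrightarrow> y * x \<in> K"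
    and K_mult_right: "x \<in> K \<Longrightarrow> x * y \<in> K"
    and K_st: "x \<in> K \<Longrightarrow> st x \<in> K"
    and K_closed: "(\<And>n e. e > 0 \<Longrightarrow> \<exists>k\<in>K. p n (x - k) < e) \<Longrightarrow> x \<in> K"
begin

sublocale p: cstar_seminormed st J "p n" for n
  by (rule seminormed)

sublocale p: star_seminormed st J "p n" for n
  by (rule p.star_seminormed)

lemma K_scaleR: "x \<in> K \<Longrightarrow> c *\<^sub>R x \<in> K"
  using K_mult_left[of x "c *\<^sub>R 1"] by simp

lemma K_minus: "x \<in> K \<Longrightarrow> - x \<in> K"
  using K_scaleR[of x "-1"] by simp

lemma K_diff: "x \<in> K \<Longrightarrow> y \<in> K \<Longrightarrow> x - y \<in> K"
  using K_add[of x "- y"] K_minus by simp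

text \<open>Closedness puts the common kernel of the seminorms into \<open>K\<close>; this turns
  identities that hold only up to that kernel into congruences modulo \<open>K\<close>.\<close>

lemma K_null: "(\<And>n. p n x = 0) \<Longrightarrow> x \<in> K"
  by (rule K_closed) (auto intro: bexI[of _ 0] K_zero)

lemma p_mono: "m \<le> n \<Longrightarrow> p m x \<le> p n x"
  by (rule lift_Suc_mono_le[of "\<lambda>n. p n x"]) (rule p_Suc)

lemma complete_geometric:
  assumes "\<And>n. \<exists>C N. \<forall>i\<ge>N. p n (s (Suc i) - s i) \<le> C * (1/2) ^ i"
  shows "\<exists>l. \<forall>n. (\<lambda>i. p n (s i - l)) \<longlonglongrightarrow> 0"
proof (rule complete)
  fix n and e :: real assume e: "e > 0"
  obtain C N where N: "\<And>i. i \<ge> N \<Longrightarrow> p n (s (Suc i) - s i) \<le> C * (1/2) ^ i"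
    using assms[of n] by blast
  have "C * (1/2) ^ N \<ge> 0" using N[of N] p.p_nonneg order_trans by blast
  then have C: "C \<ge> 0" by (metis half_gt_zero mult_less_cancel_right_pos not_le zero_less_power zero_less_one mult_zero_left)
  \<comment> \<open>The factor \<open>1 - (1/2) ^ k\<close> is the exact geometric sum, which lets
    the induction on \<open>k\<close> close.\<close>
  have *: "p n (s (i + k) - s i) \<le> 2 * C * (1/2) ^ i * (1 - (1/2) ^ k)" if "i \<ge> N" for i k
  proof (induction k)
    case (Suc k)
    have "p n (s (i + Suc k) - s i) \<le> p n (s (Suc (i + k)) - s (i + k)) + p n (s (i + k) - s i)"
      using p.p_triangle[of n "s (i + Suc k)" "s i" "s (i + k)"] by simp
    also have "\<dots> \<le> C * (1/2) ^ (i + k) + 2 * C * (1/2) ^ i * (1 - (1/2) ^ k)"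
      by (intro add_mono Suc N) (use that in simp)
    finally show ?case by (simp add: power_add algebra_simps)
  qed simp
  have **: "p n (s (i + k) - s i) \<le> 2 * C * (1/2) ^ i" if "i \<ge> N" for i k
  proof (rule order_trans[OF *[OF that]])
    show "2 * C * (1/2) ^ i * (1 - (1/2) ^ k) \<le> 2 * C * (1/2) ^ i"
      using C by (simp add: mult_left_le)
  qed
  have "(\<lambda>i. 2 * C * (1/2::real) ^ i) \<longlonglongrightarrow> 2 * C * 0"
    by (intro tendsto_intros LIMSEQ_power_zero) simp
  then have "\<forall>\<^sub>F i in sequentially. 2 * C * (1/2) ^ i < e"
    using e by (intro order_tendstoD(2)[where y = "2 * C * 0"]) simp_all
  then obtain M where M: "\<And>i. i \<ge> M \<Longrightarrow> 2 * C * (1/2) ^ i < e"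
    unfolding eventually_sequentially by blast
  have le: "p n (s j - s i) < e" if "i \<ge> max M N" "j \<ge> i" for i j
    using **[of i "j - i"] M[of i] that by simp
  show "\<exists>N. \<forall>i\<ge>N. \<forall>j\<ge>N. p n (s i - s j) < e"
    by (intro exI[of _ "max M N"] allI impI) (metis le nat_le_linear p.p_commute)
qed

subsection \<open>Exponentials\<close>

text \<open>The compound-interest form of the exponential of \<open>i h\<close>. Exponents that are
  powers of 2 relate consecutive terms by squaring the base, and the form of the base makes
  unitarity a statement about powers of \<open>1 + h^2 / 4^k\<close>.\<close>

definition exp_approx :: "'t \<Rightarrow> nat \<Rightarrow> 't" where
  "exp_approx h k = (1 + (1 / 2 ^ k) *\<^sub>R (J * h)) ^ (2 ^ k)"

text \<open>Limits are determined only up to elements on which all seminorms vanish, hence the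
  choice; later facts about \<open>iexp\<close> are stated through seminorms or modulo
  \<open>K\<close>.\<close>

definition iexp :: "'t \<Rightarrow> 't" where
  "iexp h = (SOME l. \<forall>n. (\<lambda>k. p n (exp_approx h k - l)) \<longlonglongrightarrow> 0)"

lemma base_bound:
  assumes "star_seminormed st J r" "r h \<le> R"
  shows "r (1 + (1 / M) *\<^sub>R (J * h)) \<le> 1 + R / \<bar>M\<bar>"
proof -
  interpret star_seminormed st J r by fact
  have "r ((1 / M) *\<^sub>R (J * h)) \<le> \<bar>1 / M\<bar> * r (J * h)" by (rule r_scaleR)
  also have "\<dots> \<le> \<bar>1 / M\<bar> * R"
    by (rule mult_left_mono) (use r_J[of h] assms(2) in auto)
  finally show ?thesis
    using r_add[of 1 "(1 / M) *\<^sub>R (J * h)"] r_one by simp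
qed

lemma pow_le_exp: "0 \<le> R \<Longrightarrow> (1 + R / 2 ^ k) ^ (2 ^ k) \<le> exp (R::real)"
  using exp_ge_one_plus_x_over_n_power_n[of "2 ^ k" R]
  by (simp add: order_trans[of "- (2 ^ k)" 0])

text \<open>The square of the base at stage \<open>k + 1\<close> differs from the base at stage
  \<open>k\<close> by the square of \<open>J * h\<close> divided by \<open>4 ^ Suc k\<close>.
  Raising to the power \<open>2 ^ k\<close> costs a factor of at most
  \<open>2 ^ k * exp (p n h)\<close>, so consecutive terms differ by a multiple of
  \<open>(1/2) ^ k\<close>.\<close>

lemma exp_approx_tendsto: "(\<lambda>k. p n (exp_approx h k - iexp h)) \<longlonglongrightarrow> 0"
proof -
  have "\<exists>l. \<forall>n. (\<lambda>k. p n (exp_approx h k - l)) \<longlonglongrightarrow> 0"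
  proof (rule complete_geometric)
    fix n
    define R where "R = p n h"
    have R: "R \<ge> 0" by (simp add: R_def)
    have "p n (exp_approx h (Suc k) - exp_approx h k) \<le> (exp R * R\<^sup>2) * (1/2) ^ k" for k
    proof -
      define u where "u = 1 + (1 / 2 ^ Suc k) *\<^sub>R (J * h)"
      define v where "v = 1 + (1 / 2 ^ k) *\<^sub>R (J * h)"
      define B where "B = (1 + R / 2 ^ Suc k)\<^sup>2"
      have pu: "p n u \<le> 1 + R / 2 ^ Suc k"
        using base_bound[OF p.star_seminormed, of n h R "2 ^ Suc k"] by (simp add: u_def R_def)
      have pu2: "p n (u * u) \<le> B"
        unfolding B_def power2_eq_square by (rule p.p_mult_le[OF pu pu])
      have "p n v \<le> 1 + R / 2 ^ k"
        using base_bound[OF p.star_seminormed, of n h R "2 ^ k"] by (simp add: v_def R_def)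
      also have "\<dots> \<le> B" by (simp add: B_def power2_eq_square algebra_simps)
      finally have pv: "p n v \<le> B" .
      have "u * u - v = (1 / 4 ^ Suc k) *\<^sub>R (J * h * (J * h))"
      proof -
        define c :: real where "c = 1 / 2 ^ Suc k"
        have c: "1 / 2 ^ k = c + c" "1 / 4 ^ Suc k = c * c"
          by (simp_all add: c_def power_mult_distrib[symmetric])
        have "v = 1 + (c *\<^sub>R (J * h) + c *\<^sub>R (J * h))"
          by (simp only: v_def c scaleR_add_left)
        then show ?thesis
          unfolding u_def c(2) c_def[symmetric] by (simp add: algebra_simps)
      qed
      then have "p n (u * u - v) = (1 / 4 ^ Suc k) * p n (J * h * (J * h))"
        by (simp only: p.p_scaleR) simp
      also have "\<dots> \<le> (1 / 4 ^ Suc k) * (R * R)"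
        by (intro mult_left_mono p.p_mult_le) (simp_all add: p.p_J R_def)
      finally have d: "p n (u * u - v) \<le> R\<^sup>2 / 4 ^ Suc k" by (simp add: power2_eq_square)
      have "exp_approx h (Suc k) = (u * u) ^ (2 ^ k)"
        by (simp add: exp_approx_def u_def power2_eq_square[symmetric] power_mult[symmetric])
      then have "p n (exp_approx h (Suc k) - exp_approx h k) = p n ((u * u) ^ (2 ^ k) - v ^ (2 ^ k))"
        by (simp add: exp_approx_def v_def)
      also have "\<dots> \<le> real (2 ^ k) * B ^ (2 ^ k) * p n (u * u - v)"
        by (rule p.r_power_diff[OF pu2 pv]) (use R in \<open>simp add: B_def\<close>)
      also have "B ^ (2 ^ k) = (1 + R / 2 ^ Suc k) ^ (2 ^ Suc k)"
        by (simp add: B_def power_mult[symmetric])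
      also have "real (2 ^ k) * (1 + R / 2 ^ Suc k) ^ (2 ^ Suc k) * p n (u * u - v)
          \<le> real (2 ^ k) * exp R * (R\<^sup>2 / 4 ^ Suc k)"
        by (intro mult_mono d pow_le_exp R) (use R in auto)
      also have "\<dots> = (exp R * R\<^sup>2) * (1/2) ^ k / 4"
        by (simp add: power_divide) (simp add: power_mult_distrib[symmetric] field_simps)
      also have "\<dots> \<le> (exp R * R\<^sup>2) * (1/2) ^ k" by simp
      finally show ?thesis .
    qed
    then show "\<exists>C N. \<forall>k\<ge>N. p n (exp_approx h (Suc k) - exp_approx h k) \<le> C * (1/2) ^ k"
      by blast
  qed
  then show ?thesis unfolding iexp_def by (rule someI2_ex) blast
qed

text \<open>Convergence is known for \<open>p n\<close>; the estimate is wanted for a smaller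
  seminorm \<open>r\<close>, such as \<open>q n\<close>, in which the elements may be much closer.
  It passes to the limit because \<open>r\<close> is dominated by \<open>p n\<close>.\<close>

lemma limit_dist_le:
  assumes r: "star_seminormed st J r" "\<And>x. r x \<le> p n x"
    and s: "(\<lambda>k. p n (s k - l)) \<longlonglongrightarrow> 0" and t: "(\<lambda>k. p n (t k - m)) \<longlonglongrightarrow> 0"
    and b: "\<And>k. r (s k - t k) \<le> b k" "b \<longlonglongrightarrow> c"
  shows "r (l - m) \<le> c"
proof -
  interpret star_seminormed st J r by fact
  have "r (l - m) \<le> p n (s k - l) + b k + p n (t k - m)" for k
    using r_triangle[of l m "s k"] r_triangle[of "s k" m "t k"] r(2)[of "s k - l"] r(2)[of "t k - m"]
      b(1)[of k] r_commute[of l "s k"] by linarith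
  moreover have "(\<lambda>k. p n (s k - l) + b k + p n (t k - m)) \<longlonglongrightarrow> 0 + c + 0"
    by (intro tendsto_intros s t b)
  ultimately show ?thesis
    by (intro LIMSEQ_le_const[of _ c]) auto
qed

lemma iexp_dist:
  assumes r: "star_seminormed st J r" "\<And>x. r x \<le> p n x"
    and R: "r h \<le> R" "r g \<le> R"
  shows "r (iexp h - iexp g) \<le> exp R * r (h - g)"
proof (rule limit_dist_le[OF r exp_approx_tendsto exp_approx_tendsto _ tendsto_const])
  interpret star_seminormed st J r by fact
  have R0: "R \<ge> 0" using R(1) r_nonneg order_trans by blast
  fix k
  let ?x = "1 + (1 / 2 ^ k) *\<^sub>R (J * h)" and ?y = "1 + (1 / 2 ^ k) *\<^sub>R (J * g)"
  have "r (exp_approx h k - exp_approx g k) \<le> real (2 ^ k) * (1 + R / 2 ^ k) ^ (2 ^ k) * r (?x - ?y)"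
    unfolding exp_approx_def
    by (rule r_power_diff)
      (use base_bound[OF r(1) R(1), of "2 ^ k"] base_bound[OF r(1) R(2), of "2 ^ k"] R0 in simp_all)
  also have "r (?x - ?y) \<le> (1 / 2 ^ k) * r (h - g)"
  proof -
    have "?x - ?y = (1 / 2 ^ k) *\<^sub>R (J * (h - g))" by (simp add: algebra_simps)
    then have "r (?x - ?y) \<le> (1 / 2 ^ k) * r (J * (h - g))"
      using r_scaleR[of "1 / 2 ^ k" "J * (h - g)"] by simp
    also have "\<dots> \<le> (1 / 2 ^ k) * r (h - g)" by (intro mult_left_mono r_J) simp
    finally show ?thesis .
  qed
  also have "real (2 ^ k) * (1 + R / 2 ^ k) ^ (2 ^ k) * ((1 / 2 ^ k) * r (h - g))
      = (1 + R / 2 ^ k) ^ (2 ^ k) * r (h - g)" by simp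
  also have "\<dots> \<le> exp R * r (h - g)"
    by (intro mult_right_mono pow_le_exp R0) simp
  finally show "r (exp_approx h k - exp_approx g k) \<le> exp R * r (h - g)"
    using R0 by (simp add: mult_left_mono)
qed

lemma iexp_linear:
  assumes r: "star_seminormed st J r" "\<And>x. r x \<le> p n x"
  shows "r (iexp h - (1 + J * h)) \<le> (r h)\<^sup>2 * exp (r h)"
proof (rule limit_dist_le[OF r exp_approx_tendsto _ _ tendsto_const])
  interpret star_seminormed st J r by fact
  show "(\<lambda>k. p n ((1 + J * h) - (1 + J * h))) \<longlonglongrightarrow> 0" by simp
  fix k
  define x where "x = (1 / 2 ^ k) *\<^sub>R (J * h)"
  have rx: "r x \<le> r h / 2 ^ k"
    using r_scaleR[of "1 / 2 ^ k" "J * h"] r_J[of h]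
    by (simp add: x_def divide_right_mono order_trans)
  have "r (exp_approx h k - (1 + J * h)) = r ((1 + x) ^ (2 ^ k) - 1 - real (2 ^ k) *\<^sub>R x)"
    by (simp add: exp_approx_def x_def algebra_simps)
  also have "\<dots> \<le> (real (2 ^ k))\<^sup>2 * (r x)\<^sup>2 * (1 + r x) ^ (2 ^ k)" by (rule r_power_linear)
  also have "\<dots> \<le> (real (2 ^ k))\<^sup>2 * (r h / 2 ^ k)\<^sup>2 * (1 + r h / 2 ^ k) ^ (2 ^ k)"
    by (intro mult_mono power_mono add_mono rx) auto
  also have "\<dots> = (r h)\<^sup>2 * (1 + r h / 2 ^ k) ^ (2 ^ k)" by (simp add: power_divide)
  also have "\<dots> \<le> (r h)\<^sup>2 * exp (r h)" by (intro mult_left_mono pow_le_exp) auto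
  finally show "r (exp_approx h k - (1 + J * h)) \<le> (r h)\<^sup>2 * exp (r h)" .
qed

text \<open>The approximants are powers of elements of \<open>1 + K\<close>, a set closed under
  products, and \<open>K\<close> is closed under limits.\<close>

lemma iexp_minus_one_in_K:
  assumes "h \<in> K"
  shows "iexp h - 1 \<in> K"
proof (rule K_closed)
  fix n and e :: real assume e: "e > 0"
  have "x ^ M - 1 \<in> K" if "x - 1 \<in> K" for x M
  proof (induction M)
    case (Suc M)
    have "x ^ Suc M - 1 = x * (x ^ M - 1) + (x - 1)" by (simp add: algebra_simps)
    then show ?case using that Suc by (simp only: K_add K_mult_left)
  qed (simp add: K_zero)
  then have k: "exp_approx h k - 1 \<in> K" for k
    unfolding exp_approx_def using assms by (simp add: K_scaleR K_mult_left)
  have "\<forall>\<^sub>F k in sequentially. p n (exp_approx h k - iexp h) < e"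
    using exp_approx_tendsto[of n h] e by (rule order_tendstoD)
  then obtain k where "p n (exp_approx h k - iexp h) < e"
    unfolding eventually_sequentially by blast
  then show "\<exists>k\<in>K. p n (iexp h - 1 - k) < e"
    by (intro bexI[OF _ k[of k]]) (simp add: p.p_commute)
qed

text \<open>Unitarity up to the common kernel of the seminorms, as the relations of a unitary cannot
  be expected to hold exactly in the free algebra. Equality returns after evaluation, where the
  seminorms separate points.\<close>

definition unit :: "'t \<Rightarrow> bool" where
  "unit w \<longleftrightarrow> (\<forall>n. p n (st w * w - 1) = 0 \<and> p n (w * st w - 1) = 0)"

lemma unit_norm: "unit w \<Longrightarrow> p n w \<le> 1"
proof -
  assume w: "unit w"
  have "(p n w)\<^sup>2 = p n ((st w * w - 1) + 1)" by (simp add: p.p_star)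
  also have "\<dots> \<le> 0 + 1"
    using w p.p_add[of n "st w * w - 1" 1] p.p_one[of n] by (simp add: unit_def)
  finally show ?thesis by (simp add: power_le_one_iff abs_le_square_iff[symmetric] power2_le_iff_abs_le)
qed

lemma unit_st: "unit w \<Longrightarrow> unit (st w)"
  by (simp add: unit_def)

lemma unit_one [simp]: "unit 1"
  by (simp add: unit_def)

lemma p_null_mult:
  assumes "p n x = 0"
  shows "p n (y * x) = 0" "p n (x * y) = 0"
  using p.p_mult[of n y x] p.p_mult[of n x y] assms p.p_nonneg[of n "y * x"] p.p_nonneg[of n "x * y"]
  by simp_all

lemma unit_mult:
  assumes "unit v" "unit w"
  shows "unit (v * w)"
proof -
  have *: "p n (st (v * w) * (v * w) - 1) = 0" if "unit v" "unit w" for n v w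
  proof -
    have "st (v * w) * (v * w) - 1 = st w * ((st v * v - 1) * w) + (st w * w - 1)"
      by (simp add: st_mult algebra_simps)
    moreover have "p n (st w * ((st v * v - 1) * w)) = 0"
      using that by (intro p_null_mult) (simp add: unit_def)
    moreover have "p n (st w * w - 1) = 0" using that by (simp add: unit_def)
    ultimately show ?thesis
      using p.p_add[of n "st w * ((st v * v - 1) * w)" "st w * w - 1"]
        p.p_nonneg[of n "st (v * w) * (v * w) - 1"] by (metis add_0 order_antisym)
  qed
  show ?thesis
    using *[OF assms] *[OF unit_st[OF assms(2)] unit_st[OF assms(1)]]
    by (simp add: unit_def st_mult)
qed

lemma unit_limit:
  assumes w: "\<And>k. p n (st (w k)) \<le> b" "\<And>n. (\<lambda>k. p n (w k - l)) \<longlonglongrightarrow> 0"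
    and u: "(\<lambda>k. p n (st (w k) * w k - 1)) \<longlonglongrightarrow> 0"
  shows "p n (st l * l - 1) = 0"
proof -
  have "p n (st l * l - 1) \<le> p n (w k - l) * p n l + b * p n (w k - l) + p n (st (w k) * w k - 1)" for k
  proof -
    have "st l * l - 1 = (st (w k) * w k - 1) - (st (w k - l) * l + st (w k) * (w k - l))"
      by (simp add: st_diff algebra_simps)
    then have "p n (st l * l - 1) \<le> p n (st (w k) * w k - 1) + p n (st (w k - l) * l + st (w k) * (w k - l))"
      by (metis p.p_diff)
    also have "p n (st (w k - l) * l + st (w k) * (w k - l)) \<le> p n (w k - l) * p n l + b * p n (w k - l)"
      by (rule order_trans[OF p.p_add]) (intro add_mono p.p_mult_le w; simp)
    finally show ?thesis by simp
  qed
  moreover have "(\<lambda>k. p n (w k - l) * p n l + b * p n (w k - l) + p n (st (w k) * w k - 1))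
      \<longlonglongrightarrow> 0 * p n l + b * 0 + 0"
    by (intro tendsto_intros w u)
  ultimately have "p n (st l * l - 1) \<le> 0 * p n l + b * 0 + 0"
    by (intro LIMSEQ_le_const) auto
  then show ?thesis using p.p_nonneg[of n "st l * l - 1"] by simp
qed

lemma commuting_power_mult: "a * b = b * a \<Longrightarrow> a ^ n * b ^ n = (a * b) ^ n" for a b :: 't
proof (induction n)
  case (Suc n)
  have "a ^ Suc n * b ^ Suc n = a * (a ^ n * b) * b ^ n" by (simp add: mult.assoc)
  also have "a ^ n * b = b * a ^ n" using Suc.prems by (metis power_commuting_commutes)
  also have "a * (b * a ^ n) * b ^ n = (a * b) * (a ^ n * b ^ n)" by (simp add: mult.assoc)
  finally show ?case by (simp only: Suc power_Suc)
qed simp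

text \<open>For self-adjoint \<open>h\<close> the bases \<open>1 + i h / 2^k\<close> and
  \<open>1 - i h / 2^k\<close> are adjoint to each other and commute, so the adjoint of an
  approximant times the approximant is \<open>(1 + h^2 / 4^k) ^ (2 ^ k)\<close>. This tends to 1
  because the exponent is only the square root of \<open>4^k\<close>.\<close>

lemma unit_iexp:
  assumes h: "st h = h"
  shows "unit (iexp h)"
proof -
  have bound: "p n (exp_approx h k) \<le> exp (p n h)" for n k
  proof -
    have "p n (exp_approx h k) \<le> (1 + p n h / 2 ^ k) ^ (2 ^ k)"
      unfolding exp_approx_def
      by (rule p.r_power_le) (use base_bound[OF p.star_seminormed, of n h _ "2 ^ k"] in simp)
    also have "\<dots> \<le> exp (p n h)" by (rule pow_le_exp) simp
    finally show ?thesis .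
  qed
  have approx: "(\<lambda>k. p n (a k - 1)) \<longlonglongrightarrow> 0"
    if a: "\<And>k. a k = (1 + (1 / 4 ^ k) *\<^sub>R (h * h)) ^ (2 ^ k)" for a n
  proof -
    define R where "R = p n (h * h)"
    have R: "R \<ge> 0" by (simp add: R_def)
    have "p n (a k - 1) \<le> exp R * R * (1/2) ^ k" for k
    proof -
      have b1: "p n (1 + (1 / 4 ^ k) *\<^sub>R (h * h)) \<le> 1 + R / 2 ^ k"
      proof -
        have "p n (1 + (1 / 4 ^ k) *\<^sub>R (h * h)) \<le> 1 + R / 4 ^ k"
          using p.p_add[of n 1 "(1 / 4 ^ k) *\<^sub>R (h * h)"] p.p_one[of n]
          by (simp add: p.p_scaleR R_def)
        also have "R / 4 ^ k \<le> R / 2 ^ k"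
          using R by (intro divide_left_mono power_mono) auto
        finally show ?thesis by simp
      qed
      have "p n (a k - 1 ^ (2 ^ k)) \<le> real (2 ^ k) * (1 + R / 2 ^ k) ^ (2 ^ k) * p n (1 + (1 / 4 ^ k) *\<^sub>R (h * h) - 1)"
        unfolding a by (rule p.r_power_diff[OF b1]) (use R p.p_one[of n] in \<open>auto intro: order_trans\<close>)
      also have "\<dots> \<le> real (2 ^ k) * exp R * (R / 4 ^ k)"
        by (intro mult_mono pow_le_exp R) (use R in \<open>auto simp: p.p_scaleR R_def\<close>)
      also have "\<dots> = exp R * R * (1/2) ^ k"
        by (simp add: power_divide) (simp add: power_mult_distrib[symmetric] field_simps)
      finally show ?thesis by simp
    qed
    moreover have "(\<lambda>k. exp R * R * (1/2) ^ k) \<longlonglongrightarrow> exp R * R * 0"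
      by (intro tendsto_intros LIMSEQ_power_zero) simp
    ultimately show ?thesis
      by (intro tendsto_sandwich[of "\<lambda>_. 0" "\<lambda>k. p n (a k - 1)" sequentially "\<lambda>k. exp R * R * (1/2) ^ k"])
        auto
  qed
  define x y where "x k = 1 + (1 / 2 ^ k) *\<^sub>R (J * h)" and "y k = 1 - (1 / 2 ^ k) *\<^sub>R (J * h)" for k :: nat
  have xy: "x k * y k = 1 + (1 / 4 ^ k) *\<^sub>R (h * h)" "y k * x k = 1 + (1 / 4 ^ k) *\<^sub>R (h * h)" for k
  proof -
    have JJ: "J * h * (J * h) = - (h * h)"
      by (simp add: mult.assoc J_left_comm[of h] J_J_left)
    have "(1 / 2 ^ k) *\<^sub>R (1 / 2 ^ k) *\<^sub>R (h * h) = (1 / 4 ^ k) *\<^sub>R (h * h)"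
      by (simp add: power_mult_distrib[symmetric])
    then show "x k * y k = 1 + (1 / 4 ^ k) *\<^sub>R (h * h)" "y k * x k = 1 + (1 / 4 ^ k) *\<^sub>R (h * h)"
      unfolding x_def y_def
      by (simp_all only: distrib_left distrib_right left_diff_distrib right_diff_distrib mult_1 mult_1_right
          mult_scaleR_left mult_scaleR_right JJ) (simp_all add: algebra_simps)
  qed
  have stx: "st (x k ^ 2 ^ k) = y k ^ 2 ^ k" "st (y k ^ 2 ^ k) = x k ^ 2 ^ k" for k
    by (simp_all add: x_def y_def st_simps h J_comm)
  have u: "(\<lambda>k. p n (st (exp_approx h k) * exp_approx h k - 1)) \<longlonglongrightarrow> 0"
    "(\<lambda>k. p n (st (st (exp_approx h k)) * st (exp_approx h k) - 1)) \<longlonglongrightarrow> 0" for n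
    by (rule approx; simp only: exp_approx_def x_def[symmetric] stx st_st commuting_power_mult xy)+
  have "p n (st (iexp h) * iexp h - 1) = 0" for n
    by (rule unit_limit[of n "exp_approx h" "exp (p n h)"])
      (use bound exp_approx_tendsto u in auto)
  moreover have "p n (st (st (iexp h)) * st (iexp h) - 1) = 0" for n
    by (rule unit_limit[of n "\<lambda>k. st (exp_approx h k)" "exp (p n h)"])
      (use bound exp_approx_tendsto u in \<open>auto simp: st_diff[symmetric]\<close>)
  ultimately show ?thesis by (simp add: unit_def)
qed

text \<open>A first-order logarithm: if \<open>z = e\<^bsup>i\<theta>\<^esup>\<close> then \<open>sin_part z = sin \<theta>\<close>, so \<open>e\<^bsup>i sin_part z\<^esup>\<close>
  agrees with \<open>z\<close> up to second order in \<open>z - 1\<close>.\<close>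

definition sin_part :: "'t \<Rightarrow> 't" where
  "sin_part z = - ((1/2) *\<^sub>R (J * (z - st z)))"

lemma st_sin_part: "st (sin_part z) = sin_part z"
  by (simp add: sin_part_def st_simps J_comm scaleR_right_diff_distrib right_diff_distrib)

lemma sin_part_bound:
  assumes "star_seminormed st J r"
  shows "r (sin_part z) \<le> r (z - 1)"
proof -
  interpret star_seminormed st J r by fact
  have "r (sin_part z) \<le> (1/2) * r (J * (z - st z))"
    unfolding sin_part_def using r_scaleR[of "1/2" "J * (z - st z)"] by simp
  also have "\<dots> \<le> (1/2) * r (z - st z)" by (intro mult_left_mono r_J) simp
  also have "z - st z = (z - 1) - st (z - 1)" by (simp add: st_diff)
  also have "r \<dots> \<le> r (z - 1) + r (z - 1)"
    using r_diff[of "z - 1" "st (z - 1)"] r_st[of "z - 1"] by linarith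
  finally show ?thesis by simp
qed

text \<open>With \<open>h = sin_part z\<close> the deviation \<open>1 + J * h - z\<close> equals
  half of \<open>st (z - 1) * (z - 1) - (st z * z - 1)\<close>, hence is quadratic in
  \<open>z - 1\<close> when \<open>r\<close> sees \<open>z\<close> as unitary. The constant 4 is 1
  from this term and 3, an upper bound of \<open>exp 1\<close>, from
  \<open>iexp_linear\<close>.\<close>

lemma iexp_sin_part:
  assumes r: "star_seminormed st J r" "\<And>x. r x \<le> p n x"
    and z: "r (st z * z - 1) = 0" "r (z - 1) \<le> 1"
  shows "r (iexp (sin_part z) - z) \<le> 4 * (r (z - 1))\<^sup>2"
proof -
  interpret star_seminormed st J r by fact
  define d h where "d = r (z - 1)" and "h = sin_part z"
  have d: "0 \<le> d" "d \<le> 1" using z by (simp_all add: d_def)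
  have hd: "r h \<le> d" unfolding h_def d_def by (rule sin_part_bound[OF r(1)])
  have Jh: "J * h = (1/2) *\<^sub>R (z - st z)"
    by (simp add: h_def sin_part_def J_J_left scaleR_right_diff_distrib)
  have "1 + J * h - z = (1/2) *\<^sub>R (st (z - 1) * (z - 1) - (st z * z - 1))"
  proof -
    have "z = (1/2) *\<^sub>R z + (1/2) *\<^sub>R z" "1 = (1/2) *\<^sub>R (1::'t) + (1/2) *\<^sub>R 1"
      by (simp_all flip: scaleR_add_left)
    then have "1 + J * h - z = ((1/2) *\<^sub>R (1::'t) + (1/2) *\<^sub>R 1) + (1/2) *\<^sub>R (z - st z) - ((1/2) *\<^sub>R z + (1/2) *\<^sub>R z)"
      unfolding Jh by simp
    also have "\<dots> = (1/2) *\<^sub>R (1 + 1 + (z - st z) - (z + z))"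
      by (simp only: scaleR_add_right scaleR_diff_right)
    also have "1 + 1 + (z - st z) - (z + z) = st (z - 1) * (z - 1) - (st z * z - 1)"
      by (simp add: st_diff algebra_simps)
    finally show ?thesis .
  qed
  then have "r (1 + J * h - z) \<le> (1/2) * r (st (z - 1) * (z - 1) - (st z * z - 1))"
    using r_scaleR[of "1/2"] by (metis abs_of_nonneg half_gt_zero_iff less_eq_real_def zero_less_one)
  also have "\<dots> \<le> (1/2) * (d * d + 0)"
  proof (rule mult_left_mono)
    have "r (st (z - 1) * (z - 1)) \<le> d * d"
      by (rule r_mult_le) (use r_st[of "z - 1"] in \<open>auto simp: d_def\<close>)
    then show "r (st (z - 1) * (z - 1) - (st z * z - 1)) \<le> d * d + 0"
      using r_diff[of "st (z - 1) * (z - 1)" "st z * z - 1"] z by simp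
  qed simp
  also have "\<dots> \<le> d\<^sup>2" by (simp add: power2_eq_square)
  finally have 1: "r (1 + J * h - z) \<le> d\<^sup>2" .
  have "r (iexp h - (1 + J * h)) \<le> (r h)\<^sup>2 * exp (r h)" by (rule iexp_linear[OF r])
  also have "\<dots> \<le> d\<^sup>2 * 3"
  proof (intro mult_mono power_mono hd)
    have "exp (r h) \<le> exp 1" using hd d by simp
    then show "exp (r h) \<le> 3" using exp_le by linarith
  qed auto
  finally show ?thesis
    using 1 r_triangle[of "iexp h" z "1 + J * h"] by (simp add: h_def d_def)
qed

end

context complete_star_ring
begin

subsection \<open>Quotient seminorms\<close>

definition q :: "nat \<Rightarrow> 't \<Rightarrow> real" where
  "q n x = (INF k\<in>K. p n (x + k))"

lemma q_le: "k \<in> K \<Longrightarrow> q n x \<le> p n (x + k)"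
  unfolding q_def by (intro cINF_lower bdd_belowI2[where m = 0]) auto

lemma q_le_p: "q n x \<le> p n x"
  using q_le[OF K_zero] by simp

lemma q_less: "q n x < e \<Longrightarrow> \<exists>k\<in>K. p n (x + k) < e"
  unfolding q_def using K_zero by (subst (asm) cINF_less_iff) (auto intro!: bdd_belowI2[where m = 0])

lemma q_nonneg: "0 \<le> q n x"
  unfolding q_def using K_zero by (intro cINF_greatest) auto

lemma q_star_seminormed: "star_seminormed st J (q n)"
proof
  fix x y :: 't and c :: real
  have ex: "\<exists>k\<in>K. p n (z + k) < q n z + e" if "e > 0" for z e
    by (rule q_less) (use that in simp)
  show "0 \<le> q n x" by (rule q_nonneg)
  show "q n 1 \<le> 1" using q_le_p[of n 1] p.p_one[of n] by linarith
  show "q n (x + y) \<le> q n x + q n y"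
  proof (rule field_le_epsilon)
    fix e :: real assume "e > 0"
    then obtain k l where k: "k \<in> K" "p n (x + k) < q n x + e / 2"
      and l: "l \<in> K" "p n (y + l) < q n y + e / 2" using ex[of "e / 2"] by (metis half_gt_zero)
    have "q n (x + y) \<le> p n ((x + k) + (y + l))"
      using q_le[OF K_add[OF k(1) l(1)], of n "x + y"] by (simp add: algebra_simps)
    then show "q n (x + y) \<le> q n x + q n y + e"
      using p.p_add[of n "x + k" "y + l"] k l by linarith
  qed
  show "q n (c *\<^sub>R x) \<le> \<bar>c\<bar> * q n x"
  proof (rule field_le_epsilon)
    fix e :: real assume e: "e > 0"
    then obtain k where k: "k \<in> K" "p n (x + k) < q n x + e / (\<bar>c\<bar> + 1)"
      using ex[of "e / (\<bar>c\<bar> + 1)" x] by (auto simp: add_nonneg_pos)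
    have "q n (c *\<^sub>R x) \<le> p n (c *\<^sub>R (x + k))"
      using q_le[OF K_scaleR[OF k(1)], of n "c *\<^sub>R x"] by (simp add: scaleR_add_right)
    also have "\<dots> \<le> \<bar>c\<bar> * (q n x + e / (\<bar>c\<bar> + 1))"
      unfolding p.p_scaleR by (rule mult_left_mono) (use k in auto)
    also have "\<dots> \<le> \<bar>c\<bar> * q n x + e"
    proof -
      have "\<bar>c\<bar> * (e / (\<bar>c\<bar> + 1)) \<le> e" using e by (simp add: field_simps)
      then show ?thesis by (simp add: distrib_left)
    qed
    finally show "q n (c *\<^sub>R x) \<le> \<bar>c\<bar> * q n x + e" .
  qed
  show "q n (J * x) \<le> q n x"
  proof (rule field_le_epsilon)
    fix e :: real assume "e > 0"
    then obtain k where k: "k \<in> K" "p n (x + k) < q n x + e" using ex by blast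
    have "q n (J * x) \<le> p n (J * (x + k))"
      using q_le[OF K_mult_left[OF k(1)], of n "J * x" J] by (simp add: distrib_left)
    then show "q n (J * x) \<le> q n x + e" using k by (simp add: p.p_J)
  qed
  show "q n (st x) \<le> q n x"
  proof (rule field_le_epsilon)
    fix e :: real assume "e > 0"
    then obtain k where k: "k \<in> K" "p n (x + k) < q n x + e" using ex by blast
    have "q n (st x) \<le> p n (st (x + k))"
      using q_le[OF K_st[OF k(1)], of n "st x"] by (simp add: st_add)
    then show "q n (st x) \<le> q n x + e" using k by simp
  qed
  show "q n (x * y) \<le> q n x * q n y"
  proof -
    define a b where "a = q n x" and "b = q n y"
    have "q n (x * y) \<le> (a + e) * (b + e)" if e: "e > 0" for e
    proof -
      obtain k l where k: "k \<in> K" "p n (x + k) < a + e" and l: "l \<in> K" "p n (y + l) < b + e"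
        unfolding a_def b_def using ex[OF e] by metis
      have "x * l + k * (y + l) \<in> K"
        using k l by (intro K_add K_mult_left K_mult_right)
      from q_le[OF this, of n "x * y"] have "q n (x * y) \<le> p n ((x + k) * (y + l))"
        by (simp add: algebra_simps)
      also have "\<dots> \<le> (a + e) * (b + e)" by (rule p.p_mult_le) (use k l in auto)
      finally show ?thesis .
    qed
    then have "\<forall>\<^sub>F e in at_right 0. q n (x * y) \<le> (a + e) * (b + e)"
      unfolding eventually_at_right_field by (intro exI[of _ 1]) auto
    moreover have "((\<lambda>e. (a + e) * (b + e)) \<longlongrightarrow> (a + 0) * (b + 0)) (at_right 0)"
      by (intro tendsto_intros)
    ultimately have "q n (x * y) \<le> (a + 0) * (b + 0)"
      by (intro tendsto_lowerbound[where F = "at_right (0::real)"]) auto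
    then show ?thesis by (simp add: a_def b_def)
  qed
qed

sublocale q: star_seminormed st J "q n" for n
  by (rule q_star_seminormed)

lemma q_mono: "m \<le> n \<Longrightarrow> q m x \<le> q n x"
proof (rule field_le_epsilon)
  fix e :: real assume mn: "m \<le> n" and "e > 0"
  then obtain k where k: "k \<in> K" "p n (x + k) < q n x + e"
    using q_less[of n x "q n x + e"] by auto
  then show "q m x \<le> q n x + e"
    using q_le[OF k(1), of m x] p_mono[OF mn, of "x + k"] by linarith
qed

lemma q_K: "k \<in> K \<Longrightarrow> q n k = 0"
  using q_le[OF K_minus, of k n k] q_nonneg[of n k] by simp

lemma q_eq_K: "x - y \<in> K \<Longrightarrow> q n x = q n y"
  using q.r_triangle[of n x 0 y] q.r_triangle[of n y 0 x] q.r_commute[of n x y] q_K[of "x - y" n]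
  by simp

lemma q_zero_K: "(\<And>n. q n x = 0) \<Longrightarrow> x \<in> K"
proof (rule K_closed)
  fix n and e :: real assume "\<And>n. q n x = 0" "e > 0"
  then obtain k where "k \<in> K" "p n (x + k) < e" using q_less[of n x e] by auto
  then show "\<exists>k\<in>K. p n (x - k) < e" by (intro bexI[of _ "- k"]) (auto intro: K_minus)
qed

lemma q_unit_mult_left: "unit w \<Longrightarrow> q n (w * x) \<le> q n x"
  using q.r_mult_le[of n w 1 x "q n x"] q_le_p[of n w] unit_norm[of w n] by simp

definition unitK :: "'t \<Rightarrow> bool" where
  "unitK x \<longleftrightarrow> st x * x - 1 \<in> K \<and> x * st x - 1 \<in> K"

lemma unit_imp_unitK: "unit w \<Longrightarrow> unitK w"
  by (auto simp: unit_def unitK_def intro!: K_null)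

lemma unitK_mult:
  assumes "unitK x" "unitK y"
  shows "unitK (x * y)"
proof -
  have "st (x * y) * (x * y) - 1 = st y * ((st x * x - 1) * y) + (st y * y - 1)"
    "x * y * st (x * y) - 1 = x * ((y * st y - 1) * st x) + (x * st x - 1)"
    by (simp_all add: st_mult algebra_simps)
  then show ?thesis
    using assms unfolding unitK_def by (metis K_add K_mult_left K_mult_right)
qed

lemma unitK_add:
  assumes "unitK x" "k \<in> K"
  shows "unitK (x + k)"
proof -
  have "st (x + k) * (x + k) - 1 = (st x * x - 1) + (st (x + k) * k + st k * x)"
    "(x + k) * st (x + k) - 1 = (x * st x - 1) + (k * st (x + k) + x * st k)"
    by (simp_all add: st_add algebra_simps)
  moreover have "st (x + k) * k + st k * x \<in> K" "k * st (x + k) + x * st k \<in> K"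
    using assms(2) by (blast intro: K_add K_mult_left K_mult_right K_st)+
  ultimately show ?thesis
    using assms(1) unfolding unitK_def by (metis K_add)
qed

lemma one_plus_K_mult:
  assumes "x - 1 \<in> K" "y - 1 \<in> K"
  shows "x * y - 1 \<in> K"
proof -
  have "x * y - 1 = x * (y - 1) + (x - 1)" by (simp add: algebra_simps)
  then show ?thesis using assms by (simp only: K_add K_mult_left)
qed

subsection \<open>Lifting paths of unitaries\<close>

text \<open>\<open>x\<close> is any choice of representatives for a path of unitaries in the
  quotient: its continuity concerns the \<open>q m\<close>, not the \<open>p m\<close>. Uniform
  continuity and boundedness are built in because the lifting subdivides the interval and multiplies
  paths; \<open>unit_pathI\<close> obtains them from compactness.\<close>

definition unit_path :: "(real \<Rightarrow> 't) \<Rightarrow> bool" where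
  "unit_path x \<longleftrightarrow> (\<forall>t\<in>{0..1}. unitK (x t)) \<and> x 0 - 1 \<in> K \<and>
    (\<forall>m. \<forall>e>0. \<exists>d>0. \<forall>s\<in>{0..1}. \<forall>t\<in>{0..1}. \<bar>s - t\<bar> < d \<longrightarrow> q m (x s - x t) < e) \<and>
    (\<forall>m. \<exists>B. \<forall>t\<in>{0..1}. q m (x t) \<le> B)"

text \<open>In contrast to \<open>unit_path\<close>, a curve of unitaries upstairs, continuous for
  every \<open>p m\<close>. The Lipschitz form is stable under the products formed below; the
  parameter runs over all reals, so that a curve can be continued as a constant after its last
  step.\<close>

definition unit_curve :: "(real \<Rightarrow> 't) \<Rightarrow> bool" where
  "unit_curve W \<longleftrightarrow> (\<forall>t. unit (W t)) \<and> (\<forall>m. \<exists>L. \<forall>s t. p m (W s - W t) \<le> L * \<bar>s - t\<bar>)"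

lemma iexp_minus_one:
  assumes r: "star_seminormed st J r" "\<And>x. r x \<le> p n x"
    and h: "st h = h" "r h \<le> 1"
  shows "r (iexp h - 1) \<le> 3 * r h"
proof -
  interpret star_seminormed st J r by fact
  have "p n (iexp 0 - 1) = 0"
  proof -
    have "p n (iexp 0 - (1 + J * 0)) \<le> (p n 0)\<^sup>2 * exp (p n 0)"
      by (rule iexp_linear[OF p.star_seminormed order_refl])
    then show ?thesis using p.p_nonneg[of n "iexp 0 - 1"] by simp
  qed
  then have "r (iexp 0 - 1) = 0" using r(2)[of "iexp 0 - 1"] r_nonneg[of "iexp 0 - 1"] by linarith
  moreover have "r (iexp h - iexp 0) \<le> exp 1 * r (h - 0)"
    by (rule iexp_dist[OF r]) (use h in auto)
  moreover have "exp 1 * r h \<le> 3 * r h" using exp_le by (simp add: mult_right_mono)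
  ultimately show ?thesis using r_triangle[of "iexp h" 1 "iexp 0"] by simp
qed

text \<open>Along a small step, \<open>w\<close> is multiplied by an exponential \<open>e\<^bsup>ih\<^esup>\<close> that follows the path in
  the quotient, and then by a unitary \<open>c \<in> 1 + K\<close>, invisible in the quotient, that brings the
  product back near \<open>1\<close> for the seminorm \<open>p n\<close>.\<close>

lemma lift_step:
  assumes w: "unit w" "p n (w - 1) \<le> 8 * \<epsilon>" and x': "unitK x'"
    and e: "0 < \<epsilon>" "\<epsilon> \<le> 1/1000" and d: "0 < \<delta>" "\<delta> \<le> \<epsilon>"
    and xw: "q (Suc n) (x' - w) \<le> 2 * \<delta>" and x1: "q n (x' - 1) \<le> \<epsilon>"
  obtains h c where "st h = h" "q (Suc n) h \<le> 3 * \<delta>" "unit c" "c - 1 \<in> K"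
    "q (Suc n) (x' - w * iexp h) \<le> \<delta>" "p n (w * iexp h * c - 1) \<le> 8 * \<epsilon>"
proof -
  let ?N = "Suc n"
  have null: "p m (w * st w - 1) = 0" "p m (st w * w - 1) = 0" for m
    using w(1) by (auto simp: unit_def)
  define z0 where "z0 = st w * x'"
  have z0: "unitK z0"
    unfolding z0_def by (intro unitK_mult x' unit_imp_unitK unit_st w)
  have "z0 - 1 - st w * (x' - w) \<in> K"
  proof -
    have "z0 - 1 - st w * (x' - w) = st w * w - 1" by (simp add: z0_def algebra_simps)
    then show ?thesis using K_null[OF null(2)] by (simp only:)
  qed
  then have "q ?N (z0 - 1) = q ?N (st w * (x' - w))" by (rule q_eq_K)
  also have "\<dots> \<le> 2 * \<delta>"
    using q_unit_mult_left[OF unit_st[OF w(1)], of ?N "x' - w"] xw by linarith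
  finally have "q ?N (z0 - 1) < 3 * \<delta>" using d by linarith
  \<comment> \<open>The quotient estimate is realised by a representative \<open>z = z0 + k\<close>
    that is near 1 upstairs, so that its first-order logarithm is small for \<open>p\<close> as
    well.\<close>
  then obtain k where k: "k \<in> K" "p ?N (z0 - 1 + k) < 3 * \<delta>" using q_less by blast
  define z where "z = z0 + k"
  have z: "unitK z" unfolding z_def by (rule unitK_add[OF z0 k(1)])
  have pz: "p ?N (z - 1) \<le> 3 * \<delta>" using k(2) by (simp add: z_def algebra_simps)
  define h where "h = sin_part z"
  have sh: "st h = h" by (simp add: h_def st_sin_part)
  have ph: "p ?N h \<le> 3 * \<delta>"
    unfolding h_def using sin_part_bound[OF p.star_seminormed, of ?N z] pz by linarith
  have "q ?N (iexp h - z) \<le> 4 * (q ?N (z - 1))\<^sup>2"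
    unfolding h_def
  proof (rule iexp_sin_part[OF q_star_seminormed q_le_p])
    show "q ?N (st z * z - 1) = 0" using z by (intro q_K) (simp add: unitK_def)
    show "q ?N (z - 1) \<le> 1" using q_le_p[of ?N "z - 1"] pz e d by linarith
  qed
  \<comment> \<open>The error 36 \<delta>^2 is at most \<delta> because \<delta> \<le> 1/1000; the
    step thus reduces the distance 2\<delta> found on entry to \<delta>.\<close>
  also have "\<dots> \<le> 4 * (3 * \<delta>)\<^sup>2"
    by (intro mult_left_mono power_mono) (use q_le_p[of ?N "z - 1"] pz in auto)
  also have "\<dots> = (36 * \<delta>) * \<delta>" by (simp add: power2_eq_square)
  also have "\<dots> \<le> 1 * \<delta>" by (rule mult_right_mono) (use e d in auto)
  finally have hz: "q ?N (iexp h - z) \<le> \<delta>" by simp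
  define w1 where "w1 = w * iexp h"
  have uw1: "unit w1" unfolding w1_def by (intro unit_mult w unit_iexp sh)
  have "(x' - w1) - w * (z - iexp h) \<in> K"
  proof -
    have "(x' - w1) - w * (z - iexp h) = - ((w * st w - 1) * x') - w * k"
      by (simp add: w1_def z_def z0_def algebra_simps)
    then show ?thesis
      using K_null[OF null(1)] k(1) by (simp only: K_diff K_minus K_mult_left K_mult_right)
  qed
  then have "q ?N (x' - w1) = q ?N (w * (z - iexp h))" by (rule q_eq_K)
  also have "\<dots> \<le> \<delta>"
    using q_unit_mult_left[OF w(1), of ?N "z - iexp h"] hz q.r_commute[of ?N z "iexp h"] by simp
  finally have xw1: "q ?N (x' - w1) \<le> \<delta>" .
  have phn: "p n h \<le> 3 * \<delta>" using p_Suc[of n h] ph by linarith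
  have "p n (iexp h - 1) \<le> 3 * p n h"
    by (rule iexp_minus_one[OF p.star_seminormed]) (use sh phn e d in auto)
  then have p1: "p n (iexp h - 1) \<le> 9 * \<delta>" using phn by linarith
  have pw1: "p n (w1 - 1) \<le> 17 * \<epsilon>"
  proof -
    have "w1 - 1 = w * (iexp h - 1) + (w - 1)" by (simp add: w1_def algebra_simps)
    then have "p n (w1 - 1) \<le> p n (w * (iexp h - 1)) + p n (w - 1)" by (metis p.p_add)
    also have "p n (w * (iexp h - 1)) \<le> 1 * (9 * \<delta>)"
      by (rule p.p_mult_le[OF unit_norm[OF w(1)] p1])
    finally show ?thesis using w(2) d by linarith
  qed
  \<comment> \<open>Upstairs only the bound 17\<epsilon> is available; in the quotient
    \<open>w1\<close> follows the path, which gives 2\<epsilon>. The excess therefore comes from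
    \<open>K\<close> up to a small error, and the factor \<open>c\<close> will remove it.\<close>
  have qw1: "q n (w1 - 1) \<le> 2 * \<epsilon>"
  proof -
    have "q n (w1 - 1) \<le> q n (w1 - x') + q n (x' - 1)" by (rule q.r_triangle)
    also have "q n (w1 - x') \<le> \<delta>"
      using q_mono[of n ?N "x' - w1"] xw1 q.r_commute[of n w1 x'] by simp
    finally show ?thesis using x1 d by linarith
  qed
  define h' where "h' = sin_part w1"
  have sh': "st h' = h'" by (simp add: h'_def st_sin_part)
  have ph': "p n h' \<le> 17 * \<epsilon>"
    unfolding h'_def using sin_part_bound[OF p.star_seminormed, of n w1] pw1 by linarith
  have qh': "q n h' < 3 * \<epsilon>"
    unfolding h'_def using sin_part_bound[OF q_star_seminormed, of n w1] qw1 e by linarith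
  have "p n (iexp h' - w1) \<le> 4 * (p n (w1 - 1))\<^sup>2"
    unfolding h'_def
    by (rule iexp_sin_part[OF p.star_seminormed]) (use uw1 pw1 e in \<open>auto simp: unit_def\<close>)
  also have "\<dots> \<le> 4 * (17 * \<epsilon>)\<^sup>2"
    by (intro mult_left_mono power_mono) (use pw1 in auto)
  also have "\<dots> = (1156 * \<epsilon>) * \<epsilon>" by (simp add: power2_eq_square)
  also have "\<dots> \<le> 2 * \<epsilon>" by (rule mult_right_mono) (use e in auto)
  finally have hw: "p n (iexp h' - w1) \<le> 2 * \<epsilon>" .
  obtain k' where k': "k' \<in> K" "p n (h' + k') < 3 * \<epsilon>" using q_less[OF qh'] by blast
  \<comment> \<open>An element of \<open>K\<close> within 3\<epsilon> of \<open>h'\<close>, averaged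
    with its adjoint so that its exponential is unitary.\<close>
  define g where "g = - ((1/2) *\<^sub>R (k' + st k'))"
  have gK: "g \<in> K" unfolding g_def using k' by (intro K_minus K_scaleR K_add K_st)
  have sg: "st g = g" by (simp add: g_def st_simps add.commute)
  have hg: "p n (h' - g) \<le> 3 * \<epsilon>"
  proof -
    have "h' = (1/2) *\<^sub>R h' + (1/2) *\<^sub>R st h'" using sh' by (simp flip: scaleR_add_left)
    then have "h' - g = (1/2) *\<^sub>R ((h' + k') + st (h' + k'))"
      by (metis (no_types, opaque_lifting) add.assoc add.left_commute diff_minus_eq_add g_def scaleR_add_right st_add)
    then have "p n (h' - g) = (1/2) * p n ((h' + k') + st (h' + k'))" by (simp add: p.p_scaleR)
    also have "\<dots> \<le> (1/2) * (p n (h' + k') + p n (h' + k'))"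
      using p.p_add[of n "h' + k'" "st (h' + k')"] by simp
    finally show ?thesis using k' by simp
  qed
  have pg: "p n g \<le> 20 * \<epsilon>"
    using p.p_triangle[of n g 0 h'] p.p_commute[of n g h'] hg ph' by simp
  have "p n (iexp h' - iexp g) \<le> exp (20 * \<epsilon>) * p n (h' - g)"
    by (rule iexp_dist[OF p.star_seminormed]) (use ph' pg e in auto)
  also have "\<dots> \<le> 2 * (3 * \<epsilon>)"
  proof (rule mult_mono)
    have "exp (20 * \<epsilon>) \<le> 1 + 20 * \<epsilon> + (20 * \<epsilon>)\<^sup>2" by (rule exp_bound) (use e in auto)
    also have "(20 * \<epsilon>)\<^sup>2 \<le> (1/2)\<^sup>2" by (rule power_mono) (use e in auto)
    finally show "exp (20 * \<epsilon>) \<le> 2" using e by (simp add: power2_eq_square)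
  qed (use hg in auto)
  finally have hg': "p n (iexp h' - iexp g) \<le> 6 * \<epsilon>" by simp
  have ug: "unit (iexp g)" by (rule unit_iexp[OF sg])
  \<comment> \<open>\<open>iexp g\<close> is near \<open>w1\<close>: 2\<epsilon> from the logarithm
    and 6\<epsilon> from replacing \<open>h'\<close> by \<open>g\<close>. Multiplying by its adjoint
    restores the radius 8\<epsilon>.\<close>
  define c where "c = st (iexp g)"
  have uc: "unit c" unfolding c_def by (rule unit_st[OF ug])
  have cK: "c - 1 \<in> K"
    using K_st[OF iexp_minus_one_in_K[OF gK]] by (simp add: c_def st_diff)
  have "p n (w1 * c - 1) \<le> 8 * \<epsilon>"
  proof -
    have "w1 * c - 1 = (w1 - iexp g) * c + (iexp g * st (iexp g) - 1)"
      by (simp add: c_def algebra_simps)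
    then have "p n (w1 * c - 1) \<le> p n ((w1 - iexp g) * c) + p n (iexp g * st (iexp g) - 1)"
      by (metis p.p_add)
    also have "p n (iexp g * st (iexp g) - 1) = 0" using ug by (simp add: unit_def)
    also have "p n ((w1 - iexp g) * c) \<le> (8 * \<epsilon>) * 1"
    proof (rule p.p_mult_le[OF _ unit_norm[OF uc]])
      show "p n (w1 - iexp g) \<le> 8 * \<epsilon>"
        using p.p_triangle[of n w1 "iexp g" "iexp h'"] hw hg' p.p_commute[of n w1 "iexp h'"] by linarith
    qed
    finally show ?thesis by simp
  qed
  then show thesis
    using that[OF sh _ uc cK] q_le_p[of ?N h] ph xw1 unfolding w1_def by (metis order_trans)
qed

lemma unit_curve_mult:
  assumes W: "unit_curve W" and h: "st h = h" and c: "unit c"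
    and th: "\<And>t. 0 \<le> \<theta> t \<and> \<theta> t \<le> 1" "\<And>s t. \<bar>\<theta> s - \<theta> t\<bar> \<le> b * \<bar>s - t\<bar>"
  shows "unit_curve (\<lambda>t. W t * iexp (\<theta> t *\<^sub>R h) * c)"
  unfolding unit_curve_def
proof (intro conjI allI)
  show "unit (W t * iexp (\<theta> t *\<^sub>R h) * c)" for t
    using W h c by (intro unit_mult unit_iexp) (auto simp: unit_curve_def st_scaleR)
  fix m
  obtain L where L: "\<And>s t. p m (W s - W t) \<le> L * \<bar>s - t\<bar>"
    using W unfolding unit_curve_def by blast
  define R where "R = p m h"
  have R: "R \<ge> 0" by (simp add: R_def)
  have "p m (W s * iexp (\<theta> s *\<^sub>R h) * c - W t * iexp (\<theta> t *\<^sub>R h) * c)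
      \<le> (L + exp R * (b * R)) * \<bar>s - t\<bar>" for s t
  proof -
    have E: "p m (iexp (\<theta> s *\<^sub>R h) - iexp (\<theta> t *\<^sub>R h)) \<le> exp R * (b * \<bar>s - t\<bar> * R)"
    proof -
      have "\<theta> s * R \<le> 1 * R" "\<theta> t * R \<le> 1 * R" using th(1) R by (intro mult_right_mono; simp)+
      then have "p m (iexp (\<theta> s *\<^sub>R h) - iexp (\<theta> t *\<^sub>R h)) \<le> exp R * p m (\<theta> s *\<^sub>R h - \<theta> t *\<^sub>R h)"
        by (intro iexp_dist[OF p.star_seminormed]) (auto simp: p.p_scaleR R_def th(1))
      also have "p m (\<theta> s *\<^sub>R h - \<theta> t *\<^sub>R h) = \<bar>\<theta> s - \<theta> t\<bar> * R"
        by (simp add: scaleR_left_diff_distrib[symmetric] p.p_scaleR R_def)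
      also have "\<bar>\<theta> s - \<theta> t\<bar> * R \<le> (b * \<bar>s - t\<bar>) * R"
        by (rule mult_right_mono[OF th(2) R])
      finally show ?thesis by simp
    qed
    have "W s * iexp (\<theta> s *\<^sub>R h) * c - W t * iexp (\<theta> t *\<^sub>R h) * c
        = ((W s - W t) * iexp (\<theta> s *\<^sub>R h) + W t * (iexp (\<theta> s *\<^sub>R h) - iexp (\<theta> t *\<^sub>R h))) * c"
      by (simp add: algebra_simps)
    moreover have "p m ((W s - W t) * iexp (\<theta> s *\<^sub>R h)) \<le> (L * \<bar>s - t\<bar>) * 1"
      by (rule p.p_mult_le[OF L unit_norm[OF unit_iexp]]) (use h in \<open>simp add: st_scaleR\<close>)
    moreover have "p m (W t * (iexp (\<theta> s *\<^sub>R h) - iexp (\<theta> t *\<^sub>R h))) \<le> 1 * (exp R * (b * \<bar>s - t\<bar> * R))"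
      by (rule p.p_mult_le[OF unit_norm E]) (use W in \<open>simp add: unit_curve_def\<close>)
    ultimately have "p m (W s * iexp (\<theta> s *\<^sub>R h) * c - W t * iexp (\<theta> t *\<^sub>R h) * c)
        \<le> ((L * \<bar>s - t\<bar>) * 1 + 1 * (exp R * (b * \<bar>s - t\<bar> * R))) * 1"
      by (simp only:) (rule p.p_mult_le[OF order_trans[OF p.p_add add_mono] unit_norm[OF c]])
    then show ?thesis by (simp add: algebra_simps)
  qed
  then show "\<exists>L. \<forall>s t. p m (W s * iexp (\<theta> s *\<^sub>R h) * c - W t * iexp (\<theta> t *\<^sub>R h) * c) \<le> L * \<bar>s - t\<bar>"
    by blast
qed

text \<open>The interval is cut into steps on which the path varies by less than \<delta> for
  \<open>q (Suc n)\<close>, and \<open>lift_step\<close> is applied at each node. Closeness to 1 at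
  level \<open>n\<close> along the whole path is traded for an approximation of the whole path one
  level higher; upstairs, only the endpoint of \<open>W\<close> is controlled.\<close>

lemma lift_path_approx:
  assumes x: "unit_path x" "\<And>t. t \<in> {0..1} \<Longrightarrow> q n (x t - 1) \<le> \<epsilon>"
    and e: "0 < \<epsilon>" "\<epsilon> \<le> 1/1000" and e': "0 < \<epsilon>'"
  shows "\<exists>W. unit_curve W \<and> W 0 - 1 \<in> K \<and> (\<forall>t\<in>{0..1}. q (Suc n) (x t - W t) \<le> \<epsilon>') \<and>
    p n (W 1 - 1) \<le> 8 * \<epsilon>"
proof -
  let ?N = "Suc n"
  \<comment> \<open>Between two nodes the curve may deviate by 11\<delta> from the path, which the
    factor 20 covers.\<close>
  define \<delta> where "\<delta> = min \<epsilon> (\<epsilon>' / 20)"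
  have d: "0 < \<delta>" "\<delta> \<le> \<epsilon>" "20 * \<delta> \<le> \<epsilon>'" using e e' by (auto simp: \<delta>_def)
  obtain \<eta> where eta: "\<eta> > 0" "\<And>s t. s \<in> {0..1} \<Longrightarrow> t \<in> {0..1} \<Longrightarrow> \<bar>s - t\<bar> < \<eta> \<Longrightarrow> q ?N (x s - x t) < \<delta>"
    using x(1) d(1) unfolding unit_path_def by metis
  obtain m' where m': "inverse (real (Suc m')) < \<eta>" using reals_Archimedean[OF eta(1)] by blast
  define m where "m = real (Suc m')"
  have m: "m > 0" "1 / m < \<eta>" using m' by (simp_all add: m_def inverse_eq_divide)
  \<comment> \<open>The bound \<delta> at the node is sharper than the bound \<epsilon>' before it,
    so errors do not accumulate from step to step; constancy after the node provides the starting
    value for the next step.\<close>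
  define good where "good j W \<longleftrightarrow> unit_curve W \<and> W 0 - 1 \<in> K \<and>
    (\<forall>t. real j / m \<le> t \<longrightarrow> W t = W (real j / m)) \<and>
    (\<forall>t. 0 \<le> t \<and> t \<le> real j / m \<longrightarrow> q ?N (x t - W t) \<le> \<epsilon>') \<and>
    q ?N (x (real j / m) - W (real j / m)) \<le> \<delta> \<and> p n (W (real j / m) - 1) \<le> 8 * \<epsilon>" for j W
  have "\<exists>W. good j W" if "j \<le> Suc m'" for j
    using that
  proof (induction j)
    case 0
    have "q ?N (x 0 - 1) = 0" using x(1) by (intro q_K) (simp add: unit_path_def)
    then have "good 0 (\<lambda>_. 1)"
      using d e e' by (auto simp: good_def unit_curve_def K_zero intro!: exI[of _ 0])
    then show ?case by blast
  next
    case (Suc j)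
    then obtain W where W: "good j W" by auto
    define a b where "a = real j / m" and "b = real (Suc j) / m"
    have ab: "b - a = 1 / m" by (simp add: a_def b_def diff_divide_distrib[symmetric])
    have a0: "0 \<le> a" "a < b" using m ab by (simp add: a_def) (use m ab in \<open>smt (verit) divide_pos_pos\<close>)
    have b1: "b \<le> 1" using Suc.prems m by (simp add: b_def m_def)
    have near: "q ?N (x s - x a) \<le> \<delta>" if "a \<le> s" "s \<le> b" for s
    proof -
      have "\<bar>s - a\<bar> < \<eta>" using that ab m by linarith
      then show ?thesis using eta(2)[of s a] that a0 b1 by force
    qed
    define w where "w = W a"
    have Wa: "unit_curve W" "W 0 - 1 \<in> K" "\<And>t. a \<le> t \<Longrightarrow> W t = w"
      "\<And>t. 0 \<le> t \<Longrightarrow> t \<le> a \<Longrightarrow> q ?N (x t - W t) \<le> \<epsilon>'" "q ?N (x a - w) \<le> \<delta>" "p n (w - 1) \<le> 8 * \<epsilon>"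
      using W unfolding good_def a_def[symmetric] w_def by blast+
    have uw: "unit w" using Wa(1) by (simp add: w_def unit_curve_def)
    have xb: "q ?N (x b - w) \<le> 2 * \<delta>"
      using q.r_triangle[of ?N "x b" w "x a"] near[of b] a0 Wa(5) by linarith
    obtain h c where hc: "st h = h" "q ?N h \<le> 3 * \<delta>" "unit c" "c - 1 \<in> K"
      "q ?N (x b - w * iexp h) \<le> \<delta>" "p n (w * iexp h * c - 1) \<le> 8 * \<epsilon>"
    proof (rule lift_step[OF uw Wa(6) _ e d(1,2) xb])
      show "unitK (x b)" "q n (x b - 1) \<le> \<epsilon>"
        using x a0 b1 by (auto simp: unit_path_def)
    qed blast
    \<comment> \<open>A ramp from 0 to 1 over the new step: the new exponential is switched on
      continuously, and the earlier part of the curve is unchanged in the quotient.\<close>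
    define \<theta> where "\<theta> t = max 0 (min 1 (m * (t - a)))" for t
    have th: "0 \<le> \<theta> t \<and> \<theta> t \<le> 1" for t by (simp add: \<theta>_def)
    have th_lip: "\<bar>\<theta> s - \<theta> t\<bar> \<le> m * \<bar>s - t\<bar>" for s t
    proof -
      have "\<bar>\<theta> s - \<theta> t\<bar> \<le> \<bar>m * (s - a) - m * (t - a)\<bar>" by (auto simp: \<theta>_def)
      also have "m * (s - a) - m * (t - a) = m * (s - t)" by (simp add: algebra_simps)
      finally show ?thesis using m by (simp add: abs_mult)
    qed
    have th0: "\<theta> t = 0" if "t \<le> a" for t using mult_nonneg_nonpos[of m "t - a"] that m by (simp add: \<theta>_def)
    have th1: "\<theta> t = 1" if "b \<le> t" for t
    proof -
      have "m * (b - a) \<le> m * (t - a)" using that m by (intro mult_left_mono) auto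
      then show ?thesis using m by (simp add: \<theta>_def ab)
    qed
    \<comment> \<open>The factor \<open>c\<close> multiplies the curve at all times, not only from
      the new node on: since \<open>c - 1\<close> lies in \<open>K\<close> the quotient does not see
      it, and no jump is created.\<close>
    define V where "V t = W t * iexp (\<theta> t *\<^sub>R h) * c" for t
    have cV: "V t - W t * iexp (\<theta> t *\<^sub>R h) \<in> K" for t
    proof -
      have "V t - W t * iexp (\<theta> t *\<^sub>R h) = W t * iexp (\<theta> t *\<^sub>R h) * (c - 1)" by (simp add: V_def algebra_simps)
      then show ?thesis using hc(4) by (simp only: K_mult_left)
    qed
    have qV: "q ?N (y - V t) = q ?N (y - W t * iexp (\<theta> t *\<^sub>R h))" for y t
      by (rule q_eq_K) (use K_minus[OF cV[of t]] in \<open>simp add: algebra_simps\<close>)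
    have "good (Suc j) V"
      unfolding good_def b_def[symmetric]
    proof (intro conjI allI impI)
      show "unit_curve V"
        unfolding V_def by (rule unit_curve_mult[OF Wa(1) hc(1,3) th th_lip])
      show "V 0 - 1 \<in> K"
        unfolding V_def th0[OF a0(1)] scaleR_zero_left
        by (intro one_plus_K_mult Wa(2) hc(4) iexp_minus_one_in_K K_zero)
      show "V t = V b" if "b \<le> t" for t
        using that a0 by (simp add: V_def th1 Wa(3))
      have Vb: "V b = w * iexp h * c" using a0 by (simp add: V_def th1 Wa(3))
      show "p n (V b - 1) \<le> 8 * \<epsilon>" using hc(6) by (simp add: Vb)
      show "q ?N (x b - V b) \<le> \<delta>"
        unfolding qV using hc(5) a0 by (simp add: th1 Wa(3))
      fix t assume t: "0 \<le> t \<and> t \<le> b"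
      show "q ?N (x t - V t) \<le> \<epsilon>'"
      proof (cases "t \<le> a")
        case True
        have "q ?N (x t - V t) = q ?N (x t - W t)"
          unfolding qV th0[OF True] scaleR_zero_left
        proof (rule q_eq_K)
          have "x t - W t * iexp 0 - (x t - W t) = - (W t * (iexp 0 - 1))" by (simp add: algebra_simps)
          then show "x t - W t * iexp 0 - (x t - W t) \<in> K"
            by (simp only: K_minus K_mult_left iexp_minus_one_in_K K_zero)
        qed
        then show ?thesis using Wa(4)[of t] True t by simp
      next
        case False
        have "q ?N (\<theta> t *\<^sub>R h) \<le> 1 * (3 * \<delta>)"
          by (rule order_trans[OF q.r_scaleR mult_mono]) (use th hc(2) in auto)
        then have th_h: "q ?N (\<theta> t *\<^sub>R h) \<le> 3 * \<delta>" by simp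
        have "q ?N (iexp (\<theta> t *\<^sub>R h) - 1) \<le> 3 * q ?N (\<theta> t *\<^sub>R h)"
          by (rule iexp_minus_one[OF q_star_seminormed q_le_p])
            (use hc(1) th_h d e in \<open>auto simp: st_scaleR\<close>)
        then have 1: "q ?N (1 - iexp (\<theta> t *\<^sub>R h)) \<le> 9 * \<delta>"
          using th_h q.r_commute[of ?N 1 "iexp (\<theta> t *\<^sub>R h)"] by linarith
        have 2: "q ?N (w - w * iexp (\<theta> t *\<^sub>R h)) \<le> 9 * \<delta>"
          using q_unit_mult_left[OF uw, of ?N "1 - iexp (\<theta> t *\<^sub>R h)"] 1
          by (simp add: right_diff_distrib)
        have Wt: "W t = w" using False Wa(3) by simp
        have "q ?N (x t - w * iexp (\<theta> t *\<^sub>R h)) \<le> \<delta> + (\<delta> + 9 * \<delta>)"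
          using q.r_triangle[of ?N "x t" "w * iexp (\<theta> t *\<^sub>R h)" "x a"]
            q.r_triangle[of ?N "x a" "w * iexp (\<theta> t *\<^sub>R h)" w] near[of t] False t Wa(5) 2
          by linarith
        then show ?thesis unfolding qV Wt using d by linarith
      qed
    qed
    then show ?case by blast
  qed
  then obtain W where W: "good (Suc m') W" by blast
  have m1: "real (Suc m') / m = 1" using m by (simp add: m_def)
  show ?thesis
  proof (intro exI[of _ W] conjI ballI)
    show "unit_curve W" "W 0 - 1 \<in> K" "p n (W 1 - 1) \<le> 8 * \<epsilon>"
      using W unfolding good_def m1 by blast+
    show "q ?N (x t - W t) \<le> \<epsilon>'" if "t \<in> {0..1}" for t
      using W that unfolding good_def m1 atLeastAtMost_iff by blast
  qed
qed

lemma unit_path_step: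
  assumes x: "unit_path x" and W: "unit_curve W" "W 0 - 1 \<in> K"
  shows "unit_path (\<lambda>t. st (W t) * x t)"
  unfolding unit_path_def
proof (intro conjI allI impI ballI)
  have uW: "unit (st (W t))" for t using W by (auto simp: unit_curve_def intro: unit_st)
  show "unitK (st (W t) * x t)" if "t \<in> {0..1}" for t
    using that x by (intro unitK_mult[OF unit_imp_unitK[OF uW]]) (simp add: unit_path_def)
  show "st (W 0) * x 0 - 1 \<in> K"
    using K_st[OF W(2)] x by (intro one_plus_K_mult) (auto simp: unit_path_def st_diff)
  fix m
  obtain B where B: "\<And>t. t \<in> {0..1} \<Longrightarrow> q m (x t) \<le> B" using x unfolding unit_path_def by metis
  show "\<exists>B. \<forall>t\<in>{0..1}. q m (st (W t) * x t) \<le> B"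
    using B q_unit_mult_left[OF uW] by (meson order_trans)
  obtain L where L: "\<And>s t. p m (W s - W t) \<le> L * \<bar>s - t\<bar>"
    using W(1) unfolding unit_curve_def by metis
  fix e :: real assume e: "e > 0"
  obtain d where d: "d > 0" "\<And>s t. s \<in> {0..1} \<Longrightarrow> t \<in> {0..1} \<Longrightarrow> \<bar>s - t\<bar> < d \<Longrightarrow> q m (x s - x t) < e / 2"
    using x e unfolding unit_path_def by (metis half_gt_zero)
  define C where "C = (\<bar>L\<bar> + 1) * (\<bar>B\<bar> + 1)"
  have C: "C > 0" unfolding C_def by (intro mult_pos_pos) auto
  have "q m (st (W s) * x s - st (W t) * x t) < e"
    if st: "s \<in> {0..1}" "t \<in> {0..1}" "\<bar>s - t\<bar> < min d (e / (2 * C))" for s t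
  proof -
    have "q m (st (W s) * x s - st (W t) * x t) = q m (st (W s) * (x s - x t) + st (W s - W t) * x t)"
      by (simp add: st_diff algebra_simps)
    also have "\<dots> \<le> q m (st (W s) * (x s - x t)) + q m (st (W s - W t) * x t)" by (rule q.r_add)
    also have "q m (st (W s) * (x s - x t)) < e / 2"
      using q_unit_mult_left[OF uW, of m s "x s - x t"] d(2)[OF st(1,2)] st(3) by linarith
    also have "q m (st (W s - W t) * x t) \<le> ((\<bar>L\<bar> + 1) * \<bar>s - t\<bar>) * (\<bar>B\<bar> + 1)"
    proof (rule q.r_mult_le)
      have "q m (st (W s - W t)) \<le> L * \<bar>s - t\<bar>"
        using q_le_p[of m "st (W s - W t)"] L[of s t] by simp
      also have "\<dots> \<le> (\<bar>L\<bar> + 1) * \<bar>s - t\<bar>" by (rule mult_right_mono) auto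
      finally show "q m (st (W s - W t)) \<le> (\<bar>L\<bar> + 1) * \<bar>s - t\<bar>" .
      show "q m (x t) \<le> \<bar>B\<bar> + 1" using B[OF st(2)] by linarith
    qed
    also have "((\<bar>L\<bar> + 1) * \<bar>s - t\<bar>) * (\<bar>B\<bar> + 1) = C * \<bar>s - t\<bar>" by (simp add: C_def)
    also have "C * \<bar>s - t\<bar> \<le> C * (e / (2 * C))" by (rule mult_left_mono) (use st C in auto)
    also have "C * (e / (2 * C)) = e / 2" using C by simp
    finally show ?thesis by simp
  qed
  then show "\<exists>d>0. \<forall>s\<in>{0..1}. \<forall>t\<in>{0..1}. \<bar>s - t\<bar> < d \<longrightarrow> q m (st (W s) * x s - st (W t) * x t) < e"
    using d(1) e C by (intro exI[of _ "min d (e / (2 * C))"]) auto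
qed

text \<open>At stage \<open>n\<close> the remaining path is within \<open>eps n\<close> of 1 for
  \<open>q n\<close>, and its approximate lift ends within \<open>8 * eps n\<close> of 1 for
  \<open>p n\<close>. A fixed seminorm controls only the factors from its own stage on, which is
  enough for convergence of the product.\<close>

theorem unit_path_endpoint_lift:
  assumes "unit_path x"
  obtains w where "unit w" "x 1 - w \<in> K"
proof -
  define eps where "eps n = (1/1000) * (1/2 :: real) ^ n" for n
  have eps: "0 < eps n" "eps n \<le> 1/1000" for n
    by (simp_all add: eps_def power_le_one)
  \<comment> \<open>Entry \<open>n\<close> pairs the path left after \<open>n\<close> divisions with
    the endpoint of the curve used in the last of them; entry 0 has no such endpoint, so its second
    component is arbitrary.\<close>
  have "\<exists>f :: nat \<Rightarrow> (real \<Rightarrow> 't) \<times> 't. \<forall>n.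
      (unit_path (fst (f n)) \<and> (\<forall>t\<in>{0..1}. q n (fst (f n) t - 1) \<le> eps n) \<and> (n = 0 \<longrightarrow> fst (f n) = x)) \<and>
      (unit (snd (f (Suc n))) \<and> p n (snd (f (Suc n)) - 1) \<le> 8 * eps n \<and>
        fst (f (Suc n)) 1 = st (snd (f (Suc n))) * fst (f n) 1)"
  proof (rule dependent_nat_choice)
    have "q 0 y = 0" for y using q_le_p[of 0 y] q_nonneg[of 0 y] by (simp add: p_0)
    then show "\<exists>f. unit_path (fst f) \<and> (\<forall>t\<in>{0..1}. q 0 (fst f t - 1) \<le> eps 0) \<and> (0 = 0 \<longrightarrow> fst f = x)"
      using assms eps(1)[of 0] by (intro exI[of _ "(x, undefined)"]) auto
  next
    fix f :: "(real \<Rightarrow> 't) \<times> 't" and n :: nat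
    assume f: "unit_path (fst f) \<and> (\<forall>t\<in>{0..1}. q n (fst f t - 1) \<le> eps n) \<and> (n = 0 \<longrightarrow> fst f = x)"
    obtain W where W: "unit_curve W" "W 0 - 1 \<in> K" "\<And>t. t \<in> {0..1} \<Longrightarrow> q (Suc n) (fst f t - W t) \<le> eps (Suc n)"
      "p n (W 1 - 1) \<le> 8 * eps n"
      using lift_path_approx[of "fst f" n "eps n" "eps (Suc n)"] f eps by blast
    have "q (Suc n) (st (W t) * fst f t - 1) \<le> eps (Suc n)" if t: "t \<in> {0..1}" for t
    proof -
      have uW: "unit (W t)" using W(1) by (simp add: unit_curve_def)
      have "st (W t) * fst f t - 1 - st (W t) * (fst f t - W t) = st (W t) * W t - 1"
        by (simp add: algebra_simps)
      moreover have "st (W t) * W t - 1 \<in> K" using uW by (auto simp: unit_def intro: K_null)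
      ultimately have "st (W t) * fst f t - 1 - st (W t) * (fst f t - W t) \<in> K" by (simp only:)
      then have "q (Suc n) (st (W t) * fst f t - 1) = q (Suc n) (st (W t) * (fst f t - W t))"
        by (rule q_eq_K)
      then show ?thesis
        using q_unit_mult_left[OF unit_st[OF uW], of "Suc n" "fst f t - W t"] W(3)[OF t] by linarith
    qed
    then show "\<exists>g. (unit_path (fst g) \<and> (\<forall>t\<in>{0..1}. q (Suc n) (fst g t - 1) \<le> eps (Suc n)) \<and>
          (Suc n = 0 \<longrightarrow> fst g = x)) \<and>
        (unit (snd g) \<and> p n (snd g - 1) \<le> 8 * eps n \<and> fst g 1 = st (snd g) * fst f 1)"
      using unit_path_step[of "fst f" W] f W
      by (intro exI[of _ "(\<lambda>t. st (W t) * fst f t, W 1)"]) (auto simp: unit_curve_def)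
  qed
  then obtain f :: "nat \<Rightarrow> (real \<Rightarrow> 't) \<times> 't" where
    f: "\<And>n t. t \<in> {0..1} \<Longrightarrow> q n (fst (f n) t - 1) \<le> eps n" "fst (f 0) = x"
      "\<And>n. unit (snd (f (Suc n)))" "\<And>n. p n (snd (f (Suc n)) - 1) \<le> 8 * eps n"
      "\<And>n. fst (f (Suc n)) 1 = st (snd (f (Suc n))) * fst (f n) 1"
    by metis
  define V where "V n = rec_nat 1 (\<lambda>i v. v * snd (f (Suc i))) n" for n
  have V: "V 0 = 1" "\<And>n. V (Suc n) = V n * snd (f (Suc n))" by (simp_all add: V_def)
  have uV: "unit (V n)" for n by (induction n) (auto simp: V intro: unit_mult f)
  have xV: "fst (f n) 1 = st (V n) * x 1" for n
    by (induction n) (simp_all add: V f(2,5) st_mult mult.assoc)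
  have "\<exists>l. \<forall>n. (\<lambda>i. p n (V i - l)) \<longlonglongrightarrow> 0"
  proof (rule complete_geometric)
    fix n
    \<comment> \<open>Only indices \<open>i \<ge> n\<close> are estimated: the new factor is near 1
      for \<open>p i\<close>, which dominates \<open>p n\<close>.\<close>
    have "p n (V (Suc i) - V i) \<le> (8 / 1000) * (1/2) ^ i" if "n \<le> i" for i
    proof -
      have "V (Suc i) - V i = V i * (snd (f (Suc i)) - 1)" by (simp add: V algebra_simps)
      then have "p n (V (Suc i) - V i) \<le> 1 * (8 * eps i)"
        using p.p_mult_le[OF unit_norm[OF uV[of i]] order_trans[OF p_mono[OF that] f(4)[of i]]] by simp
      then show ?thesis by (simp add: eps_def)
    qed
    then show "\<exists>C N. \<forall>i\<ge>N. p n (V (Suc i) - V i) \<le> C * (1/2) ^ i" by blast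
  qed
  then obtain w where w: "\<And>n. (\<lambda>i. p n (V i - w)) \<longlonglongrightarrow> 0" by blast
  have "p n (st w * w - 1) = 0" for n
    by (rule unit_limit[of n V 1 w]) (use uV w in \<open>auto simp: unit_norm unit_st simp flip: unit_def\<close>, auto simp: unit_def)
  moreover have "p n (st (st w) * st w - 1) = 0" for n
    by (rule unit_limit[of n "\<lambda>i. st (V i)" 1 "st w"])
      (use uV w in \<open>auto simp: unit_norm st_diff[symmetric]\<close>, auto simp: unit_def)
  ultimately have "unit w" by (simp add: unit_def)
  moreover have "x 1 - w \<in> K"
  proof (rule q_zero_K)
    fix m
    \<comment> \<open>Modulo \<open>K\<close>, the difference \<open>x 1 - V n\<close> is
      \<open>V n\<close> times the deviation of the remaining endpoint from 1.\<close>
    have "q m (x 1 - w) \<le> eps n + p m (V n - w)" if n: "m \<le> n" for n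
    proof -
      have "V n * st (V n) - 1 \<in> K" using uV[of n] by (auto simp: unit_def intro: K_null)
      then have "x 1 - V n - V n * (fst (f n) 1 - 1) \<in> K"
        using K_minus[OF K_mult_right[of "V n * st (V n) - 1" "x 1"]]
        by (simp add: xV algebra_simps)
      then have "q m (x 1 - V n) = q m (V n * (fst (f n) 1 - 1))" by (rule q_eq_K)
      also have "\<dots> \<le> q n (fst (f n) 1 - 1)"
        using q_unit_mult_left[OF uV[of n], of m] q_mono[OF n] order_trans by blast
      also have "\<dots> \<le> eps n" by (rule f) simp
      finally show ?thesis
        using q.r_triangle[of m "x 1" w "V n"] q_le_p[of m "V n - w"] by linarith
    qed
    moreover have "(\<lambda>n. eps n + p m (V n - w)) \<longlonglongrightarrow> (1/1000) * 0 + 0"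
      unfolding eps_def by (intro tendsto_intros w LIMSEQ_power_zero) simp
    ultimately have "q m (x 1 - w) \<le> (1/1000) * 0 + 0"
      by (intro LIMSEQ_le_const) auto
    then show "q m (x 1 - w) = 0" using q_nonneg[of m "x 1 - w"] by simp
  qed
  ultimately show thesis by (rule that)
qed

text \<open>Compactness of the interval does the work: a Lebesgue number of the cover by the balls
  of radius \<open>D t\<close> gives uniform continuity, and the compact image of \<open>q m\<close>
  along the path gives the bound.\<close>

lemma unit_pathI:
  assumes "\<And>t. t \<in> {0..1} \<Longrightarrow> unitK (x t)" "x 0 - 1 \<in> K"
    and c: "\<And>m t e. t \<in> {0..1} \<Longrightarrow> e > 0 \<Longrightarrow> \<exists>d>0. \<forall>s\<in>{0..1}. \<bar>s - t\<bar> < d \<longrightarrow> q m (x s - x t) < e"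
  shows "unit_path x"
  unfolding unit_path_def
proof (intro conjI ballI allI impI)
  fix m
  have "continuous_on {0..1} (\<lambda>t. q m (x t))"
    unfolding continuous_on_iff
  proof (intro ballI allI impI)
    fix t e :: real assume t: "t \<in> {0..1}" "e > 0"
    then obtain d where d: "d > 0" "\<And>s. s \<in> {0..1} \<Longrightarrow> \<bar>s - t\<bar> < d \<Longrightarrow> q m (x s - x t) < e"
      using c by metis
    have "dist (q m (x s)) (q m (x t)) < e" if "s \<in> {0..1}" "dist s t < d" for s
      using d(2)[of s] that q.r_triangle[of m "x s" 0 "x t"] q.r_triangle[of m "x t" 0 "x s"]
        q.r_commute[of m "x s" "x t"] by (simp add: dist_real_def)
    then show "\<exists>d>0. \<forall>s\<in>{0..1}. dist s t < d \<longrightarrow> dist (q m (x s)) (q m (x t)) < e"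
      using d(1) by blast
  qed
  then have "compact ((\<lambda>t. q m (x t)) ` {0..1})" by (rule compact_continuous_image) simp
  then have "bdd_above ((\<lambda>t. q m (x t)) ` {0..1})" by (intro bounded_imp_bdd_above compact_imp_bounded)
  then show "\<exists>B. \<forall>t\<in>{0..1}. q m (x t) \<le> B" unfolding bdd_above_def by blast
  fix e :: real assume e: "e > 0"
  then have "\<forall>t\<in>{0..1}. \<exists>d>0. \<forall>s\<in>{0..1}. \<bar>s - t\<bar> < d \<longrightarrow> q m (x s - x t) < e / 2"
    using c half_gt_zero by blast
  then obtain D where D: "\<And>t. t \<in> {0..1} \<Longrightarrow> D t > 0"
    "\<And>s t. t \<in> {0..1} \<Longrightarrow> s \<in> {0..1} \<Longrightarrow> \<bar>s - t\<bar> < D t \<Longrightarrow> q m (x s - x t) < e / 2"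
    by metis
  obtain d where d: "d > 0" "\<And>t. t \<in> {0..1} \<Longrightarrow> \<exists>G\<in>(\<lambda>t. ball t (D t)) ` {0..1}. ball t d \<subseteq> G"
    by (rule Heine_Borel_lemma[of "{0..1::real}" "(\<lambda>t. ball t (D t)) ` {0..1}"]) (use D(1) in auto)
  have "q m (x s - x t) < e" if st: "s \<in> {0..1}" "t \<in> {0..1}" "\<bar>s - t\<bar> < d" for s t
  proof -
    obtain u where u: "u \<in> {0..1}" "ball t d \<subseteq> ball u (D u)" using d(2)[OF st(2)] by blast
    have "s \<in> ball t d" "t \<in> ball t d" using st d(1) by (auto simp: dist_real_def)
    then have "s \<in> ball u (D u)" "t \<in> ball u (D u)" using u(2) by blast+
    then have "\<bar>s - u\<bar> < D u" "\<bar>t - u\<bar> < D u" by (auto simp: dist_real_def abs_minus_commute)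
    then have "q m (x s - x u) < e / 2" "q m (x t - x u) < e / 2" using D(2) u st by auto
    then show ?thesis using q.r_triangle[of m "x s" "x t" "x u"] q.r_commute[of m "x u" "x t"] by linarith
  qed
  then show "\<exists>d>0. \<forall>s\<in>{0..1}. \<forall>t\<in>{0..1}. \<bar>s - t\<bar> < d \<longrightarrow> q m (x s - x t) < e"
    using d(1) by blast
qed (use assms in auto)

end

section \<open>Neighbourhoods, limits and closures tested by an increasing sequence of
  seminorms\<close>

section \<open>Topologies defined by seminorms\<close>

text \<open>\<open>P\<close> generates the topology; the increasing sequence \<open>s\<close> has
  open balls and dominates \<open>P\<close>, so a neighbourhood can be tested with a single
  \<open>s n\<close>. There are two instances: the algebra itself, where \<open>s\<close> consists
  of running maxima of a countable \<open>P\<close>, and the operator algebra, where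
  \<open>P\<close> comes from all continuous C*-seminorms.\<close>

locale graded_seminorms = abelian_group B for B :: "('a, 'b) ring_scheme" (structure) +
  fixes P :: "('a \<Rightarrow> real) set" and s :: "nat \<Rightarrow> 'a \<Rightarrow> real"
  assumes P_nonempty: "P \<noteq> {}"
    and P_triangle: "\<lbrakk>r \<in> P; x \<in> carrier B; y \<in> carrier B\<rbrakk> \<Longrightarrow> r (x \<oplus> y) \<le> r x + r y"
    and P_zero: "r \<in> P \<Longrightarrow> r \<zero> = 0"
    and P_dominated: "r \<in> P \<Longrightarrow> \<exists>n. \<exists>C>0. \<forall>y\<in>carrier B. r y \<le> C * s n y"
    and s_mono: "\<lbrakk>y \<in> carrier B; m \<le> n\<rbrakk> \<Longrightarrow> s m y \<le> s n y"
    and s_nonneg: "y \<in> carrier B \<Longrightarrow> 0 \<le> s n y"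
    and s_zero: "s n \<zero> = 0"
    and s_open: "\<lbrakk>x \<in> carrier B; 0 < e\<rbrakk> \<Longrightarrow>
      openin (seminorm_topology B P) {y \<in> carrier B. s n (y \<ominus> x) < e}"
begin

abbreviation "T \<equiv> seminorm_topology B P"

lemma minus_self: "x \<in> carrier B \<Longrightarrow> x \<ominus> x = \<zero>"
  by (simp add: a_minus_def r_neg)

lemma minus_trans:
  "\<lbrakk>x \<in> carrier B; y \<in> carrier B; z \<in> carrier B\<rbrakk> \<Longrightarrow> x \<ominus> z = (x \<ominus> y) \<oplus> (y \<ominus> z)"
  by (simp add: a_minus_def a_assoc r_neg1 r_neg2 l_neg)

lemma P_ball: "\<lbrakk>r \<in> P; x \<in> carrier B; 0 < e\<rbrakk> \<Longrightarrow> openin T {y \<in> carrier B. r (y \<ominus> x) < e}"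
  unfolding seminorm_topology_def by (rule topology_generated_by_Basis) blast

lemma topspace_T: "topspace T = carrier B"
proof
  show "topspace T \<subseteq> carrier B"
    unfolding seminorm_topology_def topology_generated_by_topspace by blast
  obtain r where r: "r \<in> P" using P_nonempty by blast
  show "carrier B \<subseteq> topspace T"
  proof
    fix x assume x: "x \<in> carrier B"
    have "x \<in> {y \<in> carrier B. r (y \<ominus> x) < 1}" using x r by (simp add: minus_self P_zero)
    then show "x \<in> topspace T" using openin_subset[OF P_ball[OF r x, of 1]] by auto
  qed
qed

text \<open>Induction over the generation of the topology; for an intersection the two indices are
  replaced by their maximum, which is where monotonicity of \<open>s\<close> enters.\<close>

lemma open_contains_ball:
  assumes "openin T U" "x \<in> U"
  shows "\<exists>n. \<exists>e>0. \<forall>y\<in>carrier B. s n (y \<ominus> x) < e \<longrightarrow> y \<in> U"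
proof -
  have "generate_topology_on {{y \<in> carrier B. r (y \<ominus> x) < e} | r x e. r \<in> P \<and> x \<in> carrier B \<and> 0 < e} U"
    using assms(1) by (simp add: seminorm_topology_def openin_topology_generated_by_iff)
  then show ?thesis using assms(2)
  proof (induction arbitrary: x)
    case (Int U V)
    obtain n e where n: "e > 0" "\<And>y. y \<in> carrier B \<Longrightarrow> s n (y \<ominus> x) < e \<Longrightarrow> y \<in> U"
      using Int.IH(1)[of x] Int.prems by blast
    obtain m d where m: "d > 0" "\<And>y. y \<in> carrier B \<Longrightarrow> s m (y \<ominus> x) < d \<Longrightarrow> y \<in> V"
      using Int.IH(2)[of x] Int.prems by blast
    have "U \<subseteq> carrier B"
      using Int.hyps(1) openin_subset[of T U] unfolding topspace_T
      by (simp add: openin_topology_generated_by_iff seminorm_topology_def)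
    then have x: "x \<in> carrier B" using Int.prems by blast
    have "y \<in> U \<inter> V" if y: "y \<in> carrier B" "s (max n m) (y \<ominus> x) < min e d" for y
    proof -
      have "y \<ominus> x \<in> carrier B" using y x by simp
      then have "s n (y \<ominus> x) \<le> s (max n m) (y \<ominus> x)" "s m (y \<ominus> x) \<le> s (max n m) (y \<ominus> x)"
        by (simp_all add: s_mono)
      then show ?thesis using y n(2)[of y] m(2)[of y] by simp
    qed
    moreover have "min e d > 0" using n m by simp
    ultimately show ?case by blast
  next
    case (UN \<U>)
    obtain V where V: "V \<in> \<U>" "x \<in> V" using UN.prems by (rule UnionE)
    show ?case using UN.IH[OF V] UnionI[OF V(1)] by meson
  next
    case (Basis V)
    then obtain r z e where V: "V = {y \<in> carrier B. r (y \<ominus> z) < e}" "r \<in> P" "z \<in> carrier B" by blast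
    have x: "x \<in> carrier B" "r (x \<ominus> z) < e" using Basis.prems V by auto
    obtain n C where C: "C > 0" "\<And>y. y \<in> carrier B \<Longrightarrow> r y \<le> C * s n y" using P_dominated[OF V(2)] by blast
    define d where "d = (e - r (x \<ominus> z)) / C"
    have "y \<in> V" if y: "y \<in> carrier B" "s n (y \<ominus> x) < d" for y
    proof -
      have "r (y \<ominus> z) \<le> r (y \<ominus> x) + r (x \<ominus> z)"
        using P_triangle[OF V(2), of "y \<ominus> x" "x \<ominus> z"] minus_trans[of y x z] y(1) x(1) V(3) by (simp only: minus_closed)
      also have "r (y \<ominus> x) \<le> C * s n (y \<ominus> x)" using C(2) y x by simp
      also have "\<dots> < C * d" using y C by simp
      also have "C * d = e - r (x \<ominus> z)" using C by (simp add: d_def)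
      finally show ?thesis using y V by simp
    qed
    moreover have "d > 0" using x C by (simp add: d_def)
    ultimately show ?case by blast
  qed simp
qed

lemma limitin_iff:
  assumes "\<And>i. f i \<in> carrier B"
  shows "limitin T f l F \<longleftrightarrow> l \<in> carrier B \<and> (\<forall>n. ((\<lambda>i. s n (f i \<ominus> l)) \<longlongrightarrow> 0) F)"
proof
  assume L: "limitin T f l F"
  then have l: "l \<in> carrier B" using limitin_topspace topspace_T by metis
  have "((\<lambda>i. s n (f i \<ominus> l)) \<longlongrightarrow> 0) F" for n
  proof (rule tendstoI)
    fix e :: real assume e: "e > 0"
    have "\<forall>\<^sub>F i in F. f i \<in> {y \<in> carrier B. s n (y \<ominus> l) < e}"
      using L s_open[OF l e] l e unfolding limitin_def by (force simp: minus_self s_zero)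
    then show "\<forall>\<^sub>F i in F. dist (s n (f i \<ominus> l)) 0 < e"
      by eventually_elim (use l in \<open>auto simp: s_nonneg dist_real_def\<close>)
  qed
  then show "l \<in> carrier B \<and> (\<forall>n. ((\<lambda>i. s n (f i \<ominus> l)) \<longlongrightarrow> 0) F)" using l by blast
next
  assume R: "l \<in> carrier B \<and> (\<forall>n. ((\<lambda>i. s n (f i \<ominus> l)) \<longlongrightarrow> 0) F)"
  show "limitin T f l F"
    unfolding limitin_def
  proof (intro conjI allI impI)
    show "l \<in> topspace T" using R topspace_T by simp
    fix U assume "openin T U \<and> l \<in> U"
    then obtain n e where "e > 0" and U: "\<And>y. y \<in> carrier B \<Longrightarrow> s n (y \<ominus> l) < e \<Longrightarrow> y \<in> U"
      using open_contains_ball[of U l] by blast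
    moreover have "\<forall>\<^sub>F i in F. s n (f i \<ominus> l) < e"
      using R \<open>e > 0\<close> order_tendstoD(2) by blast
    ultimately show "\<forall>\<^sub>F i in F. f i \<in> U"
      using assms by (auto elim: eventually_mono)
  qed
qed

lemma closure_of_iff:
  assumes "S \<subseteq> carrier B"
  shows "x \<in> T closure_of S \<longleftrightarrow> x \<in> carrier B \<and> (\<forall>n. \<forall>e>0. \<exists>y\<in>S. s n (y \<ominus> x) < e)"
proof
  assume c: "x \<in> T closure_of S"
  then have x: "x \<in> carrier B" using topspace_T by (auto simp: in_closure_of)
  have "\<exists>y\<in>S. s n (y \<ominus> x) < e" if e: "e > 0" for n e
  proof -
    have "x \<in> {y \<in> carrier B. s n (y \<ominus> x) < e}" using x e by (simp add: minus_self s_zero)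
    moreover have "\<forall>U. x \<in> U \<and> openin T U \<longrightarrow> (\<exists>y. y \<in> S \<and> y \<in> U)"
      using c unfolding in_closure_of by (rule conjunct2)
    ultimately have "\<exists>y. y \<in> S \<and> y \<in> {y \<in> carrier B. s n (y \<ominus> x) < e}"
      using s_open[OF x e, of n] by (meson)
    then show ?thesis by auto
  qed
  then show "x \<in> carrier B \<and> (\<forall>n. \<forall>e>0. \<exists>y\<in>S. s n (y \<ominus> x) < e)" using x by blast
next
  assume R: "x \<in> carrier B \<and> (\<forall>n. \<forall>e>0. \<exists>y\<in>S. s n (y \<ominus> x) < e)"
  show "x \<in> T closure_of S"
    unfolding in_closure_of
  proof (intro conjI allI impI)
    show "x \<in> topspace T" using R topspace_T by simp
    fix U assume "x \<in> U \<and> openin T U"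
    then obtain n e where "e > 0" and U: "\<And>y. y \<in> carrier B \<Longrightarrow> s n (y \<ominus> x) < e \<Longrightarrow> y \<in> U"
      using open_contains_ball[of U x] by blast
    obtain y where y: "y \<in> S" "s n (y \<ominus> x) < e" using R \<open>e > 0\<close> by meson
    have "y \<in> U" by (rule U) (use y assms in auto)
    then show "\<exists>y. y \<in> S \<and> y \<in> U" using y(1) by blast
  qed
qed

end

section \<open>Seminorm rules in the carrier and inner products over finitely many
  coordinates\<close>

section \<open>C*-seminorms on a star-algebra\<close>

context star_algebra
begin

context
  fixes p assumes p: "cstar_seminorm A p"
begin

lemma cs_nonneg: "x \<in> carrier A \<Longrightarrow> 0 \<le> p x"
  and cs_add: "\<lbrakk>x \<in> carrier A; y \<in> carrier A\<rbrakk> \<Longrightarrow> p (x \<oplus> y) \<le> p x + p y"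
  and cs_cscale: "x \<in> carrier A \<Longrightarrow> p (cscale A c x) = cmod c * p x"
  and cs_mult: "\<lbrakk>x \<in> carrier A; y \<in> carrier A\<rbrakk> \<Longrightarrow> p (x \<otimes> y) \<le> p x * p y"
  and cs_star_mult: "x \<in> carrier A \<Longrightarrow> p (star A x \<otimes> x) = (p x)\<^sup>2"
  using p by (auto simp: cstar_seminorm_def)

lemma cs_zero: "p \<zero> = 0"
  using cs_cscale[of \<zero> 0] by simp

lemma cs_minus: "x \<in> carrier A \<Longrightarrow> p (\<ominus> x) = p x"
  using cs_cscale[of x "-1"] by (simp add: cscale_minus)

lemma cs_star: "x \<in> carrier A \<Longrightarrow> p (star A x) = p x"
proof -
  assume x: "x \<in> carrier A"
  interpret c: cstar_seminormed free_adj free_J "\<lambda>f. p (free_eval f)"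
    by (rule cstar_seminormed_free_eval[OF p])
  show ?thesis using c.p_st[of "gen x"] x by (simp add: free_eval_adj)
qed

lemma cs_triangle:
  "\<lbrakk>x \<in> carrier A; y \<in> carrier A; z \<in> carrier A\<rbrakk> \<Longrightarrow> p (x \<ominus> z) \<le> p (x \<ominus> y) + p (y \<ominus> z)"
proof -
  assume a: "x \<in> carrier A" "y \<in> carrier A" "z \<in> carrier A"
  then have "x \<ominus> z = (x \<ominus> y) \<oplus> (y \<ominus> z)" by (simp add: a_minus_def a_assoc r_neg1 r_neg2 l_neg)
  then show ?thesis using cs_add[of "x \<ominus> y" "y \<ominus> z"] a by simp
qed

lemma cs_commute: "\<lbrakk>x \<in> carrier A; y \<in> carrier A\<rbrakk> \<Longrightarrow> p (x \<ominus> y) = p (y \<ominus> x)"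
proof -
  assume a: "x \<in> carrier A" "y \<in> carrier A"
  then have "y \<ominus> x = \<ominus> (x \<ominus> y)" by (simp add: a_minus_def minus_add a_comm)
  then show ?thesis using cs_minus[of "x \<ominus> y"] a by simp
qed

lemma cs_minus_zero: "x \<in> carrier A \<Longrightarrow> p (x \<ominus> \<zero>) = p x"
  by (simp add: a_minus_def)

lemma cs_diff_le: "\<lbrakk>x \<in> carrier A; y \<in> carrier A\<rbrakk> \<Longrightarrow> \<bar>p x - p y\<bar> \<le> p (x \<ominus> y)"
  using cs_triangle[of x y \<zero>] cs_triangle[of y x \<zero>] cs_commute[of x y] by (simp add: cs_minus_zero)

lemma cs_one: "p \<one> \<le> 1"
proof -
  interpret c: cstar_seminormed free_adj free_J "\<lambda>f. p (free_eval f)"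
    by (rule cstar_seminormed_free_eval[OF p])
  show ?thesis using c.p_one by simp
qed

lemma cs_finsum: "f \<in> F \<rightarrow> carrier A \<Longrightarrow> p (\<Oplus>k\<in>F. f k) \<le> (\<Sum>k\<in>F. p (f k))"
proof (induction F rule: infinite_finite_induct)
  case (insert x F)
  then have "f \<in> F \<rightarrow> carrier A" "f x \<in> carrier A" by auto
  then show ?case using insert cs_add[of "f x" "\<Oplus>k\<in>F. f k"] by (simp add: finsum_insert)
qed (simp_all add: cs_zero)

end

text \<open>Initial segments \<open>{..<N}\<close> give the partial sums of \<open>l2_inner\<close>,
  intervals \<open>{M..<N}\<close> give the tails in the Cauchy criterion.\<close>

definition gram :: "nat set \<Rightarrow> (nat \<Rightarrow> 'a) \<Rightarrow> (nat \<Rightarrow> 'a) \<Rightarrow> 'a" where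
  "gram F \<xi> \<eta> = (\<Oplus>k\<in>F. star A (\<xi> k) \<otimes> \<eta> k)"

definition gram_norm :: "('a \<Rightarrow> real) \<Rightarrow> nat set \<Rightarrow> (nat \<Rightarrow> 'a) \<Rightarrow> real" where
  "gram_norm p F \<xi> = sqrt (p (gram F \<xi> \<xi>))"

abbreviation seqs :: "(nat \<Rightarrow> 'a) set" where
  "seqs \<equiv> {\<xi>. \<forall>k. \<xi> k \<in> carrier A}"

lemma gram_closed [simp]: "\<lbrakk>\<xi> \<in> seqs; \<eta> \<in> seqs\<rbrakk> \<Longrightarrow> gram F \<xi> \<eta> \<in> carrier A"
  by (auto simp: gram_def star_closed intro!: finsum_closed)

lemma gram_free_eval:
  "\<lbrakk>\<xi> \<in> seqs; \<eta> \<in> seqs\<rbrakk> \<Longrightarrow> gram F \<xi> \<eta> = free_eval (\<Sum>k\<in>F. free_adj (gen (\<xi> k)) * gen (\<eta> k))"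
  by (simp add: gram_def free_eval_sum free_eval_mult free_eval_adj)

lemma gram_add_right:
  assumes "\<xi> \<in> seqs" "\<eta> \<in> seqs" "\<zeta> \<in> seqs"
  shows "gram F \<xi> (l2_add A \<eta> \<zeta>) = gram F \<xi> \<eta> \<oplus> gram F \<xi> \<zeta>"
proof -
  have "gram F \<xi> (l2_add A \<eta> \<zeta>) = (\<Oplus>k\<in>F. star A (\<xi> k) \<otimes> \<eta> k \<oplus> star A (\<xi> k) \<otimes> \<zeta> k)"
    using assms unfolding gram_def l2_add_def by (simp add: r_distr star_closed)
  also have "\<dots> = gram F \<xi> \<eta> \<oplus> gram F \<xi> \<zeta>"
    unfolding gram_def by (rule finsum_addf) (use assms in \<open>auto simp: star_closed\<close>)
  finally show ?thesis .
qed

lemma gram_act_right: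
  assumes "\<xi> \<in> seqs" "\<eta> \<in> seqs" "a \<in> carrier A"
  shows "gram F \<xi> (l2_act A \<eta> a) = gram F \<xi> \<eta> \<otimes> a"
proof (cases "finite F")
  case True
  have "gram F \<xi> (l2_act A \<eta> a) = (\<Oplus>k\<in>F. star A (\<xi> k) \<otimes> \<eta> k \<otimes> a)"
    using assms unfolding gram_def l2_act_def by (simp add: m_assoc star_closed)
  also have "\<dots> = gram F \<xi> \<eta> \<otimes> a"
    unfolding gram_def by (rule finsum_ldistr[symmetric, OF True]) (use assms in \<open>auto simp: star_closed\<close>)
  finally show ?thesis .
qed (use assms in \<open>simp add: gram_def\<close>)

lemma star_gram: "\<lbrakk>\<xi> \<in> seqs; \<eta> \<in> seqs\<rbrakk> \<Longrightarrow> star A (gram F \<xi> \<eta>) = gram F \<eta> \<xi>"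
  unfolding gram_def by (subst star_finsum) (auto simp: star_closed star_mult star_star)

lemma gram_diff:
  assumes "\<xi> \<in> seqs" "\<eta> \<in> seqs" "M \<le> N"
  shows "gram {..<N} \<xi> \<eta> \<ominus> gram {..<M} \<xi> \<eta> = gram {M..<N} \<xi> \<eta>"
proof -
  have "{..<N} = {..<M} \<union> {M..<N}" using assms by auto
  then have "gram {..<N} \<xi> \<eta> = gram {..<M} \<xi> \<eta> \<oplus> gram {M..<N} \<xi> \<eta>"
    unfolding gram_def by (simp only:) (rule finsum_Un_disjoint, use assms in \<open>auto simp: star_closed\<close>)
  moreover have "gram {..<M} \<xi> \<eta> \<in> carrier A" "gram {M..<N} \<xi> \<eta> \<in> carrier A" using assms by simp_all
  ultimately show ?thesis by (simp add: a_minus_def a_comm a_assoc r_neg1)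
qed

context
  fixes p assumes p: "cstar_seminorm A p"
begin

interpretation c: cstar_seminormed free_adj free_J "\<lambda>f. p (free_eval f)"
  by (rule cstar_seminormed_free_eval[OF p])

lemma gram_norm_nonneg: "\<xi> \<in> seqs \<Longrightarrow> 0 \<le> gram_norm p F \<xi>"
  by (simp add: gram_norm_def cs_nonneg[OF p])

lemma gram_norm_square: "\<xi> \<in> seqs \<Longrightarrow> (gram_norm p F \<xi>)\<^sup>2 = p (gram F \<xi> \<xi>)"
  by (simp add: gram_norm_def cs_nonneg[OF p])

lemma gram_Cauchy_Schwarz:
  assumes "\<xi> \<in> seqs" "\<eta> \<in> seqs" "finite F"
  shows "p (gram F \<xi> \<eta>) \<le> gram_norm p F \<xi> * gram_norm p F \<eta>"
  unfolding gram_norm_def real_sqrt_mult[symmetric]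
  by (rule real_le_rsqrt) (use c.gram_cauchy_schwarz[OF assms(3), of "\<lambda>k. gen (\<xi> k)" "\<lambda>k. gen (\<eta> k)"] assms in
      \<open>simp add: gram_free_eval\<close>)

lemma gram_norm_triangle:
  assumes "\<xi> \<in> seqs" "\<eta> \<in> seqs" "finite F"
  shows "gram_norm p F (l2_add A \<xi> \<eta>) \<le> gram_norm p F \<xi> + gram_norm p F \<eta>"
proof -
  have "gram F (l2_add A \<xi> \<eta>) (l2_add A \<xi> \<eta>)
      = free_eval (\<Sum>k\<in>F. free_adj (gen (\<xi> k) + gen (\<eta> k)) * (gen (\<xi> k) + gen (\<eta> k)))"
    using assms by (simp add: gram_def l2_add_def free_eval_sum free_eval_mult free_eval_adj free_eval_add)
  then show ?thesis
    using c.gram_triangle[OF assms(3), of "\<lambda>k. gen (\<xi> k)" "\<lambda>k. gen (\<eta> k)"] assms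
    by (simp add: gram_norm_def gram_free_eval)
qed

lemma gram_norm_mono:
  assumes "\<xi> \<in> seqs" "F \<subseteq> G" "finite G"
  shows "gram_norm p F \<xi> \<le> gram_norm p G \<xi>"
  using c.gram_mono[OF assms(2,3), of "\<lambda>k. gen (\<xi> k)"] assms(1)
  by (simp add: gram_norm_def gram_free_eval)

lemma gram_norm_act:
  assumes "\<xi> \<in> seqs" "a \<in> carrier A"
  shows "gram_norm p F (l2_act A \<xi> a) \<le> gram_norm p F \<xi> * p a"
proof -
  have a: "l2_act A \<xi> a \<in> seqs" using assms by (simp add: l2_act_def)
  have "gram F (l2_act A \<xi> a) (l2_act A \<xi> a) = star A a \<otimes> gram F \<xi> \<xi> \<otimes> a"
  proof -
    have "gram F (l2_act A \<xi> a) \<xi> = star A (gram F \<xi> (l2_act A \<xi> a))"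
      using star_gram[OF assms(1) a] by simp
    then have "gram F (l2_act A \<xi> a) \<xi> = star A a \<otimes> gram F \<xi> \<xi>"
      using assms by (simp add: gram_act_right star_mult star_gram)
    then show ?thesis using assms a by (simp add: gram_act_right)
  qed
  then have "p (gram F (l2_act A \<xi> a) (l2_act A \<xi> a)) \<le> (p a * p (gram F \<xi> \<xi>)) * p a"
    using assms cs_mult[OF p, of "star A a \<otimes> gram F \<xi> \<xi>" a] cs_mult[OF p, of "star A a" "gram F \<xi> \<xi>"]
      mult_right_mono[OF cs_mult[OF p, of "star A a" "gram F \<xi> \<xi>"] cs_nonneg[OF p assms(2)]]
    by (simp add: star_closed cs_star[OF p])
  also have "\<dots> = (gram_norm p F \<xi> * p a)\<^sup>2"
    using gram_norm_square[OF assms(1)] by (simp add: power_mult_distrib power2_eq_square mult_ac)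
  finally show ?thesis
    unfolding gram_norm_def[of p F "l2_act A \<xi> a"]
    using gram_norm_nonneg[OF assms(1)] cs_nonneg[OF p assms(2)] by (intro real_le_lsqrt) simp_all
qed

lemma gram_norm_coord:
  assumes "\<xi> \<in> seqs" "k \<in> F" "finite F"
  shows "p (\<xi> k) \<le> gram_norm p F \<xi>"
proof -
  have "gram {k} \<xi> \<xi> = star A (\<xi> k) \<otimes> \<xi> k" using assms(1) by (simp add: gram_def star_closed)
  then have "gram_norm p {k} \<xi> = p (\<xi> k)"
    using assms(1) by (simp add: gram_norm_def cs_star_mult[OF p] cs_nonneg[OF p])
  then show ?thesis using gram_norm_mono[of \<xi> "{k}" F] assms by simp
qed

lemma gram_norm_le_sum:
  assumes "\<xi> \<in> seqs"
  shows "(gram_norm p F \<xi>)\<^sup>2 \<le> (\<Sum>k\<in>F. (p (\<xi> k))\<^sup>2)"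
  unfolding gram_norm_square[OF assms] unfolding gram_def
  by (rule order_trans[OF cs_finsum[OF p]]) (use assms in \<open>auto simp: star_closed cs_star_mult[OF p]\<close>)

end

text \<open>A maximum, unlike a sum, preserves the C*-identity; this is what makes an increasing
  sequence of C*-seminorms available.\<close>

lemma cstar_seminorm_max:
  assumes p: "cstar_seminorm A p" and q: "cstar_seminorm A q"
  shows "cstar_seminorm A (\<lambda>x. max (p x) (q x))"
  unfolding cstar_seminorm_def
proof (intro conjI ballI allI)
  fix x y assume x: "x \<in> carrier A" and y: "y \<in> carrier A"
  note nn = cs_nonneg[OF p x] cs_nonneg[OF p y] cs_nonneg[OF q x] cs_nonneg[OF q y]
  show "0 \<le> max (p x) (q x)" using nn by simp
  show "max (p (x \<oplus> y)) (q (x \<oplus> y)) \<le> max (p x) (q x) + max (p y) (q y)"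
    using cs_add[OF p x y] cs_add[OF q x y] by linarith
  have "p x * p y \<le> max (p x) (q x) * max (p y) (q y)" "q x * q y \<le> max (p x) (q x) * max (p y) (q y)"
    using nn by (auto intro!: mult_mono)
  then show "max (p (x \<otimes> y)) (q (x \<otimes> y)) \<le> max (p x) (q x) * max (p y) (q y)"
    using cs_mult[OF p x y] cs_mult[OF q x y] by linarith
  show "max (p (cscale A c x)) (q (cscale A c x)) = cmod c * max (p x) (q x)" for c
    using x by (simp add: cs_cscale[OF p] cs_cscale[OF q] max_mult_distrib_left)
  show "max (p (star A x \<otimes> x)) (q (star A x \<otimes> x)) = (max (p x) (q x))\<^sup>2"
    using x nn by (auto simp: cs_star_mult[OF p] cs_star_mult[OF q] max_def)
qed

end

section \<open>An increasing sequence of seminorms for the topology, and sequential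
  convergence\<close>

section \<open>Seminorms of a sigma-C*-algebra\<close>

lemma tendsto_zero_dominated:
  fixes f g :: "nat \<Rightarrow> real"
  assumes "g \<longlonglongrightarrow> 0" "\<And>i. 0 \<le> f i" "\<And>i. f i \<le> g i"
  shows "f \<longlonglongrightarrow> 0"
  using tendsto_sandwich[of "\<lambda>_. 0" f sequentially g] assms by simp

context sigma_cstar_algebra
begin

definition base_seminorm :: "nat \<Rightarrow> 'a \<Rightarrow> real" where
  "base_seminorm = (SOME p. (\<forall>n. cstar_seminorm A (p n)) \<and> tpl A = seminorm_topology A (range p))"

lemma base_seminorm: "cstar_seminorm A (base_seminorm n)" "tpl A = seminorm_topology A (range base_seminorm)"
  using someI_ex[OF countably_many_seminorms] unfolding base_seminorm_def by blast+

primrec level :: "nat \<Rightarrow> 'a \<Rightarrow> real" where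
  "level 0 = base_seminorm 0"
| "level (Suc n) = (\<lambda>x. max (level n x) (base_seminorm (Suc n) x))"

lemma level_cstar: "cstar_seminorm A (level n)"
  by (induction n) (simp_all add: base_seminorm cstar_seminorm_max)

lemma level_mono: "m \<le> n \<Longrightarrow> level m x \<le> level n x"
  by (rule lift_Suc_mono_le[of "\<lambda>n. level n x"]) auto

lemma base_le_level: "base_seminorm n x \<le> level n x"
  by (cases n) simp_all

sublocale seminorms: graded_seminorms A "range base_seminorm" level
proof
  fix r x y assume r: "r \<in> range base_seminorm" and "x \<in> carrier A" "y \<in> carrier A"
  then show "r (x \<oplus> y) \<le> r x + r y" using cs_add base_seminorm(1) by blast
next
  fix r assume r: "r \<in> range base_seminorm"
  then show "r \<zero> = 0" using cs_zero base_seminorm(1) by blast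
  obtain n where "r = base_seminorm n" using r by blast
  then show "\<exists>n. \<exists>C>0. \<forall>y\<in>carrier A. r y \<le> C * level n y"
    using base_le_level by (intro exI[of _ n] exI[of _ 1]) simp
next
  fix x and e :: real and n assume x: "x \<in> carrier A" "0 < e"
  have ball: "openin (seminorm_topology A (range base_seminorm)) {y \<in> carrier A. base_seminorm i (y \<ominus> x) < e}" for i
    unfolding seminorm_topology_def by (rule topology_generated_by_Basis) (use x in blast)
  show "openin (seminorm_topology A (range base_seminorm)) {y \<in> carrier A. level n (y \<ominus> x) < e}"
  proof (induction n)
    case (Suc n)
    have "{y \<in> carrier A. level (Suc n) (y \<ominus> x) < e}
        = {y \<in> carrier A. level n (y \<ominus> x) < e} \<inter> {y \<in> carrier A. base_seminorm (Suc n) (y \<ominus> x) < e}"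
      by auto
    then show ?case using openin_Int[OF Suc ball[of "Suc n"]] by simp
  qed (use ball[of 0] in simp)
qed (auto simp: level_mono cs_nonneg[OF level_cstar] cs_zero[OF level_cstar])

lemma tpl_eq: "tpl A = seminorms.T"
  by (rule base_seminorm(2))

lemma level_continuous: "continuous_cstar_seminorm A (level n)"
  unfolding continuous_cstar_seminorm_def
proof (intro conjI level_cstar)
  show "continuous_map (tpl A) euclideanreal (level n)"
    unfolding continuous_map_def
  proof (intro conjI allI impI)
    fix V assume V: "openin euclideanreal V"
    show "openin (tpl A) {x \<in> topspace (tpl A). level n x \<in> V}"
    proof (subst openin_subopen, intro ballI)
      fix x assume x: "x \<in> {x \<in> topspace (tpl A). level n x \<in> V}"
      then have xA: "x \<in> carrier A" by (simp add: topspace_carrier)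
      obtain e where e: "e > 0" "ball (level n x) e \<subseteq> V"
        using V x by (auto simp: open_contains_ball)
      have "{y \<in> carrier A. level n (y \<ominus> x) < e} \<subseteq> {x \<in> topspace (tpl A). level n x \<in> V}"
        using e(2) cs_diff_le[OF level_cstar, of _ x n] xA
        by (force simp: topspace_carrier dist_real_def subset_iff abs_minus_commute)
      moreover have "x \<in> {y \<in> carrier A. level n (y \<ominus> x) < e}"
        using xA e by (simp add: seminorms.minus_self seminorms.s_zero)
      ultimately show "\<exists>T. openin (tpl A) T \<and> x \<in> T \<and> T \<subseteq> {x \<in> topspace (tpl A). level n x \<in> V}"
        using seminorms.s_open[OF xA e(1), of n] unfolding tpl_eq by blast
    qed
  qed simp
qed

lemma ccs_cstar: "continuous_cstar_seminorm A q \<Longrightarrow> cstar_seminorm A q"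
  by (simp add: continuous_cstar_seminorm_def)

text \<open>Continuity at zero gives a \<open>level n\<close>-ball on which \<open>q < 1\<close>,
  and homogeneity spreads the bound over the carrier. Where \<open>level n\<close> vanishes, all
  multiples of \<open>x\<close> lie in the ball, so \<open>q\<close> vanishes too.\<close>

lemma ccs_dominated:
  assumes "continuous_cstar_seminorm A q"
  shows "\<exists>n. \<exists>C>0. \<forall>x\<in>carrier A. q x \<le> C * level n x"
proof -
  have q: "cstar_seminorm A q" by (rule ccs_cstar[OF assms])
  have "openin (tpl A) {x \<in> topspace (tpl A). q x \<in> {..<1}}"
    by (rule openin_continuous_map_preimage[where Y = euclideanreal])
      (use assms in \<open>auto simp: continuous_cstar_seminorm_def\<close>)
  then obtain n e where e: "e > 0"
    "\<And>y. y \<in> carrier A \<Longrightarrow> level n (y \<ominus> \<zero>) < e \<Longrightarrow> y \<in> {x \<in> topspace (tpl A). q x \<in> {..<1}}"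
    using seminorms.open_contains_ball[of "{x \<in> topspace (tpl A). q x \<in> {..<1}}" \<zero>] cs_zero[OF q]
    unfolding tpl_eq seminorms.topspace_T by auto
  have small: "c * q x < 1" if x: "x \<in> carrier A" "c > 0" "c * level n x < e" for c x
    using e(2)[of "cscale A (of_real c) x"] x
    by (simp add: cscale_closed cs_minus_zero[OF level_cstar] cs_cscale[OF level_cstar] cs_cscale[OF q])
  have "q x \<le> (2 / e) * level n x" if x: "x \<in> carrier A" for x
  proof (cases "level n x = 0")
    case True
    have "q x \<le> 0"
    proof (rule ccontr)
      assume "\<not> q x \<le> 0"
      then have qx: "q x > 0" by simp
      then have "(1 / q x) * q x < 1" by (intro small x) (use True e in auto)
      then show False using qx by simp
    qed
    then show ?thesis using True by simp
  next
    case False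
    then have l: "level n x > 0" using cs_nonneg[OF level_cstar x, of n] by simp
    have "(e / (2 * level n x)) * q x < 1" by (intro small x) (use l e in auto)
    then show ?thesis using l e by (simp add: field_simps)
  qed
  then show ?thesis using e by (intro exI[of _ n] exI[of _ "2 / e"]) auto
qed

definition conv :: "(nat \<Rightarrow> 'a) \<Rightarrow> 'a \<Rightarrow> bool" where
  "conv s l \<longleftrightarrow> s \<in> seqs \<and> l \<in> carrier A \<and> (\<forall>n. (\<lambda>i. level n (s i \<ominus> l)) \<longlonglongrightarrow> 0)"

lemma conv_iff_limitin: "s \<in> seqs \<Longrightarrow> conv s l \<longleftrightarrow> limitin (tpl A) s l sequentially"
  unfolding tpl_eq conv_def by (subst seminorms.limitin_iff) auto

lemma separation:
  assumes "x \<in> carrier A" "y \<in> carrier A" "\<And>n. level n (x \<ominus> y) = 0"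
  shows "x = y"
proof (rule ccontr)
  assume "x \<noteq> y"
  then have "\<exists>U V. openin (tpl A) U \<and> openin (tpl A) V \<and> x \<in> U \<and> y \<in> V \<and> disjnt U V"
    using Hausdorff assms(1,2) unfolding Hausdorff_space_def topspace_carrier by blast
  then obtain U V where U: "openin (tpl A) U" "openin (tpl A) V" "x \<in> U" "y \<in> V" "disjnt U V"
    by blast
  then obtain n e where "e > 0" "\<And>z. z \<in> carrier A \<Longrightarrow> level n (z \<ominus> y) < e \<Longrightarrow> z \<in> V"
    using seminorms.open_contains_ball[of V y] unfolding tpl_eq by blast
  then have "x \<in> V" using assms by simp
  then show False using U by (auto simp: disjnt_def)
qed

lemma conv_unique: "\<lbrakk>conv s l; conv s m\<rbrakk> \<Longrightarrow> l = m"
proof (rule separation)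
  assume a: "conv s l" "conv s m"
  then show lm: "l \<in> carrier A" "m \<in> carrier A" by (auto simp: conv_def)
  fix n
  have s: "s i \<in> carrier A" for i using a by (simp add: conv_def)
  have "level n (l \<ominus> m) \<le> level n (s i \<ominus> l) + level n (s i \<ominus> m)" for i
    using cs_triangle[OF level_cstar lm(1) s[of i] lm(2), of n] cs_commute[OF level_cstar lm(1) s[of i], of n] by simp
  moreover have "(\<lambda>i. level n (s i \<ominus> l) + level n (s i \<ominus> m)) \<longlonglongrightarrow> 0 + 0"
    using a by (intro tendsto_add) (auto simp: conv_def)
  ultimately have "level n (l \<ominus> m) \<le> 0 + 0" by (intro LIMSEQ_le_const) auto
  then show "level n (l \<ominus> m) = 0" using cs_nonneg[OF level_cstar, of "l \<ominus> m" n] lm by simp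
qed

lemma conv_sandwich:
  assumes "t \<in> seqs" "m \<in> carrier A" "conv s l"
    and "\<And>n i. level n (t i \<ominus> m) \<le> C n * level n (s i \<ominus> l)"
  shows "conv t m"
  unfolding conv_def
proof (intro conjI allI assms)
  fix n
  have "(\<lambda>i. C n * level n (s i \<ominus> l)) \<longlonglongrightarrow> 0"
    using assms(3) by (intro tendsto_mult_right_zero) (simp add: conv_def)
  then show "(\<lambda>i. level n (t i \<ominus> m)) \<longlonglongrightarrow> 0"
    by (rule tendsto_zero_dominated[OF _ _ assms(4)]) (use assms(1,2) in \<open>simp add: cs_nonneg[OF level_cstar]\<close>)
qed

lemma conv_star: "conv s l \<Longrightarrow> conv (\<lambda>i. star A (s i)) (star A l)"
  by (rule conv_sandwich[where C = "\<lambda>_. 1", of _ _ s l])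
    (auto simp: conv_def star_closed star_diff[symmetric] cs_star[OF level_cstar])

lemma conv_mult_right: "\<lbrakk>conv s l; a \<in> carrier A\<rbrakk> \<Longrightarrow> conv (\<lambda>i. s i \<otimes> a) (l \<otimes> a)"
proof (rule conv_sandwich[where C = "\<lambda>n. level n a", of _ _ s l])
  fix n i assume a: "conv s l" "a \<in> carrier A"
  then have "s i \<otimes> a \<ominus> l \<otimes> a = (s i \<ominus> l) \<otimes> a" by (simp add: conv_def a_minus_def l_distr l_minus)
  then show "level n (s i \<otimes> a \<ominus> l \<otimes> a) \<le> level n a * level n (s i \<ominus> l)"
    using cs_mult[OF level_cstar, of "s i \<ominus> l" a n] a by (simp add: conv_def mult.commute)
qed (auto simp: conv_def)

lemma conv_add:
  assumes "conv s l" "conv t m"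
  shows "conv (\<lambda>i. s i \<oplus> t i) (l \<oplus> m)"
  unfolding conv_def
proof (intro conjI allI)
  have c: "s i \<in> carrier A" "t i \<in> carrier A" "l \<in> carrier A" "m \<in> carrier A" for i
    using assms by (auto simp: conv_def)
  then show "(\<lambda>i. s i \<oplus> t i) \<in> seqs" "l \<oplus> m \<in> carrier A" by auto
  fix n
  have "level n ((s i \<oplus> t i) \<ominus> (l \<oplus> m)) \<le> level n (s i \<ominus> l) + level n (t i \<ominus> m)" for i
  proof -
    have "(s i \<oplus> t i) \<ominus> (l \<oplus> m) = (s i \<ominus> l) \<oplus> (t i \<ominus> m)"
      using c by (simp add: a_minus_def minus_add a_ac)
    then show ?thesis using cs_add[OF level_cstar, of "s i \<ominus> l" "t i \<ominus> m" n] c by simp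
  qed
  moreover have "(\<lambda>i. level n (s i \<ominus> l) + level n (t i \<ominus> m)) \<longlonglongrightarrow> 0 + 0"
    using assms by (intro tendsto_add) (auto simp: conv_def)
  ultimately show "(\<lambda>i. level n ((s i \<oplus> t i) \<ominus> (l \<oplus> m))) \<longlonglongrightarrow> 0"
    by (intro tendsto_zero_dominated[where g = "\<lambda>i. level n (s i \<ominus> l) + level n (t i \<ominus> m)"
          and f = "\<lambda>i. level n ((s i \<oplus> t i) \<ominus> (l \<oplus> m))"])
      (use c in \<open>simp_all add: cs_nonneg[OF level_cstar]\<close>)
qed

lemma conv_ccs:
  assumes "conv s l" "continuous_cstar_seminorm A q"
  shows "(\<lambda>i. q (s i \<ominus> l)) \<longlonglongrightarrow> 0" "(\<lambda>i. q (s i)) \<longlonglongrightarrow> q l"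
proof -
  have q: "cstar_seminorm A q" by (rule ccs_cstar[OF assms(2)])
  have c: "s i \<in> carrier A" "l \<in> carrier A" for i using assms by (auto simp: conv_def)
  obtain n C where C: "C > 0" "\<And>x. x \<in> carrier A \<Longrightarrow> q x \<le> C * level n x"
    using ccs_dominated[OF assms(2)] by blast
  have "(\<lambda>i. C * level n (s i \<ominus> l)) \<longlonglongrightarrow> 0"
    using assms(1) by (intro tendsto_mult_right_zero) (simp add: conv_def)
  then show 1: "(\<lambda>i. q (s i \<ominus> l)) \<longlonglongrightarrow> 0"
    by (rule tendsto_zero_dominated) (intro C(2) cs_nonneg[OF q] minus_closed c)+
  have "(\<lambda>i. \<bar>q (s i) - q l\<bar>) \<longlonglongrightarrow> 0"
    by (rule tendsto_zero_dominated[OF 1]) (use c in \<open>simp_all add: cs_diff_le[OF q]\<close>)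
  then show "(\<lambda>i. q (s i)) \<longlonglongrightarrow> q l"
    by (rule LIM_zero_cancel[OF tendsto_rabs_zero_cancel])
qed

text \<open>Completeness is formulated with Cauchy filters; the image of the sequential filter under
  \<open>s\<close> is one.\<close>

lemma conv_exists:
  assumes s: "s \<in> seqs" and c: "\<And>n e. e > 0 \<Longrightarrow> \<exists>N. \<forall>i\<ge>N. \<forall>j\<ge>N. level n (s i \<ominus> s j) < e"
  shows "\<exists>l. conv s l"
proof -
  have "cauchy_filter A (filtermap s sequentially)"
    unfolding cauchy_filter_def
  proof (intro conjI allI impI)
    show "filtermap s sequentially \<noteq> bot" by (simp add: filtermap_bot_iff)
    show "filtermap s sequentially \<le> principal (carrier A)"
      using s by (simp add: le_principal eventually_filtermap)
    fix U assume "openin (tpl A) U \<and> \<zero> \<in> U"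
    then obtain n e where e: "e > 0" and U: "\<And>y. y \<in> carrier A \<Longrightarrow> level n (y \<ominus> \<zero>) < e \<Longrightarrow> y \<in> U"
      using seminorms.open_contains_ball[of U \<zero>] unfolding tpl_eq by blast
    obtain N where N: "\<And>i j. i \<ge> N \<Longrightarrow> j \<ge> N \<Longrightarrow> level n (s i \<ominus> s j) < e" using c[OF e] by blast
    show "\<exists>S. (\<forall>\<^sub>F x in filtermap s sequentially. x \<in> S) \<and> (\<forall>x\<in>S. \<forall>y\<in>S. x \<ominus> y \<in> U)"
    proof (intro exI[of _ "s ` {N..}"] conjI)
      show "\<forall>\<^sub>F x in filtermap s sequentially. x \<in> s ` {N..}"
        unfolding eventually_filtermap eventually_sequentially by blast
      show "\<forall>x\<in>s ` {N..}. \<forall>y\<in>s ` {N..}. x \<ominus> y \<in> U"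
        using s N by (auto intro!: U simp: cs_minus_zero[OF level_cstar])
    qed
  qed
  then obtain l where "limitin (tpl A) (\<lambda>x. x) l (filtermap s sequentially)" using complete by blast
  then have "limitin (tpl A) s l sequentially" by (simp add: limitin_def eventually_filtermap)
  then show ?thesis using conv_iff_limitin[OF s] by blast
qed

end

section \<open>Inner product, seminorms and completeness of the Hilbert module\<close>

section \<open>The standard Hilbert module\<close>

context sigma_cstar_algebra
begin

abbreviation ccs :: "('a \<Rightarrow> real) \<Rightarrow> bool" where
  "ccs \<equiv> continuous_cstar_seminorm A"

abbreviation inner :: "(nat \<Rightarrow> 'a) \<Rightarrow> (nat \<Rightarrow> 'a) \<Rightarrow> 'a" where
  "inner \<equiv> l2_inner A"

abbreviation nrm :: "('a \<Rightarrow> real) \<Rightarrow> (nat \<Rightarrow> 'a) \<Rightarrow> real" where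
  "nrm \<equiv> l2_seminorm A"

definition l2_sub :: "(nat \<Rightarrow> 'a) \<Rightarrow> (nat \<Rightarrow> 'a) \<Rightarrow> nat \<Rightarrow> 'a" where
  "l2_sub \<xi> \<eta> = l2_add A \<xi> (l2_cscale A (-1) \<eta>)"

lemma l2_sub_apply: "\<eta> \<in> seqs \<Longrightarrow> l2_sub \<xi> \<eta> k = \<xi> k \<ominus> \<eta> k"
  by (simp add: l2_sub_def l2_add_def l2_cscale_def cscale_minus a_minus_def)

lemma seqs_closed [simp]:
  "\<lbrakk>\<xi> \<in> seqs; \<eta> \<in> seqs\<rbrakk> \<Longrightarrow> l2_add A \<xi> \<eta> \<in> seqs"
  "\<lbrakk>\<xi> \<in> seqs; a \<in> carrier A\<rbrakk> \<Longrightarrow> l2_act A \<xi> a \<in> seqs"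
  "\<xi> \<in> seqs \<Longrightarrow> l2_cscale A c \<xi> \<in> seqs"
  "l2_zero A \<in> seqs"
  by (simp_all add: l2_add_def l2_act_def l2_cscale_def l2_zero_def cscale_closed)

lemma cscale_as_act: "\<xi> \<in> seqs \<Longrightarrow> l2_cscale A c \<xi> = l2_act A \<xi> (cscale A c \<one>)"
  by (rule ext) (simp add: l2_cscale_def l2_act_def cscale_mult_right)

lemma gram_norm_empty [simp]: "gram_norm (level n) {} \<xi> = 0"
  by (simp add: gram_norm_def gram_def cs_zero[OF level_cstar])

text \<open>The Cauchy criterion for the series of
  \<open>star A (\<xi> k) \<otimes> \<xi> k\<close>. Since its terms are positive, enlarging the
  index set enlarges the seminorm, so it is enough to control the intervals starting at one fixed
  \<open>M\<close>; for \<open>N \<le> M\<close> the interval is empty.\<close>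

lemma l2_iff:
  "\<xi> \<in> l2 A \<longleftrightarrow> \<xi> \<in> seqs \<and> (\<forall>n. \<forall>e>0. \<exists>M. \<forall>N. gram_norm (level n) {M..<N} \<xi> < e)"
proof -
  have main: "(\<exists>s. conv (\<lambda>N. gram {..<N} \<xi> \<xi>) s) \<longleftrightarrow> (\<forall>n. \<forall>e>0. \<exists>M. \<forall>N. gram_norm (level n) {M..<N} \<xi> < e)"
    if x: "\<xi> \<in> seqs"
  proof
    assume "\<exists>s. conv (\<lambda>N. gram {..<N} \<xi> \<xi>) s"
    then obtain s where s: "conv (\<lambda>N. gram {..<N} \<xi> \<xi>) s" by blast
    show "\<forall>n. \<forall>e>0. \<exists>M. \<forall>N. gram_norm (level n) {M..<N} \<xi> < e"
    proof (intro allI impI)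
      fix n and e :: real assume e: "e > 0"
      have "(\<lambda>N. level n (gram {..<N} \<xi> \<xi> \<ominus> s)) \<longlonglongrightarrow> 0" using s by (simp add: conv_def)
      then have "\<forall>\<^sub>F N in sequentially. level n (gram {..<N} \<xi> \<xi> \<ominus> s) < e\<^sup>2 / 2"
        using e by (intro order_tendstoD) auto
      then obtain M where M: "\<And>N. N \<ge> M \<Longrightarrow> level n (gram {..<N} \<xi> \<xi> \<ominus> s) < e\<^sup>2 / 2"
        unfolding eventually_sequentially by blast
      have sA: "s \<in> carrier A" using s by (simp add: conv_def)
      have "gram_norm (level n) {M..<N} \<xi> < e" for N
      proof (cases "M \<le> N")
        case True
        have "level n (gram {M..<N} \<xi> \<xi>) \<le> level n (gram {..<N} \<xi> \<xi> \<ominus> s) + level n (s \<ominus> gram {..<M} \<xi> \<xi>)"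
          unfolding gram_diff[OF x x True, symmetric]
          by (rule cs_triangle[OF level_cstar]) (use x sA in simp_all)
        also have "level n (s \<ominus> gram {..<M} \<xi> \<xi>) = level n (gram {..<M} \<xi> \<xi> \<ominus> s)"
          by (rule cs_commute[OF level_cstar]) (use x sA in simp_all)
        finally have "level n (gram {M..<N} \<xi> \<xi>) < e\<^sup>2" using M[of N] M[of M] True by simp
        then show ?thesis unfolding gram_norm_def using e by (simp add: real_less_lsqrt)
      next
        case False
        then show ?thesis using e by simp
      qed
      then show "\<exists>M. \<forall>N. gram_norm (level n) {M..<N} \<xi> < e" by blast
    qed
  next
    assume R: "\<forall>n. \<forall>e>0. \<exists>M. \<forall>N. gram_norm (level n) {M..<N} \<xi> < e"
    show "\<exists>s. conv (\<lambda>N. gram {..<N} \<xi> \<xi>) s"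
    proof (rule conv_exists)
      show "(\<lambda>N. gram {..<N} \<xi> \<xi>) \<in> seqs" using x by simp
      fix n and e :: real assume e: "e > 0"
      obtain M where M: "\<And>N. gram_norm (level n) {M..<N} \<xi> < sqrt e" using R e real_sqrt_gt_zero by meson
      have le: "level n (gram {..<j} \<xi> \<xi> \<ominus> gram {..<i} \<xi> \<xi>) < e" if "M \<le> i" "i \<le> j" for i j
      proof -
        have "gram_norm (level n) {i..<j} \<xi> \<le> gram_norm (level n) {M..<j} \<xi>"
          by (rule gram_norm_mono[OF level_cstar x]) (use that in auto)
        then have "sqrt (level n (gram {i..<j} \<xi> \<xi>)) < sqrt e"
          using M[of j] by (simp add: gram_norm_def)
        then show ?thesis unfolding gram_diff[OF x x that(2)] by simp
      qed
      show "\<exists>N. \<forall>i\<ge>N. \<forall>j\<ge>N. level n (gram {..<i} \<xi> \<xi> \<ominus> gram {..<j} \<xi> \<xi>) < e"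
      proof (intro exI[of _ M] allI impI)
        fix i j assume "M \<le> i" "M \<le> j"
        then show "level n (gram {..<i} \<xi> \<xi> \<ominus> gram {..<j} \<xi> \<xi>) < e"
          using le[of i j] le[of j i] cs_commute[OF level_cstar, of "gram {..<i} \<xi> \<xi>" "gram {..<j} \<xi> \<xi>" n] x
          by (cases "i \<le> j") simp_all
      qed
    qed
  qed
  have l2: "\<xi> \<in> l2 A \<longleftrightarrow> \<xi> \<in> seqs \<and> (\<exists>s. conv (\<lambda>N. gram {..<N} \<xi> \<xi>) s)"
  proof -
    have lim: "limitin (tpl A) (\<lambda>n. \<Oplus>k\<in>{..<n}. star A (\<xi> k) \<otimes> \<xi> k) s sequentially
        \<longleftrightarrow> conv (\<lambda>N. gram {..<N} \<xi> \<xi>) s" if x: "\<forall>k. \<xi> k \<in> carrier A" for s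
      using conv_iff_limitin[of "\<lambda>N. gram {..<N} \<xi> \<xi>" s] gram_closed[of \<xi> \<xi>] x by (simp add: gram_def)
    show ?thesis
      unfolding l2_def mem_Collect_eq by (intro conj_cong refl ex_cong1 lim)
  qed
  show ?thesis unfolding l2 by (rule conj_cong[OF refl]) (rule main)
qed

lemma l2_seqs: "\<xi> \<in> l2 A \<Longrightarrow> \<xi> \<in> seqs"
  unfolding l2_iff by (rule conjunct1)

lemma l2_coord [simp]: "\<xi> \<in> l2 A \<Longrightarrow> \<xi> k \<in> carrier A"
  using l2_seqs by simp

lemma l2_tail:
  assumes "\<xi> \<in> l2 A" "e > 0"
  shows "\<exists>M. \<forall>N. gram_norm (level n) {M..<N} \<xi> < e"
  using assms(1)[unfolded l2_iff, THEN conjunct2, rule_format, OF assms(2)] .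

lemma l2I:
  assumes "\<xi> \<in> seqs" "\<And>n e. e > 0 \<Longrightarrow> \<exists>M. \<forall>N. gram_norm (level n) {M..<N} \<xi> < e"
  shows "\<xi> \<in> l2 A"
  unfolding l2_iff by (intro conjI allI impI assms)

lemma l2_zero_closed [simp]: "l2_zero A \<in> l2 A"
proof (rule l2I)
  fix n and e :: real assume "e > 0"
  moreover have "gram F (l2_zero A) (l2_zero A) = \<zero>" for F
    by (simp add: gram_def l2_zero_def)
  ultimately show "\<exists>M. \<forall>N. gram_norm (level n) {M..<N} (l2_zero A) < e"
    by (simp add: gram_norm_def cs_zero[OF level_cstar])
qed (rule seqs_closed)

lemma l2_add_closed [simp]:
  assumes "\<xi> \<in> l2 A" "\<eta> \<in> l2 A"
  shows "l2_add A \<xi> \<eta> \<in> l2 A"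
proof (rule l2I)
  note x = l2_seqs[OF assms(1)] and y = l2_seqs[OF assms(2)]
  show "l2_add A \<xi> \<eta> \<in> seqs" by (rule seqs_closed(1)[OF x y])
  fix n and e :: real assume e: "e > 0"
  then have e2: "e / 2 > 0" by simp
  obtain M1 where M1: "\<And>N. gram_norm (level n) {M1..<N} \<xi> < e / 2" using l2_tail[OF assms(1) e2] by meson
  obtain M2 where M2: "\<And>N. gram_norm (level n) {M2..<N} \<eta> < e / 2" using l2_tail[OF assms(2) e2] by meson
  have "gram_norm (level n) {max M1 M2..<N} (l2_add A \<xi> \<eta>) < e" for N
  proof -
    have "gram_norm (level n) {max M1 M2..<N} (l2_add A \<xi> \<eta>)
        \<le> gram_norm (level n) {max M1 M2..<N} \<xi> + gram_norm (level n) {max M1 M2..<N} \<eta>"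
      by (rule gram_norm_triangle[OF level_cstar x y]) simp
    also have "\<dots> \<le> gram_norm (level n) {M1..<N} \<xi> + gram_norm (level n) {M2..<N} \<eta>"
      by (intro add_mono gram_norm_mono[OF level_cstar] x y) auto
    finally show ?thesis using M1[of N] M2[of N] by linarith
  qed
  then show "\<exists>M. \<forall>N. gram_norm (level n) {M..<N} (l2_add A \<xi> \<eta>) < e" by blast
qed

lemma l2_act_closed [simp]:
  assumes "\<xi> \<in> l2 A" "a \<in> carrier A"
  shows "l2_act A \<xi> a \<in> l2 A"
proof (rule l2I)
  note x = l2_seqs[OF assms(1)]
  show "l2_act A \<xi> a \<in> seqs" by (rule seqs_closed(2)[OF x assms(2)])
  fix n and e :: real assume e: "e > 0"
  define r where "r = level n a + 1"
  have r: "r > 0" "level n a \<le> r" using cs_nonneg[OF level_cstar assms(2), of n] by (auto simp: r_def)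
  then have "e / r > 0" using e by simp
  from l2_tail[OF assms(1) this] obtain M where M: "\<And>N. gram_norm (level n) {M..<N} \<xi> < e / r" by meson
  have "gram_norm (level n) {M..<N} (l2_act A \<xi> a) < e" for N
  proof -
    have "gram_norm (level n) {M..<N} (l2_act A \<xi> a) \<le> gram_norm (level n) {M..<N} \<xi> * r"
      using gram_norm_act[OF level_cstar x assms(2), of n "{M..<N}"]
        mult_left_mono[OF r(2) gram_norm_nonneg[OF level_cstar x, of n "{M..<N}"]] by linarith
    also have "\<dots> < (e / r) * r" using M[of N] r(1) by (rule mult_strict_right_mono)
    finally show ?thesis using r by simp
  qed
  then show "\<exists>M. \<forall>N. gram_norm (level n) {M..<N} (l2_act A \<xi> a) < e" by blast
qed

lemma l2_cscale_closed [simp]: "\<xi> \<in> l2 A \<Longrightarrow> l2_cscale A c \<xi> \<in> l2 A"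
  using cscale_as_act[OF l2_seqs] by (simp add: cscale_closed)

lemma l2_sub_closed [simp]: "\<lbrakk>\<xi> \<in> l2 A; \<eta> \<in> l2 A\<rbrakk> \<Longrightarrow> l2_sub \<xi> \<eta> \<in> l2 A"
  by (simp add: l2_sub_def)

text \<open>Cauchy-Schwarz on \<open>{i..<j}\<close> bounds the mixed tail by the product of the
  tails of \<open>\<xi>\<close> and \<open>\<eta>\<close>; one is made small, the other kept below
  1. With uniqueness of limits this gives the \<open>THE\<close> in \<open>l2_inner\<close> its
  value.\<close>

lemma conv_inner:
  assumes "\<xi> \<in> l2 A" "\<eta> \<in> l2 A"
  shows "conv (\<lambda>N. gram {..<N} \<xi> \<eta>) (inner \<xi> \<eta>)"
proof -
  note x = l2_seqs[OF assms(1)] and y = l2_seqs[OF assms(2)]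
  have "\<exists>s. conv (\<lambda>N. gram {..<N} \<xi> \<eta>) s"
  proof (rule conv_exists)
    show "(\<lambda>N. gram {..<N} \<xi> \<eta>) \<in> seqs" using x y by simp
    fix n and e :: real assume e: "e > 0"
    obtain M1 where M1: "\<And>N. gram_norm (level n) {M1..<N} \<xi> < e" using l2_tail[OF assms(1) e] by meson
    obtain M2 where M2: "\<And>N. gram_norm (level n) {M2..<N} \<eta> < 1" using l2_tail[OF assms(2), of 1] by (meson zero_less_one)
    have le: "level n (gram {..<j} \<xi> \<eta> \<ominus> gram {..<i} \<xi> \<eta>) < e" if "max M1 M2 \<le> i" "i \<le> j" for i j
    proof -
      have "level n (gram {i..<j} \<xi> \<eta>) \<le> gram_norm (level n) {i..<j} \<xi> * gram_norm (level n) {i..<j} \<eta>"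
        by (rule gram_Cauchy_Schwarz[OF level_cstar x y]) simp
      also have "\<dots> \<le> gram_norm (level n) {M1..<j} \<xi> * gram_norm (level n) {M2..<j} \<eta>"
        by (intro mult_mono gram_norm_mono[OF level_cstar] gram_norm_nonneg[OF level_cstar] x y) (use that in auto)
      also have "\<dots> \<le> gram_norm (level n) {M1..<j} \<xi> * 1"
        by (intro mult_left_mono gram_norm_nonneg[OF level_cstar] x) (use M2[of j] in simp)
      finally show ?thesis unfolding gram_diff[OF x y that(2)] using M1[of j] by linarith
    qed
    show "\<exists>N. \<forall>i\<ge>N. \<forall>j\<ge>N. level n (gram {..<i} \<xi> \<eta> \<ominus> gram {..<j} \<xi> \<eta>) < e"
    proof (intro exI[of _ "max M1 M2"] allI impI)
      fix i j assume "max M1 M2 \<le> i" "max M1 M2 \<le> j"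
      then show "level n (gram {..<i} \<xi> \<eta> \<ominus> gram {..<j} \<xi> \<eta>) < e"
        using le[of i j] le[of j i] cs_commute[OF level_cstar, of "gram {..<i} \<xi> \<eta>" "gram {..<j} \<xi> \<eta>" n] x y
        by (cases "i \<le> j") simp_all
    qed
  qed
  then obtain s where s: "conv (\<lambda>N. gram {..<N} \<xi> \<eta>) s" by blast
  have lim: "limitin (tpl A) (\<lambda>n. \<Oplus>k\<in>{..<n}. star A (\<xi> k) \<otimes> \<eta> k) l sequentially \<longleftrightarrow> conv (\<lambda>N. gram {..<N} \<xi> \<eta>) l" for l
    using conv_iff_limitin[of "\<lambda>N. gram {..<N} \<xi> \<eta>" l] gram_closed[OF x y] by (simp add: gram_def)
  have "inner \<xi> \<eta> = s"
    unfolding l2_inner_def lim by (rule the_equality) (use s conv_unique in blast)+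
  then show ?thesis using s by simp
qed

lemma innerI: "\<lbrakk>\<xi> \<in> l2 A; \<eta> \<in> l2 A; conv (\<lambda>N. gram {..<N} \<xi> \<eta>) s\<rbrakk> \<Longrightarrow> inner \<xi> \<eta> = s"
  using conv_inner conv_unique by blast

lemma inner_closed [simp]: "\<lbrakk>\<xi> \<in> l2 A; \<eta> \<in> l2 A\<rbrakk> \<Longrightarrow> inner \<xi> \<eta> \<in> carrier A"
  using conv_inner by (auto simp: conv_def)

lemma inner_star: "\<lbrakk>\<xi> \<in> l2 A; \<eta> \<in> l2 A\<rbrakk> \<Longrightarrow> star A (inner \<xi> \<eta>) = inner \<eta> \<xi>"
  using conv_star[OF conv_inner[of \<xi> \<eta>]] by (intro innerI[symmetric]) (simp_all add: star_gram l2_seqs)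

lemma inner_add_right:
  "\<lbrakk>\<xi> \<in> l2 A; \<eta> \<in> l2 A; \<zeta> \<in> l2 A\<rbrakk> \<Longrightarrow> inner \<xi> (l2_add A \<eta> \<zeta>) = inner \<xi> \<eta> \<oplus> inner \<xi> \<zeta>"
  using conv_add[OF conv_inner[of \<xi> \<eta>] conv_inner[of \<xi> \<zeta>]]
  by (intro innerI) (simp_all add: gram_add_right[OF l2_seqs l2_seqs l2_seqs])

lemma inner_act_right:
  "\<lbrakk>\<xi> \<in> l2 A; \<eta> \<in> l2 A; a \<in> carrier A\<rbrakk> \<Longrightarrow> inner \<xi> (l2_act A \<eta> a) = inner \<xi> \<eta> \<otimes> a"
  using conv_mult_right[OF conv_inner[of \<xi> \<eta>], of a]
  by (intro innerI) (simp_all add: gram_act_right[OF l2_seqs l2_seqs])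

lemma inner_cscale_right:
  "\<lbrakk>\<xi> \<in> l2 A; \<eta> \<in> l2 A\<rbrakk> \<Longrightarrow> inner \<xi> (l2_cscale A c \<eta>) = cscale A c (inner \<xi> \<eta>)"
  by (simp add: cscale_as_act[OF l2_seqs] inner_act_right cscale_closed cscale_mult_right)

lemma inner_add_left:
  "\<lbrakk>\<xi> \<in> l2 A; \<eta> \<in> l2 A; \<zeta> \<in> l2 A\<rbrakk> \<Longrightarrow> inner (l2_add A \<xi> \<eta>) \<zeta> = inner \<xi> \<zeta> \<oplus> inner \<eta> \<zeta>"
  using inner_star[of \<zeta> "l2_add A \<xi> \<eta>"] by (simp add: inner_add_right star_add inner_star)

lemma inner_cscale_left:
  "\<lbrakk>\<xi> \<in> l2 A; \<eta> \<in> l2 A\<rbrakk> \<Longrightarrow> inner (l2_cscale A c \<xi>) \<eta> = cscale A (cnj c) (inner \<xi> \<eta>)"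
  using inner_star[of \<eta> "l2_cscale A c \<xi>"] by (simp add: inner_cscale_right star_cscale inner_star)

lemma inner_act_left:
  "\<lbrakk>\<xi> \<in> l2 A; \<eta> \<in> l2 A; a \<in> carrier A\<rbrakk> \<Longrightarrow> inner (l2_act A \<xi> a) \<eta> = star A a \<otimes> inner \<xi> \<eta>"
  using inner_star[of \<eta> "l2_act A \<xi> a"] by (simp add: inner_act_right star_mult inner_star)

lemma nrm_nonneg: "\<lbrakk>ccs q; \<xi> \<in> l2 A\<rbrakk> \<Longrightarrow> 0 \<le> nrm q \<xi>"
  by (simp add: l2_seminorm_def cs_nonneg[OF ccs_cstar])

lemma nrm_square: "\<lbrakk>ccs q; \<xi> \<in> l2 A\<rbrakk> \<Longrightarrow> (nrm q \<xi>)\<^sup>2 = q (inner \<xi> \<xi>)"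
  by (simp add: l2_seminorm_def cs_nonneg[OF ccs_cstar])

lemma nrm_tendsto:
  "\<lbrakk>ccs q; \<xi> \<in> l2 A\<rbrakk> \<Longrightarrow> (\<lambda>N. gram_norm q {..<N} \<xi>) \<longlonglongrightarrow> nrm q \<xi>"
  unfolding l2_seminorm_def gram_norm_def
  by (intro tendsto_real_sqrt conv_ccs(2) conv_inner)

lemma gram_norm_le_nrm:
  assumes "ccs q" "\<xi> \<in> l2 A" "finite F"
  shows "gram_norm q F \<xi> \<le> nrm q \<xi>"
proof (rule LIMSEQ_le_const[OF nrm_tendsto[OF assms(1,2)]])
  obtain M where M: "F \<subseteq> {..<M}" using finite_nat_iff_bounded assms(3) by blast
  show "\<exists>N. \<forall>n\<ge>N. gram_norm q F \<xi> \<le> gram_norm q {..<n} \<xi>"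
    by (intro exI[of _ M] allI impI gram_norm_mono[OF ccs_cstar[OF assms(1)] l2_seqs[OF assms(2)]])
      (use M in auto)
qed

lemma nrm_le:
  "\<lbrakk>ccs q; \<xi> \<in> l2 A; \<And>N. gram_norm q {..<N} \<xi> \<le> B\<rbrakk> \<Longrightarrow> nrm q \<xi> \<le> B"
  by (rule LIMSEQ_le_const2[OF nrm_tendsto]) auto

lemma inner_Cauchy_Schwarz:
  assumes "ccs q" "\<xi> \<in> l2 A" "\<eta> \<in> l2 A"
  shows "q (inner \<xi> \<eta>) \<le> nrm q \<xi> * nrm q \<eta>"
  by (rule LIMSEQ_le[OF conv_ccs(2)[OF conv_inner[OF assms(2,3)] assms(1)]
        tendsto_mult[OF nrm_tendsto[OF assms(1,2)] nrm_tendsto[OF assms(1,3)]]])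
    (use gram_Cauchy_Schwarz[OF ccs_cstar[OF assms(1)] l2_seqs[OF assms(2)] l2_seqs[OF assms(3)]] in auto)

lemma nrm_triangle:
  assumes "ccs q" "\<xi> \<in> l2 A" "\<eta> \<in> l2 A"
  shows "nrm q (l2_add A \<xi> \<eta>) \<le> nrm q \<xi> + nrm q \<eta>"
  by (rule LIMSEQ_le[OF nrm_tendsto[OF assms(1)]
        tendsto_add[OF nrm_tendsto[OF assms(1,2)] nrm_tendsto[OF assms(1,3)]]])
    (use assms gram_norm_triangle[OF ccs_cstar[OF assms(1)] l2_seqs[OF assms(2)] l2_seqs[OF assms(3)]] in auto)

lemma nrm_act:
  assumes "ccs q" "\<xi> \<in> l2 A" "a \<in> carrier A"
  shows "nrm q (l2_act A \<xi> a) \<le> nrm q \<xi> * q a"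
  by (rule LIMSEQ_le[OF nrm_tendsto[OF assms(1)]
        tendsto_mult[OF nrm_tendsto[OF assms(1,2)] tendsto_const]])
    (use assms gram_norm_act[OF ccs_cstar[OF assms(1)] l2_seqs[OF assms(2)] assms(3)] in auto)

lemma nrm_cscale:
  assumes "ccs q" "\<xi> \<in> l2 A"
  shows "nrm q (l2_cscale A c \<xi>) = cmod c * nrm q \<xi>"
proof -
  have "inner (l2_cscale A c \<xi>) (l2_cscale A c \<xi>) = cscale A (cnj c * c) (inner \<xi> \<xi>)"
    using assms by (simp add: inner_cscale_left inner_cscale_right cscale_cscale mult.commute)
  then have "q (inner (l2_cscale A c \<xi>) (l2_cscale A c \<xi>)) = (cmod c)\<^sup>2 * q (inner \<xi> \<xi>)"
    using assms by (simp add: cs_cscale[OF ccs_cstar] norm_mult power2_eq_square)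
  then show ?thesis by (simp add: l2_seminorm_def real_sqrt_mult)
qed

lemma nrm_zero: "ccs q \<Longrightarrow> nrm q (l2_zero A) = 0"
proof -
  assume q: "ccs q"
  have "l2_cscale A 0 (l2_zero A) = l2_zero A" by (rule ext) (simp add: l2_cscale_def l2_zero_def)
  then show ?thesis using nrm_cscale[OF q, of "l2_zero A" 0] by simp
qed

lemma nrm_coord: "\<lbrakk>ccs q; \<xi> \<in> l2 A\<rbrakk> \<Longrightarrow> q (\<xi> k) \<le> nrm q \<xi>"
  using gram_norm_coord[OF ccs_cstar l2_seqs, of q \<xi> k "{k}"] gram_norm_le_nrm[of q \<xi> "{k}"] by simp

lemma nrm_sub_triangle:
  assumes "ccs q" "\<xi> \<in> l2 A" "\<eta> \<in> l2 A" "\<zeta> \<in> l2 A"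
  shows "nrm q (l2_sub \<xi> \<zeta>) \<le> nrm q (l2_sub \<xi> \<eta>) + nrm q (l2_sub \<eta> \<zeta>)"
proof -
  have "l2_sub \<xi> \<zeta> = l2_add A (l2_sub \<xi> \<eta>) (l2_sub \<eta> \<zeta>)"
  proof
    fix k
    show "l2_sub \<xi> \<zeta> k = l2_add A (l2_sub \<xi> \<eta>) (l2_sub \<eta> \<zeta>) k"
      using assms by (simp add: l2_sub_apply l2_seqs l2_add_def seminorms.minus_trans[of "\<xi> k" "\<eta> k" "\<zeta> k"])
  qed
  then show ?thesis using nrm_triangle[OF assms(1), of "l2_sub \<xi> \<eta>" "l2_sub \<eta> \<zeta>"] assms by simp
qed

lemma nrm_sub_commute:
  assumes "ccs q" "\<xi> \<in> l2 A" "\<eta> \<in> l2 A"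
  shows "nrm q (l2_sub \<xi> \<eta>) = nrm q (l2_sub \<eta> \<xi>)"
proof -
  have "l2_sub \<xi> \<eta> = l2_cscale A (-1) (l2_sub \<eta> \<xi>)"
  proof
    fix k
    show "l2_sub \<xi> \<eta> k = l2_cscale A (-1) (l2_sub \<eta> \<xi>) k"
      using assms by (simp add: l2_sub_apply l2_seqs l2_cscale_def cscale_minus)
        (simp add: a_minus_def minus_add a_comm)
  qed
  then show ?thesis using nrm_cscale[OF assms(1), of "l2_sub \<eta> \<xi>" "-1"] assms by simp
qed

lemma l2_eqI:
  assumes "\<xi> \<in> l2 A" "\<eta> \<in> l2 A" "\<And>n. nrm (level n) (l2_sub \<xi> \<eta>) = 0"
  shows "\<xi> = \<eta>"
proof
  fix k
  show "\<xi> k = \<eta> k"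
  proof (rule separation)
    fix n
    have "level n (\<xi> k \<ominus> \<eta> k) \<le> 0"
      using nrm_coord[OF level_continuous, of "l2_sub \<xi> \<eta>" n k] assms by (simp add: l2_sub_apply l2_seqs)
    then show "level n (\<xi> k \<ominus> \<eta> k) = 0"
      using cs_nonneg[OF level_cstar, of "\<xi> k \<ominus> \<eta> k" n] assms by simp
  qed (use assms in simp_all)
qed

lemma inner_sub_right:
  "\<lbrakk>\<xi> \<in> l2 A; \<eta> \<in> l2 A; \<zeta> \<in> l2 A\<rbrakk> \<Longrightarrow> inner \<xi> (l2_sub \<eta> \<zeta>) = inner \<xi> \<eta> \<ominus> inner \<xi> \<zeta>"
  by (simp add: l2_sub_def inner_add_right inner_cscale_right cscale_minus a_minus_def)

lemma inner_sub_left: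
  "\<lbrakk>\<xi> \<in> l2 A; \<eta> \<in> l2 A; \<zeta> \<in> l2 A\<rbrakk> \<Longrightarrow> inner (l2_sub \<xi> \<eta>) \<zeta> = inner \<xi> \<zeta> \<ominus> inner \<eta> \<zeta>"
  by (simp add: l2_sub_def inner_add_left inner_cscale_left cscale_minus a_minus_def)

lemma inner_nondegenerate:
  assumes "\<xi> \<in> l2 A" "\<eta> \<in> l2 A" "\<And>\<zeta>. \<zeta> \<in> l2 A \<Longrightarrow> inner \<zeta> \<xi> = inner \<zeta> \<eta>"
  shows "\<xi> = \<eta>"
proof (rule l2_eqI[OF assms(1,2)])
  fix n
  have "inner (l2_sub \<xi> \<eta>) (l2_sub \<xi> \<eta>) = \<zero>"
    using assms by (simp add: inner_sub_right seminorms.minus_self)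
  then show "nrm (level n) (l2_sub \<xi> \<eta>) = 0"
    by (simp add: l2_seminorm_def cs_zero[OF level_cstar])
qed

lemma nrm_dominated:
  assumes "ccs q" "\<And>x. x \<in> carrier A \<Longrightarrow> q x \<le> C * r x" "ccs r" "C > 0" "\<xi> \<in> l2 A"
  shows "nrm q \<xi> \<le> sqrt C * nrm r \<xi>"
  using assms(2)[of "inner \<xi> \<xi>"] assms(5)
  by (simp add: l2_seminorm_def real_sqrt_mult[symmetric])

text \<open>The limit is formed in each coordinate. The Cauchy bounds are compared on finite sets of
  coordinates, where coordinatewise convergence suffices, with constants independent of the set;
  this uniformity gives both membership in \<open>l2 A\<close> and convergence.\<close>

lemma l2_complete:
  assumes X: "\<And>j. X j \<in> l2 A"
    and c: "\<And>n e. e > 0 \<Longrightarrow> \<exists>J. \<forall>i\<ge>J. \<forall>j\<ge>J. nrm (level n) (l2_sub (X i) (X j)) < e"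
  obtains \<xi> where "\<xi> \<in> l2 A" "\<And>n. (\<lambda>i. nrm (level n) (l2_sub (X i) \<xi>)) \<longlonglongrightarrow> 0"
proof -
  have "\<exists>l. conv (\<lambda>i. X i k) l" for k
  proof (rule conv_exists)
    show "(\<lambda>i. X i k) \<in> seqs" using X by simp
    fix n and e :: real assume "e > 0"
    then obtain J where J: "\<And>i j. i \<ge> J \<Longrightarrow> j \<ge> J \<Longrightarrow> nrm (level n) (l2_sub (X i) (X j)) < e" using c by meson
    have "level n (X i k \<ominus> X j k) < e" if "i \<ge> J" "j \<ge> J" for i j
      using nrm_coord[OF level_continuous l2_sub_closed[OF X X], of n i j k] J[OF that]
      by (simp add: l2_sub_apply l2_seqs X)
    then show "\<exists>N. \<forall>i\<ge>N. \<forall>j\<ge>N. level n (X i k \<ominus> X j k) < e" by blast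
  qed
  then obtain \<xi> where x: "\<And>k. conv (\<lambda>i. X i k) (\<xi> k)" by metis
  have xs: "\<xi> \<in> seqs" using x by (simp add: conv_def)
  have subs: "l2_sub \<alpha> \<beta> \<in> seqs" if "\<alpha> \<in> seqs" "\<beta> \<in> seqs" for \<alpha> \<beta>
    unfolding l2_sub_def by (intro seqs_closed that)
  have lim: "(\<lambda>j. gram_norm (level n) F (l2_sub (X j) \<xi>)) \<longlonglongrightarrow> 0" for n F
  proof -
    have "(\<lambda>j. \<Sum>k\<in>F. (level n (X j k \<ominus> \<xi> k))\<^sup>2) \<longlonglongrightarrow> (\<Sum>k\<in>F. 0\<^sup>2)"
      using x by (intro tendsto_sum tendsto_power) (simp add: conv_def)
    then have "(\<lambda>j. \<Sum>k\<in>F. (level n (X j k \<ominus> \<xi> k))\<^sup>2) \<longlonglongrightarrow> 0" by simp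
    then have "(\<lambda>j. (gram_norm (level n) F (l2_sub (X j) \<xi>))\<^sup>2) \<longlonglongrightarrow> 0"
    proof (rule tendsto_zero_dominated)
      fix j
      show "(gram_norm (level n) F (l2_sub (X j) \<xi>))\<^sup>2 \<le> (\<Sum>k\<in>F. (level n (X j k \<ominus> \<xi> k))\<^sup>2)"
        using gram_norm_le_sum[OF level_cstar subs[OF l2_seqs[OF X] xs], of n F j]
        by (simp add: l2_sub_apply[OF xs])
    qed simp
    then show ?thesis by simp
  qed
  have fin: "gram_norm (level n) F (l2_sub (X i) \<xi>) \<le> e"
    if F: "finite F" and J: "\<And>j. j \<ge> J \<Longrightarrow> nrm (level n) (l2_sub (X i) (X j)) \<le> e" for n F i J e
  proof -
    have "gram_norm (level n) F (l2_sub (X i) \<xi>) \<le> e + gram_norm (level n) F (l2_sub (X j) \<xi>)" if "j \<ge> J" for j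
    proof -
      have "l2_sub (X i) \<xi> = l2_add A (l2_sub (X i) (X j)) (l2_sub (X j) \<xi>)"
      proof
        fix k
        show "l2_sub (X i) \<xi> k = l2_add A (l2_sub (X i) (X j)) (l2_sub (X j) \<xi>) k"
          using X xs by (simp add: l2_sub_apply[OF xs] l2_sub_apply[OF l2_seqs[OF X]] l2_add_def
              seminorms.minus_trans[of "X i k" "X j k" "\<xi> k"])
      qed
      then have "gram_norm (level n) F (l2_sub (X i) \<xi>)
          \<le> gram_norm (level n) F (l2_sub (X i) (X j)) + gram_norm (level n) F (l2_sub (X j) \<xi>)"
        using gram_norm_triangle[OF level_cstar subs[OF l2_seqs[OF X] l2_seqs[OF X]] subs[OF l2_seqs[OF X] xs] F, of n i j j] by simp
      also have "gram_norm (level n) F (l2_sub (X i) (X j)) \<le> nrm (level n) (l2_sub (X i) (X j))"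
        by (rule gram_norm_le_nrm[OF level_continuous l2_sub_closed[OF X X] F])
      finally show ?thesis using J[OF that] by linarith
    qed
    moreover have "(\<lambda>j. e + gram_norm (level n) F (l2_sub (X j) \<xi>)) \<longlonglongrightarrow> e + 0"
      by (intro tendsto_intros lim)
    ultimately show ?thesis by (intro LIMSEQ_le_const[where X = "\<lambda>j. e + gram_norm (level n) F (l2_sub (X j) \<xi>)"]) auto
  qed
  have xl2: "\<xi> \<in> l2 A"
  proof (rule l2I[OF xs])
    fix n and e :: real assume e: "e > 0"
    then have e3: "e / 3 > 0" by simp
    obtain J where J: "\<And>i j. i \<ge> J \<Longrightarrow> j \<ge> J \<Longrightarrow> nrm (level n) (l2_sub (X i) (X j)) < e / 3" using c[OF e3] by meson
    obtain M where M: "\<And>N. gram_norm (level n) {M..<N} (X J) < e / 3" using l2_tail[OF X e3] by meson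
    have "gram_norm (level n) {M..<N} \<xi> < e" for N
    proof -
      have "\<xi> = l2_add A (X J) (l2_cscale A (-1) (l2_sub (X J) \<xi>))"
      proof
        fix k
        show "\<xi> k = l2_add A (X J) (l2_cscale A (-1) (l2_sub (X J) \<xi>)) k"
          using X xs by (simp add: l2_sub_apply[OF xs] l2_add_def l2_cscale_def cscale_minus)
            (simp add: a_minus_def minus_add r_neg2 a_assoc[symmetric] r_neg)
      qed
      then have "gram_norm (level n) {M..<N} \<xi>
          \<le> gram_norm (level n) {M..<N} (X J) + gram_norm (level n) {M..<N} (l2_cscale A (-1) (l2_sub (X J) \<xi>))"
        using gram_norm_triangle[OF level_cstar l2_seqs[OF X] seqs_closed(3)[OF subs[OF l2_seqs[OF X] xs]], of "{M..<N}" n J "-1" J]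
        by simp
      also have "gram_norm (level n) {M..<N} (l2_cscale A (-1) (l2_sub (X J) \<xi>))
          \<le> gram_norm (level n) {M..<N} (l2_sub (X J) \<xi>) * 1"
      proof -
        have s: "l2_sub (X J) \<xi> \<in> seqs" by (rule subs[OF l2_seqs[OF X] xs])
        have "level n (cscale A (-1) \<one>) \<le> 1" using cs_one[OF level_cstar, of n] by (simp add: cs_cscale[OF level_cstar])
        then show ?thesis
          unfolding cscale_as_act[OF s]
          using gram_norm_act[OF level_cstar s, of "cscale A (-1) \<one>" n "{M..<N}"]
            mult_left_mono[of "level n (cscale A (-1) \<one>)" 1, OF _ gram_norm_nonneg[OF level_cstar s, of n "{M..<N}"]]
          by (simp add: cscale_closed)
      qed
      also have "gram_norm (level n) {M..<N} (l2_sub (X J) \<xi>) \<le> e / 3"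
        by (rule fin[where J = J]) (use J[of J] in \<open>auto intro: less_imp_le\<close>)
      finally show ?thesis using M[of N] e by linarith
    qed
    then show "\<exists>M. \<forall>N. gram_norm (level n) {M..<N} \<xi> < e" by blast
  qed
  have "(\<lambda>i. nrm (level n) (l2_sub (X i) \<xi>)) \<longlonglongrightarrow> 0" for n
  proof (rule LIMSEQ_I)
    fix e :: real assume e: "e > 0"
    then have e2: "e / 2 > 0" by simp
    obtain J where J: "\<And>i j. i \<ge> J \<Longrightarrow> j \<ge> J \<Longrightarrow> nrm (level n) (l2_sub (X i) (X j)) < e / 2" using c[OF e2] by meson
    have "norm (nrm (level n) (l2_sub (X i) \<xi>) - 0) < e" if "i \<ge> J" for i
    proof -
      have "nrm (level n) (l2_sub (X i) \<xi>) \<le> e / 2"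
        by (rule nrm_le[OF level_continuous l2_sub_closed[OF X xl2]], rule fin[where J = J])
          (use J[OF that] in \<open>auto intro: less_imp_le\<close>)
      then show ?thesis using nrm_nonneg[OF level_continuous l2_sub_closed[OF X xl2], of n i] e by simp
    qed
    then show "\<exists>J. \<forall>i\<ge>J. norm (nrm (level n) (l2_sub (X i) \<xi>) - 0) < e" by blast
  qed
  then show thesis using that xl2 by blast
qed

end

section \<open>Adjointable operators as a complete star-algebra with operator C*-seminorms\<close>

section \<open>Adjointable operators\<close>

lemma L_alg_simps [simp]:
  "carrier (L_alg A) = adjointable_ops A"
  "mult (L_alg A) = compose (l2 A)"
  "one (L_alg A) = (\<lambda>\<xi>\<in>l2 A. \<xi>)"
  "zero (L_alg A) = (\<lambda>\<xi>\<in>l2 A. l2_zero A)"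
  "add (L_alg A) = (\<lambda>s t. \<lambda>\<xi>\<in>l2 A. l2_add A (s \<xi>) (t \<xi>))"
  "cscale (L_alg A) = (\<lambda>c t. \<lambda>\<xi>\<in>l2 A. l2_cscale A c (t \<xi>))"
  "star (L_alg A) = (\<lambda>t. THE s. is_adjoint A t s)"
  by (simp_all add: L_alg_def L_ring_def)

text \<open>If \<open>b > 0\<close>, the powers of a quotient \<open>a / b > 1\<close> would outgrow
  the constant \<open>D\<close>. Only exponents that are powers of 2 arise, from repeated
  doubling.\<close>

lemma power_le_power_imp_le:
  fixes a b D :: real
  assumes "0 \<le> a" "0 \<le> b" and le: "\<And>k. a ^ (2 ^ k) \<le> D * b ^ (2 ^ k)"
  shows "a \<le> b"
proof (rule ccontr)
  assume "\<not> a \<le> b"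
  then have ab: "b < a" by simp
  show False
  proof (cases "b = 0")
    case True
    then have "a ^ (2 ^ 0) \<le> 0" using le[of 0] by simp
    then show False using ab True by simp
  next
    case False
    then have b: "b > 0" using assms by simp
    have r: "1 < a / b" using ab b by simp
    obtain k where k: "D < (a / b) ^ k" using real_arch_pow[OF r] by blast
    also have "\<dots> \<le> (a / b) ^ (2 ^ k)"
      by (rule power_increasing) (use r in \<open>auto simp: less_imp_le\<close>)
    also have "\<dots> \<le> D" using le[of k] b by (simp add: power_divide pos_divide_le_eq)
    finally show False by simp
  qed
qed

context sigma_cstar_algebra
begin

abbreviation ops :: "'a l2_op set" where
  "ops \<equiv> adjointable_ops A"

abbreviation op_nrm :: "('a \<Rightarrow> real) \<Rightarrow> 'a l2_op \<Rightarrow> real" where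
  "op_nrm \<equiv> op_seminorm A"

text \<open>\<open>is_adjoint\<close> makes only the second operator extensional; requiring the same
  of \<open>t\<close> turns it into a symmetric relation. Boundedness is kept apart, because it is
  proved one seminorm at a time.\<close>

definition adjoint_pair :: "'a l2_op \<Rightarrow> 'a l2_op \<Rightarrow> bool" where
  "adjoint_pair t s \<longleftrightarrow> t \<in> l2 A \<rightarrow>\<^sub>E l2 A \<and> is_adjoint A t s"

lemma adjoint_pairI:
  assumes "t \<in> l2 A \<rightarrow>\<^sub>E l2 A" "s \<in> l2 A \<rightarrow>\<^sub>E l2 A"
    "\<And>\<xi> \<eta>. \<xi> \<in> l2 A \<Longrightarrow> \<eta> \<in> l2 A \<Longrightarrow> inner (t \<xi>) \<eta> = inner \<xi> (s \<eta>)"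
  shows "adjoint_pair t s"
  using assms by (simp add: adjoint_pair_def is_adjoint_def)

lemma adjoint_pairD:
  assumes "adjoint_pair t s"
  shows "t \<in> l2 A \<rightarrow>\<^sub>E l2 A" "s \<in> l2 A \<rightarrow>\<^sub>E l2 A"
    "\<xi> \<in> l2 A \<Longrightarrow> t \<xi> \<in> l2 A" "\<xi> \<in> l2 A \<Longrightarrow> s \<xi> \<in> l2 A"
    "\<xi> \<in> l2 A \<Longrightarrow> \<eta> \<in> l2 A \<Longrightarrow> inner (t \<xi>) \<eta> = inner \<xi> (s \<eta>)"
  using assms by (auto simp: adjoint_pair_def is_adjoint_def)

lemma adjoint_pair_sym:
  assumes "adjoint_pair t s"
  shows "adjoint_pair s t"
proof (rule adjoint_pairI)
  note a = adjoint_pairD[OF assms]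
  show "s \<in> l2 A \<rightarrow>\<^sub>E l2 A" "t \<in> l2 A \<rightarrow>\<^sub>E l2 A" by (fact a)+
  fix \<xi> \<eta> assume x: "\<xi> \<in> l2 A" "\<eta> \<in> l2 A"
  have "inner (s \<xi>) \<eta> = star A (inner \<eta> (s \<xi>))" using x a by (simp add: inner_star)
  also have "\<dots> = star A (inner (t \<eta>) \<xi>)" using x a by simp
  also have "\<dots> = inner \<xi> (t \<eta>)" using x a(3)[of \<eta>] by (simp only: inner_star)
  finally show "inner (s \<xi>) \<eta> = inner \<xi> (t \<eta>)" .
qed

lemma adjoint_pair_unique:
  assumes "adjoint_pair t s" "adjoint_pair t s'"
  shows "s = s'"
proof (rule PiE_ext[OF adjoint_pairD(2)[OF assms(1)] adjoint_pairD(2)[OF assms(2)]])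
  fix \<eta> assume "\<eta> \<in> l2 A"
  then show "s \<eta> = s' \<eta>"
    by (intro inner_nondegenerate adjoint_pairD(4)[OF assms(1)] adjoint_pairD(4)[OF assms(2)]
        trans[OF adjoint_pairD(5)[OF assms(1), symmetric] adjoint_pairD(5)[OF assms(2)]])
qed

text \<open>Linearity over \<open>A\<close> is automatic: pair both sides with an arbitrary vector
  and move \<open>t\<close> across the inner product.\<close>

lemma adjoint_pair_module_map:
  assumes "adjoint_pair t s"
  shows "module_map A t"
proof -
  note a = adjoint_pairD[OF assms] and b = adjoint_pairD(5)[OF adjoint_pair_sym[OF assms], symmetric]
  show ?thesis
    unfolding module_map_def
  proof (intro conjI ballI)
    fix \<xi> \<eta> assume x: "\<xi> \<in> l2 A" "\<eta> \<in> l2 A"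
    show "t (l2_add A \<xi> \<eta>) = l2_add A (t \<xi>) (t \<eta>)"
      by (rule inner_nondegenerate) (use x a b in \<open>simp_all add: inner_add_right\<close>)
  next
    fix \<xi> c assume x: "\<xi> \<in> l2 A" "c \<in> carrier A"
    show "t (l2_act A \<xi> c) = l2_act A (t \<xi>) c"
      by (rule inner_nondegenerate) (use x a b in \<open>simp_all add: inner_act_right\<close>)
  qed
qed

text \<open>\<open>inner (s \<eta>) (s \<eta>)\<close> is
  \<open>inner (t (s \<eta>)) \<eta>\<close>; after Cauchy-Schwarz one factor
  \<open>nrm q (s \<eta>)\<close> cancels.\<close>

lemma op_bound_adjoint:
  assumes st: "adjoint_pair t s" and q: "ccs q" and M: "0 \<le> M"
    and b: "\<And>\<xi>. \<xi> \<in> l2 A \<Longrightarrow> nrm q (t \<xi>) \<le> M * nrm q \<xi>" and x: "\<eta> \<in> l2 A"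
  shows "nrm q (s \<eta>) \<le> M * nrm q \<eta>"
proof -
  note a = adjoint_pairD[OF st]
  have nn: "0 \<le> nrm q (s \<eta>)" "0 \<le> nrm q \<eta>" using a x q by (simp_all add: nrm_nonneg)
  have "(nrm q (s \<eta>))\<^sup>2 = q (inner (t (s \<eta>)) \<eta>)" using a x q by (simp add: nrm_square)
  also have "\<dots> \<le> nrm q (t (s \<eta>)) * nrm q \<eta>" by (rule inner_Cauchy_Schwarz) (use a x q in auto)
  also have "\<dots> \<le> (M * nrm q (s \<eta>)) * nrm q \<eta>"
    by (rule mult_right_mono[OF b nn(2)]) (use a x in auto)
  finally have "nrm q (s \<eta>) * nrm q (s \<eta>) \<le> (M * nrm q \<eta>) * nrm q (s \<eta>)"
    by (simp add: power2_eq_square mult_ac)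
  then show ?thesis
    using nn M by (cases "nrm q (s \<eta>) = 0") (auto simp: mult_le_cancel_right)
qed

text \<open>Comparing the powers \<open>(t\<^sup>* t)\<^bsup>2^k\<^esup>\<close> and taking roots removes the constant \<open>C\<close>.\<close>

lemma op_bound_dominated:
  assumes st: "adjoint_pair t s" and q: "ccs q" "ccs r" and M: "0 \<le> M"
    and b: "\<And>\<xi>. \<xi> \<in> l2 A \<Longrightarrow> nrm r (t \<xi>) \<le> M * nrm r \<xi>"
    and dom: "\<And>x. x \<in> carrier A \<Longrightarrow> q x \<le> C * r x" "C > 0" and x: "\<xi> \<in> l2 A"
  shows "nrm q (t \<xi>) \<le> M * nrm q \<xi>"
proof -
  note a = adjoint_pairD[OF st] and a' = adjoint_pairD(5)[OF adjoint_pair_sym[OF st]]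
  \<comment> \<open>As \<open>s\<close> is the adjoint of \<open>t\<close>, these are the powers of
    a self-adjoint operator, and Cauchy-Schwarz relates each power to the one with doubled
    exponent.\<close>
  define S where "S n = ((\<lambda>\<zeta>. s (t \<zeta>)) ^^ n)" for n
  have S_Suc: "S (Suc n) \<zeta> = s (t (S n \<zeta>))" for n \<zeta> by (simp add: S_def)
  have S_l2: "\<zeta> \<in> l2 A \<Longrightarrow> S n \<zeta> \<in> l2 A" for n \<zeta>
    by (induction n) (simp_all add: S_Suc a S_def[of 0])
  have S_add: "S (m + n) \<zeta> = S m (S n \<zeta>)" for m n \<zeta> by (simp add: S_def funpow_add)
  have S_sa: "inner (S n \<zeta>) \<eta> = inner \<zeta> (S n \<eta>)" if "\<zeta> \<in> l2 A" "\<eta> \<in> l2 A" for n \<zeta> \<eta>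
    using that
  proof (induction n arbitrary: \<eta>)
    case (Suc n)
    have "inner (S (Suc n) \<zeta>) \<eta> = inner (S n \<zeta>) (s (t \<eta>))"
      using Suc.prems a a' S_l2 by (simp add: S_Suc)
    also have "\<dots> = inner \<zeta> (S n (S 1 \<eta>))"
      using Suc a by (simp add: S_Suc S_def[of 0])
    finally show ?case using S_add[of n 1] by simp
  qed (simp add: S_def)
  have S_bound: "nrm r (S n \<xi>) \<le> (M * M) ^ n * nrm r \<xi>" for n
  proof (induction n)
    case (Suc n)
    have "nrm r (S (Suc n) \<xi>) \<le> M * nrm r (t (S n \<xi>))"
      unfolding S_Suc by (rule op_bound_adjoint[OF st q(2) M b]) (use S_l2 x a in auto)
    also have "\<dots> \<le> M * (M * nrm r (S n \<xi>))"
      by (intro mult_left_mono b S_l2 x M)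
    also have "\<dots> \<le> M * (M * ((M * M) ^ n * nrm r \<xi>))"
      by (intro mult_left_mono Suc M)
    finally show ?case by (simp add: mult_ac)
  qed (simp add: S_def)
  define y where "y = nrm q \<xi>"
  have y0: "y \<ge> 0" using nrm_nonneg[OF q(1) x] by (simp add: y_def)
  have tS: "(nrm q (t \<xi>))\<^sup>2 \<le> y * nrm q (S 1 \<xi>)"
  proof -
    have "(nrm q (t \<xi>))\<^sup>2 = q (inner \<xi> (S 1 \<xi>))"
      using a x q by (simp add: nrm_square S_Suc S_def[of 0])
    then show ?thesis using inner_Cauchy_Schwarz[OF q(1) x S_l2[OF x, of 1]] by (simp add: y_def)
  qed
  have "nrm q (S 1 \<xi>) \<le> (M * M) * y"
  proof (cases "y = 0")
    case True
    have "(nrm q (S 1 \<xi>))\<^sup>2 = q (inner \<xi> (S (1 + 1) \<xi>))"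
      unfolding S_add using S_l2 x q by (simp add: nrm_square S_sa[symmetric])
    also have "\<dots> \<le> y * nrm q (S (1 + 1) \<xi>)"
      unfolding y_def by (rule inner_Cauchy_Schwarz[OF q(1) x S_l2[OF x]])
    finally have "nrm q (S 1 \<xi>) = 0" using True by simp
    then show ?thesis using True by simp
  next
    case False
    then have y: "y > 0" using y0 by simp
    \<comment> \<open>By doubling, the normalised size of \<open>S 1 \<xi>\<close> is controlled by
      that of high powers, where passing from \<open>q\<close> to \<open>r\<close> costs only a
      fixed factor.\<close>
    have grow: "(nrm q (S 1 \<xi>) / y) ^ (2 ^ k) \<le> nrm q (S (2 ^ k) \<xi>) / y" for k
    proof (induction k)
      case (Suc k)
      have "(nrm q (S (2 ^ k) \<xi>))\<^sup>2 = q (inner \<xi> (S (2 ^ k + 2 ^ k) \<xi>))"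
        unfolding S_add using S_l2 x q by (simp add: nrm_square S_sa[symmetric])
      also have "\<dots> \<le> y * nrm q (S (2 ^ k + 2 ^ k) \<xi>)"
        unfolding y_def by (rule inner_Cauchy_Schwarz[OF q(1) x S_l2[OF x]])
      finally have 1: "(nrm q (S (2 ^ k) \<xi>))\<^sup>2 \<le> y * nrm q (S (2 ^ Suc k) \<xi>)" by (simp add: mult_2)
      have "(nrm q (S 1 \<xi>) / y) ^ (2 ^ Suc k) = ((nrm q (S 1 \<xi>) / y) ^ (2 ^ k))\<^sup>2"
        by (simp add: power_mult[symmetric] mult.commute)
      also have "\<dots> \<le> (nrm q (S (2 ^ k) \<xi>) / y)\<^sup>2"
        by (rule power_mono[OF Suc]) (use y nrm_nonneg[OF q(1) S_l2[OF x]] in simp)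
      also have "\<dots> \<le> nrm q (S (2 ^ Suc k) \<xi>) / y"
        using 1 y by (simp add: power_divide power2_eq_square divide_le_eq mult_ac)
      finally show ?case .
    qed simp
    have "nrm q (S 1 \<xi>) / y \<le> M * M"
    proof (rule power_le_power_imp_le)
      show "0 \<le> nrm q (S 1 \<xi>) / y" using y nrm_nonneg[OF q(1) S_l2[OF x, of 1]] by simp
      show "0 \<le> M * M" using M by simp
      fix k
      have "nrm q (S (2 ^ k) \<xi>) \<le> sqrt C * nrm r (S (2 ^ k) \<xi>)"
        by (rule nrm_dominated[OF q(1) dom(1) q(2) dom(2) S_l2[OF x]])
      also have "\<dots> \<le> sqrt C * ((M * M) ^ (2 ^ k) * nrm r \<xi>)"
        by (intro mult_left_mono S_bound) (use dom in simp)
      finally have "nrm q (S (2 ^ k) \<xi>) / y \<le> sqrt C * ((M * M) ^ (2 ^ k) * nrm r \<xi>) / y"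
        using y by (simp add: divide_right_mono)
      also have "\<dots> = (sqrt C * nrm r \<xi> / y) * (M * M) ^ (2 ^ k)" by simp
      finally show "(nrm q (S 1 \<xi>) / y) ^ (2 ^ k) \<le> (sqrt C * nrm r \<xi> / y) * (M * M) ^ (2 ^ k)"
        using grow[of k] by linarith
    qed
    then show ?thesis using y by (simp add: pos_divide_le_eq)
  qed
  then have "y * nrm q (S 1 \<xi>) \<le> y * ((M * M) * y)" using y0 by (rule mult_left_mono)
  also have "\<dots> = (M * y)\<^sup>2" by (simp add: power2_eq_square mult_ac)
  finally have "(nrm q (t \<xi>))\<^sup>2 \<le> (M * y)\<^sup>2" using tS by linarith
  then show ?thesis unfolding y_def[symmetric] by (rule power2_le_imp_le) (use M y0 in simp)
qed

text \<open>Every continuous C*-seminorm is dominated by some \<open>level n\<close> up to a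
  constant, and \<open>op_bound_dominated\<close> carries the operator bound over to it.\<close>

lemma opsI:
  assumes st: "adjoint_pair t s"
    and b: "\<And>n. \<exists>M. \<forall>\<xi>\<in>l2 A. nrm (level n) (t \<xi>) \<le> M * nrm (level n) \<xi>"
  shows "t \<in> ops"
proof -
  have "bounded_op A t"
    unfolding bounded_op_def
  proof (intro allI impI)
    fix q assume q: "ccs q"
    obtain n C where C: "C > 0" "\<And>x. x \<in> carrier A \<Longrightarrow> q x \<le> C * level n x"
      using ccs_dominated[OF q] by blast
    obtain M where M: "\<And>\<xi>. \<xi> \<in> l2 A \<Longrightarrow> nrm (level n) (t \<xi>) \<le> M * nrm (level n) \<xi>" using b by blast
    have M': "nrm (level n) (t \<xi>) \<le> \<bar>M\<bar> * nrm (level n) \<xi>" if "\<xi> \<in> l2 A" for \<xi>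
      using M[OF that] mult_right_mono[OF abs_ge_self nrm_nonneg[OF level_continuous that, of n], of M] by linarith
    show "\<exists>C. \<forall>\<xi>\<in>l2 A. nrm q (t \<xi>) \<le> C * nrm q \<xi>"
      using op_bound_dominated[OF st q level_continuous abs_ge_zero M' C(2,1)] by blast
  qed
  then show ?thesis
    using st adjoint_pair_module_map[OF st] by (auto simp: adjointable_ops_def adjoint_pair_def)
qed

lemma ops_adjoint_exists: "t \<in> ops \<Longrightarrow> \<exists>s. adjoint_pair t s"
  by (auto simp: adjointable_ops_def adjoint_pair_def)

lemma ops_l2 [simp]: "\<lbrakk>t \<in> ops; \<xi> \<in> l2 A\<rbrakk> \<Longrightarrow> t \<xi> \<in> l2 A"
  by (auto simp: adjointable_ops_def)

lemma ops_PiE: "t \<in> ops \<Longrightarrow> t \<in> l2 A \<rightarrow>\<^sub>E l2 A"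
  by (simp add: adjointable_ops_def)

lemma ops_eqI: "\<lbrakk>t \<in> ops; s \<in> ops; \<And>\<xi>. \<xi> \<in> l2 A \<Longrightarrow> t \<xi> = s \<xi>\<rbrakk> \<Longrightarrow> t = s"
  by (rule PiE_ext[OF ops_PiE ops_PiE])

lemma ops_add: "\<lbrakk>t \<in> ops; \<xi> \<in> l2 A; \<eta> \<in> l2 A\<rbrakk> \<Longrightarrow> t (l2_add A \<xi> \<eta>) = l2_add A (t \<xi>) (t \<eta>)"
  and ops_act: "\<lbrakk>t \<in> ops; \<xi> \<in> l2 A; a \<in> carrier A\<rbrakk> \<Longrightarrow> t (l2_act A \<xi> a) = l2_act A (t \<xi>) a"
  by (auto simp: adjointable_ops_def module_map_def)

lemma ops_cscale: "\<lbrakk>t \<in> ops; \<xi> \<in> l2 A\<rbrakk> \<Longrightarrow> t (l2_cscale A c \<xi>) = l2_cscale A c (t \<xi>)"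
  by (simp add: cscale_as_act l2_seqs ops_act cscale_closed del: mem_Collect_eq)

lemma op_nrm_set:
  assumes t: "t \<in> ops" and q: "ccs q"
  shows "bdd_above {nrm q (t \<xi>) |\<xi>. \<xi> \<in> l2 A \<and> nrm q \<xi> \<le> 1}"
    "{nrm q (t \<xi>) |\<xi>. \<xi> \<in> l2 A \<and> nrm q \<xi> \<le> 1} \<noteq> {}"
proof -
  obtain C where C: "\<And>\<xi>. \<xi> \<in> l2 A \<Longrightarrow> nrm q (t \<xi>) \<le> C * nrm q \<xi>"
    using t q unfolding adjointable_ops_def bounded_op_def by blast
  show "bdd_above {nrm q (t \<xi>) |\<xi>. \<xi> \<in> l2 A \<and> nrm q \<xi> \<le> 1}"
  proof (rule bdd_aboveI[of _ "\<bar>C\<bar>"], clarify)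
    fix \<xi> assume x: "\<xi> \<in> l2 A" "nrm q \<xi> \<le> 1"
    have "C * nrm q \<xi> \<le> \<bar>C\<bar> * 1"
      by (rule mult_mono) (use x nrm_nonneg[OF q] in auto)
    then show "nrm q (t \<xi>) \<le> \<bar>C\<bar>" using C[OF x(1)] by linarith
  qed
  show "{nrm q (t \<xi>) |\<xi>. \<xi> \<in> l2 A \<and> nrm q \<xi> \<le> 1} \<noteq> {}"
    using nrm_zero[OF q] by (auto intro!: exI[of _ "l2_zero A"])
qed

lemma op_nrm_nonneg: "\<lbrakk>t \<in> ops; ccs q\<rbrakk> \<Longrightarrow> 0 \<le> op_nrm q t"
proof -
  assume t: "t \<in> ops" and q: "ccs q"
  have "0 \<le> nrm q (t (l2_zero A))" using t q by (simp add: nrm_nonneg)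
  also have "\<dots> \<le> op_nrm q t"
    unfolding op_seminorm_def
    by (rule cSup_upper[OF _ op_nrm_set(1)[OF t q]]) (use nrm_zero[OF q] in \<open>auto intro!: exI[of _ "l2_zero A"]\<close>)
  finally show ?thesis .
qed

text \<open>Normalising \<open>\<xi>\<close> reduces to the supremum, except where
  \<open>nrm q \<xi> = 0\<close>; there boundedness of \<open>t\<close> makes the seminorm of
  \<open>t \<xi>\<close> vanish too.\<close>

lemma op_nrm_bound:
  assumes t: "t \<in> ops" and q: "ccs q" and x: "\<xi> \<in> l2 A"
  shows "nrm q (t \<xi>) \<le> op_nrm q t * nrm q \<xi>"
proof (cases "nrm q \<xi> = 0")
  case True
  obtain C where C: "\<And>\<xi>. \<xi> \<in> l2 A \<Longrightarrow> nrm q (t \<xi>) \<le> C * nrm q \<xi>"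
    using t q unfolding adjointable_ops_def bounded_op_def by blast
  then show ?thesis using C[OF x] True by simp
next
  case False
  define c where "c = nrm q \<xi>"
  have c: "c > 0" using False nrm_nonneg[OF q x] by (simp add: c_def)
  let ?\<zeta> = "l2_cscale A (of_real (1 / c)) \<xi>"
  have z: "?\<zeta> \<in> l2 A" "nrm q ?\<zeta> = 1"
    using x c nrm_cscale[OF q x, of "of_real (1 / c)"] by (simp_all add: c_def norm_divide)
  have "nrm q (t ?\<zeta>) \<le> op_nrm q t"
    unfolding op_seminorm_def
    by (rule cSup_upper[OF _ op_nrm_set(1)[OF t q]]) (use z in auto)
  moreover have "nrm q (t \<xi>) = c * nrm q (t ?\<zeta>)"
    using nrm_cscale[OF q ops_l2[OF t x], of "of_real (1 / c)"] c t x by (simp add: ops_cscale norm_divide)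
  ultimately show ?thesis using c by (simp add: c_def[symmetric] mult.commute mult_left_mono)
qed

lemma op_nrm_le:
  assumes t: "t \<in> ops" and q: "ccs q" and B: "0 \<le> B" "\<And>\<xi>. \<xi> \<in> l2 A \<Longrightarrow> nrm q (t \<xi>) \<le> B * nrm q \<xi>"
  shows "op_nrm q t \<le> B"
  unfolding op_seminorm_def
proof (rule cSup_least[OF op_nrm_set(2)[OF t q]], clarify)
  fix \<xi> assume x: "\<xi> \<in> l2 A" "nrm q \<xi> \<le> 1"
  have "B * nrm q \<xi> \<le> B" using x B by (simp add: mult_left_le)
  then show "nrm q (t \<xi>) \<le> B" using B(2)[OF x(1)] by linarith
qed

lemma star_L: "adjoint_pair t s \<Longrightarrow> star (L_alg A) t = s"
proof -
  assume st: "adjoint_pair t s"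
  have "(THE s. is_adjoint A t s) = s"
  proof (rule the_equality)
    show "is_adjoint A t s" using st by (simp add: adjoint_pair_def)
    fix s' assume "is_adjoint A t s'"
    then have "adjoint_pair t s'" using st by (simp add: adjoint_pair_def)
    then show "s' = s" using adjoint_pair_unique st by blast
  qed
  then show ?thesis by simp
qed

abbreviation adj :: "'a l2_op \<Rightarrow> 'a l2_op" where
  "adj \<equiv> star (L_alg A)"

lemma adj_pair: "t \<in> ops \<Longrightarrow> adjoint_pair t (adj t)"
  using ops_adjoint_exists star_L by metis

lemma opsI_bounded:
  assumes "adjoint_pair t s" "\<And>q. ccs q \<Longrightarrow> \<exists>M. \<forall>\<xi>\<in>l2 A. nrm q (t \<xi>) \<le> M * nrm q \<xi>"
  shows "t \<in> ops"
  by (rule opsI[OF assms(1)]) (rule assms(2)[OF level_continuous])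

lemma adj_closed [simp]:
  assumes t: "t \<in> ops"
  shows "adj t \<in> ops"
proof (rule opsI_bounded[OF adjoint_pair_sym[OF adj_pair[OF t]]])
  fix q assume q: "ccs q"
  have "nrm q (adj t \<xi>) \<le> op_nrm q t * nrm q \<xi>" if "\<xi> \<in> l2 A" for \<xi>
    by (rule op_bound_adjoint[OF adj_pair[OF t] q op_nrm_nonneg[OF t q] op_nrm_bound[OF t q] that])
  then show "\<exists>M. \<forall>\<xi>\<in>l2 A. nrm q (adj t \<xi>) \<le> M * nrm q \<xi>" by blast
qed

lemma inner_adj: "\<lbrakk>t \<in> ops; \<xi> \<in> l2 A; \<eta> \<in> l2 A\<rbrakk> \<Longrightarrow> inner (t \<xi>) \<eta> = inner \<xi> (adj t \<eta>)"
  using adjoint_pairD(5)[OF adj_pair] by blast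

lemma restrict_PiE: "(\<And>\<xi>. \<xi> \<in> l2 A \<Longrightarrow> f \<xi> \<in> l2 A) \<Longrightarrow> (\<lambda>\<xi>\<in>l2 A. f \<xi>) \<in> l2 A \<rightarrow>\<^sub>E l2 A"
  by auto

lemma add_pair:
  assumes "s \<in> ops" "t \<in> ops"
  shows "adjoint_pair (s \<oplus>\<^bsub>L_alg A\<^esub> t) (adj s \<oplus>\<^bsub>L_alg A\<^esub> adj t)"
proof (rule adjoint_pairI)
  fix \<xi> \<eta> assume "\<xi> \<in> l2 A" "\<eta> \<in> l2 A"
  then show "inner ((s \<oplus>\<^bsub>L_alg A\<^esub> t) \<xi>) \<eta> = inner \<xi> ((adj s \<oplus>\<^bsub>L_alg A\<^esub> adj t) \<eta>)"
    using assms adj_closed[OF assms(1)] adj_closed[OF assms(2)]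
    by (simp add: inner_add_left inner_add_right inner_adj del: L_alg_simps(7))
qed (use assms adj_closed in \<open>auto intro!: restrict_PiE simp del: L_alg_simps(7)\<close>)

lemma add_ops [simp]:
  assumes "s \<in> ops" "t \<in> ops"
  shows "s \<oplus>\<^bsub>L_alg A\<^esub> t \<in> ops"
proof (rule opsI_bounded[OF add_pair[OF assms]])
  fix q assume q: "ccs q"
  have "nrm q ((s \<oplus>\<^bsub>L_alg A\<^esub> t) \<xi>) \<le> (op_nrm q s + op_nrm q t) * nrm q \<xi>" if "\<xi> \<in> l2 A" for \<xi>
    using nrm_triangle[OF q, of "s \<xi>" "t \<xi>"] op_nrm_bound[OF assms(1) q that] op_nrm_bound[OF assms(2) q that]
      assms that by (simp add: distrib_right)
  then show "\<exists>M. \<forall>\<xi>\<in>l2 A. nrm q ((s \<oplus>\<^bsub>L_alg A\<^esub> t) \<xi>) \<le> M * nrm q \<xi>" by blast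
qed

lemma mult_pair:
  assumes "s \<in> ops" "t \<in> ops"
  shows "adjoint_pair (s \<otimes>\<^bsub>L_alg A\<^esub> t) (adj t \<otimes>\<^bsub>L_alg A\<^esub> adj s)"
proof (rule adjoint_pairI)
  fix \<xi> \<eta> assume "\<xi> \<in> l2 A" "\<eta> \<in> l2 A"
  then show "inner ((s \<otimes>\<^bsub>L_alg A\<^esub> t) \<xi>) \<eta> = inner \<xi> ((adj t \<otimes>\<^bsub>L_alg A\<^esub> adj s) \<eta>)"
    using assms adj_closed[OF assms(1)] adj_closed[OF assms(2)]
    by (simp add: compose_def inner_adj del: L_alg_simps(7))
qed (use assms adj_closed in \<open>auto intro!: restrict_PiE simp: compose_def simp del: L_alg_simps(7)\<close>)

lemma mult_ops [simp]:
  assumes "s \<in> ops" "t \<in> ops"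
  shows "s \<otimes>\<^bsub>L_alg A\<^esub> t \<in> ops"
proof (rule opsI_bounded[OF mult_pair[OF assms]])
  fix q assume q: "ccs q"
  have "nrm q ((s \<otimes>\<^bsub>L_alg A\<^esub> t) \<xi>) \<le> (op_nrm q s * op_nrm q t) * nrm q \<xi>" if "\<xi> \<in> l2 A" for \<xi>
    using op_nrm_bound[OF assms(1) q ops_l2[OF assms(2) that]]
      mult_left_mono[OF op_nrm_bound[OF assms(2) q that] op_nrm_nonneg[OF assms(1) q]] that
    by (simp add: compose_def mult.assoc)
  then show "\<exists>M. \<forall>\<xi>\<in>l2 A. nrm q ((s \<otimes>\<^bsub>L_alg A\<^esub> t) \<xi>) \<le> M * nrm q \<xi>" by blast
qed

lemma cscale_pair:
  assumes "t \<in> ops"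
  shows "adjoint_pair (cscale (L_alg A) c t) (cscale (L_alg A) (cnj c) (adj t))"
proof (rule adjoint_pairI)
  fix \<xi> \<eta> assume "\<xi> \<in> l2 A" "\<eta> \<in> l2 A"
  then show "inner (cscale (L_alg A) c t \<xi>) \<eta> = inner \<xi> (cscale (L_alg A) (cnj c) (adj t) \<eta>)"
    using assms adj_closed[OF assms] by (simp add: inner_cscale_left inner_cscale_right inner_adj del: L_alg_simps(7))
qed (use assms adj_closed in \<open>auto intro!: restrict_PiE simp del: L_alg_simps(7)\<close>)

lemma cscale_ops [simp]:
  assumes "t \<in> ops"
  shows "cscale (L_alg A) c t \<in> ops"
proof (rule opsI_bounded[OF cscale_pair[OF assms]])
  fix q assume q: "ccs q"
  have "nrm q (cscale (L_alg A) c t \<xi>) \<le> (cmod c * op_nrm q t) * nrm q \<xi>" if "\<xi> \<in> l2 A" for \<xi>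
    using mult_left_mono[OF op_nrm_bound[OF assms q that], of "cmod c"] nrm_cscale[OF q, of "t \<xi>" c] that assms
    by (simp add: mult.assoc)
  then show "\<exists>M. \<forall>\<xi>\<in>l2 A. nrm q (cscale (L_alg A) c t \<xi>) \<le> M * nrm q \<xi>" by blast
qed

lemma one_pair: "adjoint_pair \<one>\<^bsub>L_alg A\<^esub> \<one>\<^bsub>L_alg A\<^esub>"
  by (rule adjoint_pairI) auto

lemma one_ops [simp]: "\<one>\<^bsub>L_alg A\<^esub> \<in> ops"
  by (rule opsI_bounded[OF one_pair]) (auto intro!: exI[of _ 1])

lemma zero_eq_cscale: "\<zero>\<^bsub>L_alg A\<^esub> = cscale (L_alg A) 0 \<one>\<^bsub>L_alg A\<^esub>"
  by (rule ext) (simp add: restrict_def l2_cscale_def l2_zero_def cscale_zero_left fun_eq_iff)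

lemma zero_ops [simp]: "\<zero>\<^bsub>L_alg A\<^esub> \<in> ops"
  unfolding zero_eq_cscale by (rule cscale_ops[OF one_ops])

lemma l2_add_ac:
  "\<lbrakk>\<xi> \<in> l2 A; \<eta> \<in> l2 A; \<zeta> \<in> l2 A\<rbrakk> \<Longrightarrow> l2_add A (l2_add A \<xi> \<eta>) \<zeta> = l2_add A \<xi> (l2_add A \<eta> \<zeta>)"
  "\<lbrakk>\<xi> \<in> l2 A; \<eta> \<in> l2 A\<rbrakk> \<Longrightarrow> l2_add A \<xi> \<eta> = l2_add A \<eta> \<xi>"
  by (simp add: l2_add_def fun_eq_iff a_assoc) (simp add: l2_add_def fun_eq_iff a_comm)

lemma l2_add_zero: "\<xi> \<in> l2 A \<Longrightarrow> l2_add A (l2_zero A) \<xi> = \<xi>"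
  by (simp add: l2_add_def l2_zero_def fun_eq_iff)

lemma l2_add_neg: "\<xi> \<in> l2 A \<Longrightarrow> l2_add A (l2_cscale A (-1) \<xi>) \<xi> = l2_zero A"
  by (simp add: l2_add_def l2_cscale_def l2_zero_def fun_eq_iff cscale_minus l_neg)

lemma l2_cscale_laws:
  "\<xi> \<in> l2 A \<Longrightarrow> l2_cscale A 1 \<xi> = \<xi>"
  "\<xi> \<in> l2 A \<Longrightarrow> l2_cscale A c (l2_cscale A d \<xi>) = l2_cscale A (c * d) \<xi>"
  "\<xi> \<in> l2 A \<Longrightarrow> l2_cscale A (c + d) \<xi> = l2_add A (l2_cscale A c \<xi>) (l2_cscale A d \<xi>)"
  "\<lbrakk>\<xi> \<in> l2 A; \<eta> \<in> l2 A\<rbrakk> \<Longrightarrow> l2_cscale A c (l2_add A \<xi> \<eta>) = l2_add A (l2_cscale A c \<xi>) (l2_cscale A c \<eta>)"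
  by (simp_all add: l2_add_def l2_cscale_def fun_eq_iff cscale_one cscale_cscale cscale_add_left cscale_add_right)

lemma ring_L: "Ring.ring (L_alg A)"
proof (intro ringI abelian_groupI monoidI)
  fix s t r assume "s \<in> carrier (L_alg A)" "t \<in> carrier (L_alg A)" "r \<in> carrier (L_alg A)"
  then have str: "s \<in> ops" "t \<in> ops" "r \<in> ops" by simp_all
  show "s \<oplus>\<^bsub>L_alg A\<^esub> t \<oplus>\<^bsub>L_alg A\<^esub> r = s \<oplus>\<^bsub>L_alg A\<^esub> (t \<oplus>\<^bsub>L_alg A\<^esub> r)"
    using str by (intro ops_eqI add_ops) (simp_all add: l2_add_ac(1))
  show "s \<otimes>\<^bsub>L_alg A\<^esub> t \<otimes>\<^bsub>L_alg A\<^esub> r = s \<otimes>\<^bsub>L_alg A\<^esub> (t \<otimes>\<^bsub>L_alg A\<^esub> r)"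
    using str by (intro ops_eqI mult_ops) (simp_all add: compose_def)
  show "(s \<oplus>\<^bsub>L_alg A\<^esub> t) \<otimes>\<^bsub>L_alg A\<^esub> r = s \<otimes>\<^bsub>L_alg A\<^esub> r \<oplus>\<^bsub>L_alg A\<^esub> t \<otimes>\<^bsub>L_alg A\<^esub> r"
    using str by (intro ops_eqI add_ops mult_ops) (simp_all add: compose_def)
  show "r \<otimes>\<^bsub>L_alg A\<^esub> (s \<oplus>\<^bsub>L_alg A\<^esub> t) = r \<otimes>\<^bsub>L_alg A\<^esub> s \<oplus>\<^bsub>L_alg A\<^esub> r \<otimes>\<^bsub>L_alg A\<^esub> t"
    using str by (intro ops_eqI add_ops mult_ops) (simp_all add: compose_def ops_add)
next
  fix s t assume "s \<in> carrier (L_alg A)" "t \<in> carrier (L_alg A)"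
  then have st: "s \<in> ops" "t \<in> ops" by simp_all
  show "s \<oplus>\<^bsub>L_alg A\<^esub> t \<in> carrier (L_alg A)" using add_ops[OF st] by simp
  show "s \<otimes>\<^bsub>L_alg A\<^esub> t \<in> carrier (L_alg A)" using mult_ops[OF st] by simp
  show "s \<oplus>\<^bsub>L_alg A\<^esub> t = t \<oplus>\<^bsub>L_alg A\<^esub> s"
    using st by (intro ops_eqI add_ops) (simp_all add: l2_add_ac)
next
  fix t assume "t \<in> carrier (L_alg A)"
  then have t: "t \<in> ops" by simp
  show "\<zero>\<^bsub>L_alg A\<^esub> \<oplus>\<^bsub>L_alg A\<^esub> t = t"
    using t by (intro ops_eqI add_ops zero_ops) (simp_all add: l2_add_zero)
  show "\<one>\<^bsub>L_alg A\<^esub> \<otimes>\<^bsub>L_alg A\<^esub> t = t" "t \<otimes>\<^bsub>L_alg A\<^esub> \<one>\<^bsub>L_alg A\<^esub> = t"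
    using t by (intro ops_eqI mult_ops one_ops; simp add: compose_def)+
  have "cscale (L_alg A) (-1) t \<oplus>\<^bsub>L_alg A\<^esub> t = \<zero>\<^bsub>L_alg A\<^esub>"
    using t by (intro ops_eqI add_ops zero_ops cscale_ops) (simp_all add: l2_add_neg)
  then show "\<exists>s\<in>carrier (L_alg A). s \<oplus>\<^bsub>L_alg A\<^esub> t = \<zero>\<^bsub>L_alg A\<^esub>"
    using cscale_ops[OF t, of "-1"] by (metis L_alg_simps(1))
next
  show "\<zero>\<^bsub>L_alg A\<^esub> \<in> carrier (L_alg A)" using zero_ops by simp
  show "\<one>\<^bsub>L_alg A\<^esub> \<in> carrier (L_alg A)" using one_ops by simp
qed

lemma star_algebra_L: "star_algebra (L_alg A)"
proof (intro star_algebra.intro star_algebra_axioms.intro ring_L)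
  fix s t c d assume "s \<in> carrier (L_alg A)" "t \<in> carrier (L_alg A)"
  then have st: "s \<in> ops" "t \<in> ops" by simp_all
  show "cscale (L_alg A) c (s \<oplus>\<^bsub>L_alg A\<^esub> t) = cscale (L_alg A) c s \<oplus>\<^bsub>L_alg A\<^esub> cscale (L_alg A) c t"
    using st by (intro ops_eqI add_ops cscale_ops) (simp_all add: l2_cscale_laws)
  show "cscale (L_alg A) c s \<otimes>\<^bsub>L_alg A\<^esub> t = cscale (L_alg A) c (s \<otimes>\<^bsub>L_alg A\<^esub> t)"
    using st by (intro ops_eqI mult_ops cscale_ops) (simp_all add: compose_def)
  show "s \<otimes>\<^bsub>L_alg A\<^esub> cscale (L_alg A) c t = cscale (L_alg A) c (s \<otimes>\<^bsub>L_alg A\<^esub> t)"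
    using st by (intro ops_eqI mult_ops cscale_ops) (simp_all add: compose_def ops_cscale)
  show "adj (s \<oplus>\<^bsub>L_alg A\<^esub> t) = adj s \<oplus>\<^bsub>L_alg A\<^esub> adj t"
    by (rule star_L[OF add_pair[OF st]])
  show "adj (s \<otimes>\<^bsub>L_alg A\<^esub> t) = adj t \<otimes>\<^bsub>L_alg A\<^esub> adj s"
    by (rule star_L[OF mult_pair[OF st]])
next
  fix t c d assume "t \<in> carrier (L_alg A)"
  then have t: "t \<in> ops" by simp
  show "cscale (L_alg A) c t \<in> carrier (L_alg A)" using cscale_ops[OF t] by simp
  show "cscale (L_alg A) 1 t = t"
    using t by (intro ops_eqI cscale_ops) (simp_all add: l2_cscale_laws)
  show "cscale (L_alg A) c (cscale (L_alg A) d t) = cscale (L_alg A) (c * d) t"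
    using t by (intro ops_eqI cscale_ops) (simp_all add: l2_cscale_laws)
  show "cscale (L_alg A) (c + d) t = cscale (L_alg A) c t \<oplus>\<^bsub>L_alg A\<^esub> cscale (L_alg A) d t"
    using t by (intro ops_eqI add_ops cscale_ops) (simp_all add: l2_cscale_laws)
  show "adj t \<in> carrier (L_alg A)" using adj_closed[OF t] by (simp only: L_alg_simps(1))
  show "adj (adj t) = t" by (rule star_L[OF adjoint_pair_sym[OF adj_pair[OF t]]])
  show "adj (cscale (L_alg A) c t) = cscale (L_alg A) (cnj c) (adj t)"
    by (rule star_L[OF cscale_pair[OF t]])
qed

end

declare L_alg_simps(2-7) [simp del]

lemma cstar_seminormed_zero:
  "complex_star_ring st J \<Longrightarrow> cstar_seminormed st J (\<lambda>_. 0)"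
  by (simp add: cstar_seminormed_def cstar_seminormed_axioms_def)

text \<open>Subtraction uses only the carrier, addition and zero, which both records share; the
  topological arguments can then take place in \<open>L_alg\<close> throughout.\<close>

lemma seminorm_topology_L_ring: "seminorm_topology (L_ring A) P = seminorm_topology (L_alg A) P"
  unfolding seminorm_topology_def a_minus_def a_inv_def m_inv_def
  by (simp add: L_alg_def L_ring_def)

context sigma_cstar_algebra
begin

abbreviation "L \<equiv> L_alg A"
abbreviation "K \<equiv> K_ideal A"

abbreviation lev :: "nat \<Rightarrow> 'a l2_op \<Rightarrow> real" where
  "lev n \<equiv> op_nrm (level n)"

sublocale L: star_algebra "L_alg A"
  by (rule star_algebra_L)

lemma L_apply:
  "\<xi> \<in> l2 A \<Longrightarrow> (s \<oplus>\<^bsub>L\<^esub> t) \<xi> = l2_add A (s \<xi>) (t \<xi>)"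
  "\<xi> \<in> l2 A \<Longrightarrow> (s \<otimes>\<^bsub>L\<^esub> t) \<xi> = s (t \<xi>)"
  "\<xi> \<in> l2 A \<Longrightarrow> cscale L c t \<xi> = l2_cscale A c (t \<xi>)"
  by (simp_all add: L_alg_simps compose_def)

lemma L_minus_apply: "\<lbrakk>s \<in> ops; t \<in> ops; \<xi> \<in> l2 A\<rbrakk> \<Longrightarrow> (s \<ominus>\<^bsub>L\<^esub> t) \<xi> = l2_sub (s \<xi>) (t \<xi>)"
  using L.cscale_minus[of t] by (simp add: a_minus_def L_apply l2_sub_def flip: L.cscale_minus)

text \<open>The C*-identity comes from
  \<open>(nrm q (t \<xi>))^2 = q (inner \<xi> (adj t (t \<xi>)))\<close> and Cauchy-Schwarz; exact
  homogeneity comes from applying the one-sided estimate to \<open>c\<close> and to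
  \<open>1 / c\<close>.\<close>

lemma op_nrm_cstar:
  assumes q: "ccs q"
  shows "cstar_seminorm L (op_nrm q)"
proof -
  have mult: "op_nrm q (s \<otimes>\<^bsub>L\<^esub> t) \<le> op_nrm q s * op_nrm q t" if st: "s \<in> ops" "t \<in> ops" for s t
  proof (rule op_nrm_le[OF mult_ops[OF st] q])
    show "0 \<le> op_nrm q s * op_nrm q t" using st q by (simp add: op_nrm_nonneg)
    show "nrm q ((s \<otimes>\<^bsub>L\<^esub> t) \<xi>) \<le> op_nrm q s * op_nrm q t * nrm q \<xi>" if "\<xi> \<in> l2 A" for \<xi>
      using op_nrm_bound[OF st(1) q ops_l2[OF st(2) that]]
        mult_left_mono[OF op_nrm_bound[OF st(2) q that] op_nrm_nonneg[OF st(1) q]] that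
      by (simp add: L_apply mult.assoc)
  qed
  have star: "op_nrm q (adj t) \<le> op_nrm q t" if t: "t \<in> ops" for t
    by (rule op_nrm_le[OF adj_closed[OF t] q op_nrm_nonneg[OF t q]])
      (rule op_bound_adjoint[OF adj_pair[OF t] q op_nrm_nonneg[OF t q] op_nrm_bound[OF t q]])
  have cscale: "op_nrm q (cscale L c t) \<le> cmod c * op_nrm q t" if t: "t \<in> ops" for c t
  proof (rule op_nrm_le[OF cscale_ops[OF t] q])
    show "0 \<le> cmod c * op_nrm q t" using t q by (simp add: op_nrm_nonneg)
    show "nrm q (cscale L c t \<xi>) \<le> cmod c * op_nrm q t * nrm q \<xi>" if "\<xi> \<in> l2 A" for \<xi>
      using mult_left_mono[OF op_nrm_bound[OF t q that], of "cmod c"] nrm_cscale[OF q, of "t \<xi>" c] that t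
      by (simp add: L_apply mult.assoc)
  qed
  show ?thesis
    unfolding cstar_seminorm_def L_alg_simps(1)
  proof (intro conjI ballI allI)
    fix t assume t: "t \<in> ops"
    show "0 \<le> op_nrm q t" by (rule op_nrm_nonneg[OF t q])
    show "op_nrm q (cscale L c t) = cmod c * op_nrm q t" for c
    proof (cases "c = 0")
      case True
      then show ?thesis using cscale[OF t, of c] op_nrm_nonneg[OF cscale_ops[OF t] q, of c] by simp
    next
      case False
      have "cscale L (1 / c) (cscale L c t) = t"
        using False L.cscale_cscale[of t "1 / c" c] L.cscale_one[of t] t by simp
      then have "op_nrm q t \<le> cmod (1 / c) * op_nrm q (cscale L c t)"
        using cscale[OF cscale_ops[OF t], of "1 / c" c] by simp
      then have "cmod c * op_nrm q t \<le> op_nrm q (cscale L c t)"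
        using False by (simp add: norm_divide field_simps)
      then show ?thesis using cscale[OF t, of c] by simp
    qed
    show "op_nrm q (adj t \<otimes>\<^bsub>L\<^esub> t) = (op_nrm q t)\<^sup>2"
    proof (rule antisym)
      show "op_nrm q (adj t \<otimes>\<^bsub>L\<^esub> t) \<le> (op_nrm q t)\<^sup>2"
        using mult[OF adj_closed[OF t] t] mult_right_mono[OF star[OF t] op_nrm_nonneg[OF t q]]
        by (simp add: power2_eq_square)
      have tt: "adj t \<otimes>\<^bsub>L\<^esub> t \<in> ops" by (rule mult_ops[OF adj_closed[OF t] t])
      have "op_nrm q t \<le> sqrt (op_nrm q (adj t \<otimes>\<^bsub>L\<^esub> t))"
      proof (rule op_nrm_le[OF t q])
        show "0 \<le> sqrt (op_nrm q (adj t \<otimes>\<^bsub>L\<^esub> t))" using op_nrm_nonneg[OF tt q] by simp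
        fix \<xi> assume x: "\<xi> \<in> l2 A"
        have "(nrm q (t \<xi>))\<^sup>2 = q (inner \<xi> ((adj t \<otimes>\<^bsub>L\<^esub> t) \<xi>))"
          using x t q by (simp add: nrm_square inner_adj L_apply)
        also have "\<dots> \<le> nrm q \<xi> * nrm q ((adj t \<otimes>\<^bsub>L\<^esub> t) \<xi>)"
          by (rule inner_Cauchy_Schwarz[OF q x ops_l2[OF tt x]])
        also have "\<dots> \<le> nrm q \<xi> * (op_nrm q (adj t \<otimes>\<^bsub>L\<^esub> t) * nrm q \<xi>)"
          by (rule mult_left_mono[OF op_nrm_bound[OF tt q x] nrm_nonneg[OF q x]])
        also have "\<dots> = (sqrt (op_nrm q (adj t \<otimes>\<^bsub>L\<^esub> t)) * nrm q \<xi>)\<^sup>2"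
          using op_nrm_nonneg[OF tt q] by (simp add: power_mult_distrib power2_eq_square mult_ac)
        finally show "nrm q (t \<xi>) \<le> sqrt (op_nrm q (adj t \<otimes>\<^bsub>L\<^esub> t)) * nrm q \<xi>"
          by (rule power2_le_imp_le) (use op_nrm_nonneg[OF tt q] nrm_nonneg[OF q x] in simp)
      qed
      then have "(op_nrm q t)\<^sup>2 \<le> (sqrt (op_nrm q (adj t \<otimes>\<^bsub>L\<^esub> t)))\<^sup>2"
        by (rule power_mono) (rule op_nrm_nonneg[OF t q])
      then show "(op_nrm q t)\<^sup>2 \<le> op_nrm q (adj t \<otimes>\<^bsub>L\<^esub> t)" using op_nrm_nonneg[OF tt q] by simp
    qed
  next
    fix s t assume st: "s \<in> ops" "t \<in> ops"
    show "op_nrm q (s \<otimes>\<^bsub>L\<^esub> t) \<le> op_nrm q s * op_nrm q t" by (rule mult[OF st])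
    show "op_nrm q (s \<oplus>\<^bsub>L\<^esub> t) \<le> op_nrm q s + op_nrm q t"
    proof (rule op_nrm_le[OF add_ops[OF st] q])
      show "0 \<le> op_nrm q s + op_nrm q t" using st q by (simp add: op_nrm_nonneg)
      show "nrm q ((s \<oplus>\<^bsub>L\<^esub> t) \<xi>) \<le> (op_nrm q s + op_nrm q t) * nrm q \<xi>" if "\<xi> \<in> l2 A" for \<xi>
        using nrm_triangle[OF q, of "s \<xi>" "t \<xi>"] op_nrm_bound[OF st(1) q that] op_nrm_bound[OF st(2) q that]
          st that by (simp add: L_apply distrib_right)
    qed
  qed
qed

lemmas lev_cstar = op_nrm_cstar[OF level_continuous]

text \<open>The constant \<open>C\<close> of the domination does not survive in the conclusion; so
  the \<open>lev n\<close> increase, and every operator seminorm lies below one of them.\<close>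

lemma op_nrm_dominated:
  assumes t: "t \<in> ops" and q: "ccs q" "ccs r" and dom: "\<And>x. x \<in> carrier A \<Longrightarrow> q x \<le> C * r x" "C > 0"
  shows "op_nrm q t \<le> op_nrm r t"
  by (rule op_nrm_le[OF t q(1) op_nrm_nonneg[OF t q(2)]])
    (rule op_bound_dominated[OF adj_pair[OF t] q op_nrm_nonneg[OF t q(2)] op_nrm_bound[OF t q(2)] dom])

sublocale LT: graded_seminorms "L_alg A" "{op_nrm q |q. ccs q}" "\<lambda>n. op_nrm (level n)"
proof
  show "{op_nrm q |q. ccs q} \<noteq> {}" using level_continuous by blast
  fix r assume "r \<in> {op_nrm q |q. ccs q}"
  then obtain q where q: "ccs q" "r = op_nrm q" by blast
  show "r (x \<oplus>\<^bsub>L\<^esub> y) \<le> r x + r y" if "x \<in> carrier L" "y \<in> carrier L" for x y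
    using L.cs_add[OF op_nrm_cstar[OF q(1)] that] q by simp
  show "r \<zero>\<^bsub>L\<^esub> = 0" using L.cs_zero[OF op_nrm_cstar[OF q(1)]] q by simp
  obtain n C where C: "C > 0" "\<And>x. x \<in> carrier A \<Longrightarrow> q x \<le> C * level n x"
    using ccs_dominated[OF q(1)] by blast
  have "r y \<le> 1 * op_nrm (level n) y" if "y \<in> carrier L" for y
    using op_nrm_dominated[OF _ q(1) level_continuous C(2,1)] that q(2) by simp
  then show "\<exists>n. \<exists>C>0. \<forall>y\<in>carrier L. r y \<le> C * op_nrm (level n) y" using zero_less_one by blast
next
  fix y m n assume y: "y \<in> carrier L" and mn: "(m :: nat) \<le> n"
  show "op_nrm (level m) y \<le> op_nrm (level n) y"
    by (rule op_nrm_dominated[where C = 1]) (use y level_continuous level_mono[OF mn] in auto)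
next
  fix y n assume "y \<in> carrier L"
  then show "0 \<le> op_nrm (level n) y" using op_nrm_nonneg[OF _ level_continuous] by simp
next
  fix n show "op_nrm (level n) \<zero>\<^bsub>L\<^esub> = 0" by (rule L.cs_zero[OF lev_cstar])
next
  fix x and e :: real and n assume x: "x \<in> carrier L" "0 < e"
  have l: "op_nrm (level n) \<in> {op_nrm q |q. ccs q}" using level_continuous by blast
  show "openin (seminorm_topology L {op_nrm q |q. ccs q}) {y \<in> carrier L. op_nrm (level n) (y \<ominus>\<^bsub>L\<^esub> x) < e}"
    unfolding seminorm_topology_def by (rule topology_generated_by_Basis) (use x l in blast)
qed

lemma tpl_L: "tpl L = LT.T"
proof -
  have "tpl L = seminorm_topology (L_ring A) {op_nrm q |q. ccs q}" by (simp add: L_alg_def)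
  then show ?thesis by (simp only: seminorm_topology_L_ring)
qed

lemma L_separation:
  assumes st: "s \<in> ops" "t \<in> ops" and z: "\<And>n. lev n (s \<ominus>\<^bsub>L\<^esub> t) = 0"
  shows "s = t"
proof (rule ops_eqI[OF st])
  fix \<xi> assume x: "\<xi> \<in> l2 A"
  have d: "s \<ominus>\<^bsub>L\<^esub> t \<in> ops" using L.minus_closed st by simp
  show "s \<xi> = t \<xi>"
  proof (rule l2_eqI)
    fix n
    have "nrm (level n) (l2_sub (s \<xi>) (t \<xi>)) \<le> 0 * nrm (level n) \<xi>"
      using op_nrm_bound[OF d level_continuous x, of n] z[of n] st x by (simp add: L_minus_apply)
    then show "nrm (level n) (l2_sub (s \<xi>) (t \<xi>)) = 0"
      using nrm_nonneg[OF level_continuous, of "l2_sub (s \<xi>) (t \<xi>)" n] st x by simp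
  qed (use st x in simp_all)
qed

lemma L_pointwise_limit:
  assumes T: "\<And>j. T j \<in> ops"
    and c: "\<And>n e. e > 0 \<Longrightarrow> \<exists>J. \<forall>i\<ge>J. \<forall>j\<ge>J. lev n (T i \<ominus>\<^bsub>L\<^esub> T j) < e"
    and x: "\<xi> \<in> l2 A"
  shows "\<exists>\<zeta>\<in>l2 A. \<forall>n. (\<lambda>i. nrm (level n) (l2_sub (T i \<xi>) \<zeta>)) \<longlonglongrightarrow> 0"
proof -
  have "\<exists>J. \<forall>i\<ge>J. \<forall>j\<ge>J. nrm (level n) (l2_sub (T i \<xi>) (T j \<xi>)) < e" if e: "e > 0" for n e
  proof -
    define b where "b = nrm (level n) \<xi> + 1"
    have b: "b > 0" "nrm (level n) \<xi> \<le> b" using nrm_nonneg[OF level_continuous x, of n] by (simp_all add: b_def)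
    have "e / b > 0" using e b by simp
    then obtain J where J: "\<And>i j. i \<ge> J \<Longrightarrow> j \<ge> J \<Longrightarrow> lev n (T i \<ominus>\<^bsub>L\<^esub> T j) < e / b" using c by meson
    have "nrm (level n) (l2_sub (T i \<xi>) (T j \<xi>)) < e" if ij: "i \<ge> J" "j \<ge> J" for i j
    proof -
      have d: "T i \<ominus>\<^bsub>L\<^esub> T j \<in> ops" using L.minus_closed T by simp
      have "nrm (level n) (l2_sub (T i \<xi>) (T j \<xi>)) \<le> lev n (T i \<ominus>\<^bsub>L\<^esub> T j) * nrm (level n) \<xi>"
        using op_nrm_bound[OF d level_continuous x, of n] T x by (simp add: L_minus_apply)
      also have "\<dots> \<le> lev n (T i \<ominus>\<^bsub>L\<^esub> T j) * b"
        by (rule mult_left_mono[OF b(2) op_nrm_nonneg[OF d level_continuous]])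
      also have "\<dots> < (e / b) * b" by (rule mult_strict_right_mono[OF J[OF ij] b(1)])
      finally show ?thesis using b by simp
    qed
    then show ?thesis by blast
  qed
  then obtain \<zeta> where "\<zeta> \<in> l2 A" "\<And>n. (\<lambda>i. nrm (level n) (l2_sub (T i \<xi>) \<zeta>)) \<longlonglongrightarrow> 0"
    using l2_complete[of "\<lambda>i. T i \<xi>"] T x by (metis ops_l2)
  then show ?thesis by blast
qed

text \<open>Adjointability of the limit is obtained by passing to the limit in the adjoints too,
  which satisfy the same Cauchy estimates because the involution is isometric. Continuity of the
  inner product makes the two pointwise limits adjoint to each other.\<close>

lemma L_complete:
  assumes T: "\<And>j. T j \<in> ops"
    and c: "\<And>n e. e > 0 \<Longrightarrow> \<exists>J. \<forall>i\<ge>J. \<forall>j\<ge>J. lev n (T i \<ominus>\<^bsub>L\<^esub> T j) < e"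
  shows "\<exists>t\<in>ops. \<forall>n. (\<lambda>i. lev n (T i \<ominus>\<^bsub>L\<^esub> t)) \<longlonglongrightarrow> 0"
proof -
  have T': "adj (T j) \<in> ops" for j using T by simp
  have c': "\<exists>J. \<forall>i\<ge>J. \<forall>j\<ge>J. lev n (adj (T i) \<ominus>\<^bsub>L\<^esub> adj (T j)) < e" if "e > 0" for n e
  proof -
    have "lev n (adj (T i) \<ominus>\<^bsub>L\<^esub> adj (T j)) = lev n (T i \<ominus>\<^bsub>L\<^esub> T j)" for i j
      using L.star_diff[of "T i" "T j"] L.cs_star[OF lev_cstar L.minus_closed, of "T i" "T j" n] T by simp
    then show ?thesis using c[OF that, of n] by simp
  qed
  define f where "f \<xi> = (SOME \<zeta>. \<zeta> \<in> l2 A \<and> (\<forall>n. (\<lambda>i. nrm (level n) (l2_sub (T i \<xi>) \<zeta>)) \<longlonglongrightarrow> 0))" for \<xi>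
  define g where "g \<xi> = (SOME \<zeta>. \<zeta> \<in> l2 A \<and> (\<forall>n. (\<lambda>i. nrm (level n) (l2_sub (adj (T i) \<xi>) \<zeta>)) \<longlonglongrightarrow> 0))" for \<xi>
  have f: "f \<xi> \<in> l2 A" "(\<lambda>i. nrm (level n) (l2_sub (T i \<xi>) (f \<xi>))) \<longlonglongrightarrow> 0" if x: "\<xi> \<in> l2 A" for \<xi> n
    using someI_ex[of "\<lambda>\<zeta>. \<zeta> \<in> l2 A \<and> (\<forall>n. (\<lambda>i. nrm (level n) (l2_sub (T i \<xi>) \<zeta>)) \<longlonglongrightarrow> 0)"]
      L_pointwise_limit[OF T c x] unfolding f_def by blast+
  have g: "g \<xi> \<in> l2 A" "(\<lambda>i. nrm (level n) (l2_sub (adj (T i) \<xi>) (g \<xi>))) \<longlonglongrightarrow> 0" if x: "\<xi> \<in> l2 A" for \<xi> n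
    using someI_ex[of "\<lambda>\<zeta>. \<zeta> \<in> l2 A \<and> (\<forall>n. (\<lambda>i. nrm (level n) (l2_sub (adj (T i) \<xi>) \<zeta>)) \<longlonglongrightarrow> 0)"]
      L_pointwise_limit[OF T' c' x] unfolding g_def by blast+
  define t where "t = (\<lambda>\<xi>\<in>l2 A. f \<xi>)"
  have t_eq: "\<xi> \<in> l2 A \<Longrightarrow> t \<xi> = f \<xi>" for \<xi> by (simp add: t_def)
  have pair: "adjoint_pair t (\<lambda>\<xi>\<in>l2 A. g \<xi>)"
  proof (rule adjoint_pairI)
    fix \<xi> \<eta> assume x: "\<xi> \<in> l2 A" and y: "\<eta> \<in> l2 A"
    have "inner (f \<xi>) \<eta> = inner \<xi> (g \<eta>)"
    proof (rule separation)
      fix n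
      have "level n (inner (f \<xi>) \<eta> \<ominus> inner \<xi> (g \<eta>))
          \<le> nrm (level n) (l2_sub (T i \<xi>) (f \<xi>)) * nrm (level n) \<eta> +
            nrm (level n) \<xi> * nrm (level n) (l2_sub (adj (T i) \<eta>) (g \<eta>))" for i
      proof -
        have "level n (inner (f \<xi>) \<eta> \<ominus> inner \<xi> (g \<eta>))
            \<le> level n (inner (T i \<xi>) \<eta> \<ominus> inner (f \<xi>) \<eta>) + level n (inner (T i \<xi>) \<eta> \<ominus> inner \<xi> (g \<eta>))"
          using cs_triangle[OF level_cstar, of "inner (f \<xi>) \<eta>" "inner (T i \<xi>) \<eta>" "inner \<xi> (g \<eta>)" n]
            cs_commute[OF level_cstar, of "inner (f \<xi>) \<eta>" "inner (T i \<xi>) \<eta>" n] x y T f g by simp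
        also have "inner (T i \<xi>) \<eta> \<ominus> inner (f \<xi>) \<eta> = inner (l2_sub (T i \<xi>) (f \<xi>)) \<eta>"
          using x y T f by (simp add: inner_sub_left)
        also have "inner (T i \<xi>) \<eta> \<ominus> inner \<xi> (g \<eta>) = inner \<xi> (l2_sub (adj (T i) \<eta>) (g \<eta>))"
          using x y T g by (simp add: inner_sub_right inner_adj)
        also have "level n (inner (l2_sub (T i \<xi>) (f \<xi>)) \<eta>) \<le> nrm (level n) (l2_sub (T i \<xi>) (f \<xi>)) * nrm (level n) \<eta>"
          by (rule inner_Cauchy_Schwarz[OF level_continuous]) (use x y T f in auto)
        also have "level n (inner \<xi> (l2_sub (adj (T i) \<eta>) (g \<eta>))) \<le> nrm (level n) \<xi> * nrm (level n) (l2_sub (adj (T i) \<eta>) (g \<eta>))"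
          by (rule inner_Cauchy_Schwarz[OF level_continuous]) (use x y T g in auto)
        finally show ?thesis by simp
      qed
      moreover have "(\<lambda>i. nrm (level n) (l2_sub (T i \<xi>) (f \<xi>)) * nrm (level n) \<eta> +
            nrm (level n) \<xi> * nrm (level n) (l2_sub (adj (T i) \<eta>) (g \<eta>))) \<longlonglongrightarrow> 0 * nrm (level n) \<eta> + nrm (level n) \<xi> * 0"
        by (intro tendsto_intros f g x y)
      ultimately have "level n (inner (f \<xi>) \<eta> \<ominus> inner \<xi> (g \<eta>)) \<le> 0 * nrm (level n) \<eta> + nrm (level n) \<xi> * 0"
        by (intro LIMSEQ_le_const) auto
      then show "level n (inner (f \<xi>) \<eta> \<ominus> inner \<xi> (g \<eta>)) = 0"
        using cs_nonneg[OF level_cstar, of "inner (f \<xi>) \<eta> \<ominus> inner \<xi> (g \<eta>)" n] x y f g by simp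
    qed (use x y f g in simp_all)
    then show "inner (t \<xi>) \<eta> = inner \<xi> ((\<lambda>\<xi>\<in>l2 A. g \<xi>) \<eta>)" using x y by (simp add: t_eq)
  qed (use f g in \<open>auto simp: t_def\<close>)
  \<comment> \<open>Letting \<open>j\<close> tend to infinity turns the Cauchy estimate between
    \<open>T i\<close> and \<open>T j\<close> into one against the limit, uniformly in
    \<open>\<xi>\<close>.\<close>
  have near: "nrm (level n) (l2_sub (T i \<xi>) (f \<xi>)) \<le> e * nrm (level n) \<xi>"
    if J: "\<And>j. j \<ge> J \<Longrightarrow> lev n (T i \<ominus>\<^bsub>L\<^esub> T j) \<le> e" and x: "\<xi> \<in> l2 A" for n i J e \<xi>
  proof -
    have "nrm (level n) (l2_sub (T i \<xi>) (f \<xi>)) \<le> e * nrm (level n) \<xi> + nrm (level n) (l2_sub (T j \<xi>) (f \<xi>))"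
      if j: "j \<ge> J" for j
    proof -
      have d: "T i \<ominus>\<^bsub>L\<^esub> T j \<in> ops" using L.minus_closed T by simp
      have "nrm (level n) (l2_sub (T i \<xi>) (T j \<xi>)) \<le> lev n (T i \<ominus>\<^bsub>L\<^esub> T j) * nrm (level n) \<xi>"
        using op_nrm_bound[OF d level_continuous x, of n] T x by (simp add: L_minus_apply)
      also have "\<dots> \<le> e * nrm (level n) \<xi>"
        by (rule mult_right_mono[OF J[OF j] nrm_nonneg[OF level_continuous x]])
      finally show ?thesis
        using nrm_sub_triangle[OF level_continuous, of "T i \<xi>" "T j \<xi>" "f \<xi>" n] T f x by fastforce
    qed
    moreover have "(\<lambda>j. e * nrm (level n) \<xi> + nrm (level n) (l2_sub (T j \<xi>) (f \<xi>))) \<longlonglongrightarrow> e * nrm (level n) \<xi> + 0"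
      by (intro tendsto_intros f x)
    ultimately show ?thesis
      by (intro LIMSEQ_le_const[where X = "\<lambda>j. e * nrm (level n) \<xi> + nrm (level n) (l2_sub (T j \<xi>) (f \<xi>))"]) auto
  qed
  have tops: "t \<in> ops"
  proof (rule opsI[OF pair])
    fix n
    obtain J where J: "\<And>i j. i \<ge> J \<Longrightarrow> j \<ge> J \<Longrightarrow> lev n (T i \<ominus>\<^bsub>L\<^esub> T j) < 1" using c[of 1 n] by auto
    have "nrm (level n) (t \<xi>) \<le> (lev n (T J) + 1) * nrm (level n) \<xi>" if x: "\<xi> \<in> l2 A" for \<xi>
    proof -
      have z: "l2_sub \<zeta> (l2_zero A) = \<zeta>" if "\<zeta> \<in> l2 A" for \<zeta>
        using that by (simp add: l2_sub_def l2_add_def l2_cscale_def l2_zero_def fun_eq_iff)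
      have "nrm (level n) (f \<xi>) \<le> nrm (level n) (l2_sub (T J \<xi>) (f \<xi>)) + nrm (level n) (T J \<xi>)"
        using nrm_sub_triangle[OF level_continuous f(1)[OF x] ops_l2[OF T[of J] x] l2_zero_closed, of n]
          nrm_sub_commute[OF level_continuous f(1)[OF x] ops_l2[OF T[of J] x], of n]
        by (simp add: z f(1)[OF x] ops_l2[OF T x])
      also have "nrm (level n) (l2_sub (T J \<xi>) (f \<xi>)) \<le> 1 * nrm (level n) \<xi>"
        by (rule near[where J = J, OF _ x]) (use J[of J] in \<open>auto intro: less_imp_le\<close>)
      also have "nrm (level n) (T J \<xi>) \<le> lev n (T J) * nrm (level n) \<xi>"
        by (rule op_nrm_bound[OF T level_continuous x])
      finally show ?thesis using x by (simp add: t_eq distrib_right)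
    qed
    then show "\<exists>M. \<forall>\<xi>\<in>l2 A. nrm (level n) (t \<xi>) \<le> M * nrm (level n) \<xi>" by blast
  qed
  have "(\<lambda>i. lev n (T i \<ominus>\<^bsub>L\<^esub> t)) \<longlonglongrightarrow> 0" for n
  proof (rule LIMSEQ_I)
    fix e :: real assume e: "e > 0"
    then have e2: "e / 2 > 0" by simp
    obtain J where J: "\<And>i j. i \<ge> J \<Longrightarrow> j \<ge> J \<Longrightarrow> lev n (T i \<ominus>\<^bsub>L\<^esub> T j) < e / 2" using c[OF e2] by meson
    have "norm (lev n (T i \<ominus>\<^bsub>L\<^esub> t) - 0) < e" if i: "i \<ge> J" for i
    proof -
      have d: "T i \<ominus>\<^bsub>L\<^esub> t \<in> ops" using L.minus_closed T tops by simp
      have "lev n (T i \<ominus>\<^bsub>L\<^esub> t) \<le> e / 2"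
      proof (rule op_nrm_le[OF d level_continuous])
        fix \<xi> assume x: "\<xi> \<in> l2 A"
        have "nrm (level n) (l2_sub (T i \<xi>) (f \<xi>)) \<le> e / 2 * nrm (level n) \<xi>"
          by (rule near[where J = J, OF _ x]) (use J[OF i] in \<open>auto intro: less_imp_le\<close>)
        then show "nrm (level n) ((T i \<ominus>\<^bsub>L\<^esub> t) \<xi>) \<le> e / 2 * nrm (level n) \<xi>"
          using T tops x by (simp add: L_minus_apply t_eq)
      qed (use e in simp)
      then show ?thesis using op_nrm_nonneg[OF d level_continuous, of n] e by simp
    qed
    then show "\<exists>J. \<forall>i\<ge>J. norm (lev n (T i \<ominus>\<^bsub>L\<^esub> t) - 0) < e" by blast
  qed
  then show ?thesis using tops by blast
qed

section \<open>The closed two-sided ideal of compact operators\<close>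

section \<open>Compact operators\<close>

lemma rank_one_pair:
  assumes "\<xi> \<in> l2 A" "\<eta> \<in> l2 A"
  shows "adjoint_pair (rank_one A \<xi> \<eta>) (rank_one A \<eta> \<xi>)"
proof (rule adjoint_pairI)
  fix \<zeta> \<omega> assume "\<zeta> \<in> l2 A" "\<omega> \<in> l2 A"
  then show "inner (rank_one A \<xi> \<eta> \<zeta>) \<omega> = inner \<zeta> (rank_one A \<eta> \<xi> \<omega>)"
    using assms by (simp add: rank_one_def inner_act_left inner_act_right inner_star)
qed (use assms in \<open>auto simp: rank_one_def\<close>)

lemma rank_one_ops:
  assumes "\<xi> \<in> l2 A" "\<eta> \<in> l2 A"
  shows "rank_one A \<xi> \<eta> \<in> ops"
proof (rule opsI_bounded[OF rank_one_pair[OF assms]])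
  fix q assume q: "ccs q"
  have "nrm q (rank_one A \<xi> \<eta> \<zeta>) \<le> (nrm q \<xi> * nrm q \<eta>) * nrm q \<zeta>" if "\<zeta> \<in> l2 A" for \<zeta>
    using nrm_act[OF q assms(1), of "inner \<eta> \<zeta>"]
      mult_left_mono[OF inner_Cauchy_Schwarz[OF q assms(2) that] nrm_nonneg[OF q assms(1)]] that assms
    by (simp add: rank_one_def mult.assoc)
  then show "\<exists>M. \<forall>\<zeta>\<in>l2 A. nrm q (rank_one A \<xi> \<eta> \<zeta>) \<le> M * nrm q \<zeta>" by blast
qed

lemma finite_rank_ops: "t \<in> finite_rank A \<Longrightarrow> t \<in> ops"
  by (induction rule: finite_rank.induct) (auto intro: rank_one_ops)

lemma finite_rank_adj: "t \<in> finite_rank A \<Longrightarrow> adj t \<in> finite_rank A"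
proof (induction rule: finite_rank.induct)
  case (rank_one \<xi> \<eta>)
  then show ?case using star_L[OF rank_one_pair] by (simp add: finite_rank.rank_one)
next
  case (add s t)
  then show ?case using L.star_add[of s t] by (simp add: finite_rank_ops finite_rank.add)
next
  case (cscale t c)
  then show ?case using L.star_cscale[of t c] by (simp add: finite_rank_ops finite_rank.cscale)
qed

lemma finite_rank_mult_left:
  assumes s: "s \<in> ops"
  shows "t \<in> finite_rank A \<Longrightarrow> s \<otimes>\<^bsub>L\<^esub> t \<in> finite_rank A"
proof (induction rule: finite_rank.induct)
  case (rank_one \<xi> \<eta>)
  have "s \<otimes>\<^bsub>L\<^esub> rank_one A \<xi> \<eta> = rank_one A (s \<xi>) \<eta>"
    using rank_one s by (intro ops_eqI mult_ops rank_one_ops) (simp_all add: L_apply rank_one_def ops_act)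
  then show ?case using rank_one s by (simp add: finite_rank.rank_one)
next
  case (add t r)
  then show ?case using L.r_distr[of t r s] s by (simp add: finite_rank_ops finite_rank.add)
next
  case (cscale t c)
  then show ?case using L.cscale_mult_right[of s t c] s by (simp add: finite_rank_ops finite_rank.cscale)
qed

lemma K_iff: "x \<in> K \<longleftrightarrow> x \<in> ops \<and> (\<forall>n. \<forall>e>0. \<exists>y\<in>finite_rank A. lev n (y \<ominus>\<^bsub>L\<^esub> x) < e)"
  unfolding K_ideal_def tpl_L by (subst LT.closure_of_iff) (auto simp: finite_rank_ops)

lemma K_ops: "x \<in> K \<Longrightarrow> x \<in> ops"
  unfolding K_iff by (rule conjunct1)

lemma K_approx: "\<lbrakk>x \<in> K; e > 0\<rbrakk> \<Longrightarrow> \<exists>y\<in>finite_rank A. lev n (y \<ominus>\<^bsub>L\<^esub> x) < e"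
  using K_iff by meson

lemma KI:
  assumes "x \<in> ops" "\<And>n e. e > 0 \<Longrightarrow> \<exists>y\<in>finite_rank A. lev n (y \<ominus>\<^bsub>L\<^esub> x) < e"
  shows "x \<in> K"
  unfolding K_iff by (intro conjI allI impI assms)

lemma K_limit:
  assumes x: "x \<in> ops" and a: "\<And>n e. e > 0 \<Longrightarrow> \<exists>y\<in>K. lev n (x \<ominus>\<^bsub>L\<^esub> y) < e"
  shows "x \<in> K"
proof (rule KI[OF x])
  fix n and e :: real assume e: "e > 0"
  then have e2: "e / 2 > 0" by simp
  obtain y where y: "y \<in> K" "lev n (x \<ominus>\<^bsub>L\<^esub> y) < e / 2" using a[OF e2] by blast
  obtain z where z: "z \<in> finite_rank A" "lev n (z \<ominus>\<^bsub>L\<^esub> y) < e / 2" using K_approx[OF y(1) e2] by blast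
  have "lev n (z \<ominus>\<^bsub>L\<^esub> x) < e"
    using L.cs_triangle[OF lev_cstar, of z y x n] L.cs_commute[OF lev_cstar, of x y n] x y z
    by (simp add: K_ops finite_rank_ops)
  then show "\<exists>y\<in>finite_rank A. lev n (y \<ominus>\<^bsub>L\<^esub> x) < e" using z(1) by blast
qed

lemma K_add:
  assumes "x \<in> K" "y \<in> K"
  shows "x \<oplus>\<^bsub>L\<^esub> y \<in> K"
proof (rule KI)
  note o = K_ops[OF assms(1)] K_ops[OF assms(2)]
  show "x \<oplus>\<^bsub>L\<^esub> y \<in> ops" using o by simp
  fix n and e :: real assume e: "e > 0"
  then have e2: "e / 2 > 0" by simp
  obtain z where z: "z \<in> finite_rank A" "lev n (z \<ominus>\<^bsub>L\<^esub> x) < e / 2" using K_approx[OF assms(1) e2] by blast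
  obtain w where w: "w \<in> finite_rank A" "lev n (w \<ominus>\<^bsub>L\<^esub> y) < e / 2" using K_approx[OF assms(2) e2] by blast
  have zw: "z \<in> carrier L" "w \<in> carrier L" "x \<in> carrier L" "y \<in> carrier L" using z w o by (simp_all add: finite_rank_ops)
  have "(z \<oplus>\<^bsub>L\<^esub> w) \<ominus>\<^bsub>L\<^esub> (x \<oplus>\<^bsub>L\<^esub> y) = (z \<ominus>\<^bsub>L\<^esub> x) \<oplus>\<^bsub>L\<^esub> (w \<ominus>\<^bsub>L\<^esub> y)"
    using zw by (simp add: a_minus_def L.minus_add L.a_ac del: L_alg_simps)
  then have "lev n ((z \<oplus>\<^bsub>L\<^esub> w) \<ominus>\<^bsub>L\<^esub> (x \<oplus>\<^bsub>L\<^esub> y)) \<le> lev n (z \<ominus>\<^bsub>L\<^esub> x) + lev n (w \<ominus>\<^bsub>L\<^esub> y)"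
    using L.cs_add[OF lev_cstar L.minus_closed[OF zw(1,3)] L.minus_closed[OF zw(2,4)], of n] by simp
  then have "lev n ((z \<oplus>\<^bsub>L\<^esub> w) \<ominus>\<^bsub>L\<^esub> (x \<oplus>\<^bsub>L\<^esub> y)) < e" using z w by linarith
  then show "\<exists>y'\<in>finite_rank A. lev n (y' \<ominus>\<^bsub>L\<^esub> (x \<oplus>\<^bsub>L\<^esub> y)) < e"
    using finite_rank.add[OF z(1) w(1)] by blast
qed

lemma K_mult_left:
  assumes s: "s \<in> ops" and x: "x \<in> K"
  shows "s \<otimes>\<^bsub>L\<^esub> x \<in> K"
proof (rule KI)
  note o = s K_ops[OF x]
  show "s \<otimes>\<^bsub>L\<^esub> x \<in> ops" using o by simp
  fix n and e :: real assume e: "e > 0"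
  define b where "b = lev n s + 1"
  have b: "b > 0" "lev n s \<le> b" using op_nrm_nonneg[OF s level_continuous, of n] by (simp_all add: b_def)
  have "e / b > 0" using e b by simp
  then obtain z where z: "z \<in> finite_rank A" "lev n (z \<ominus>\<^bsub>L\<^esub> x) < e / b" using K_approx[OF x] by blast
  have zx: "z \<in> carrier L" "x \<in> carrier L" "s \<in> carrier L" using z o by (simp_all add: finite_rank_ops)
  have d: "z \<ominus>\<^bsub>L\<^esub> x \<in> ops" using L.minus_closed[OF zx(1,2)] by simp
  have "(s \<otimes>\<^bsub>L\<^esub> z) \<ominus>\<^bsub>L\<^esub> (s \<otimes>\<^bsub>L\<^esub> x) = s \<otimes>\<^bsub>L\<^esub> (z \<ominus>\<^bsub>L\<^esub> x)"
    using zx by (simp add: a_minus_def L.r_distr L.r_minus del: L_alg_simps)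
  then have "lev n ((s \<otimes>\<^bsub>L\<^esub> z) \<ominus>\<^bsub>L\<^esub> (s \<otimes>\<^bsub>L\<^esub> x)) \<le> lev n s * lev n (z \<ominus>\<^bsub>L\<^esub> x)"
    using L.cs_mult[OF lev_cstar zx(3) L.minus_closed[OF zx(1,2)], of n] by simp
  also have "\<dots> \<le> b * lev n (z \<ominus>\<^bsub>L\<^esub> x)"
    by (rule mult_right_mono[OF b(2) op_nrm_nonneg[OF d level_continuous]])
  also have "\<dots> < b * (e / b)" using z(2) b(1) by (rule mult_strict_left_mono)
  also have "\<dots> = e" using b by simp
  finally show "\<exists>y\<in>finite_rank A. lev n (y \<ominus>\<^bsub>L\<^esub> (s \<otimes>\<^bsub>L\<^esub> x)) < e"
    using finite_rank_mult_left[OF s z(1)] by blast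
qed

lemma K_adj:
  assumes x: "x \<in> K"
  shows "adj x \<in> K"
proof (rule KI)
  note o = K_ops[OF x]
  show "adj x \<in> ops" using o by simp
  fix n and e :: real assume e: "e > 0"
  obtain z where z: "z \<in> finite_rank A" "lev n (z \<ominus>\<^bsub>L\<^esub> x) < e" using K_approx[OF x e] by blast
  have zx: "z \<in> carrier L" "x \<in> carrier L" using z o by (simp_all add: finite_rank_ops)
  have "lev n (adj z \<ominus>\<^bsub>L\<^esub> adj x) = lev n (z \<ominus>\<^bsub>L\<^esub> x)"
    using L.star_diff[OF zx] L.cs_star[OF lev_cstar L.minus_closed[OF zx], of n] by simp
  then show "\<exists>y\<in>finite_rank A. lev n (y \<ominus>\<^bsub>L\<^esub> adj x) < e"
    using z finite_rank_adj by metis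
qed

text \<open>The involution preserves \<open>K\<close> and exchanges left and right
  multiplication.\<close>

lemma K_mult_right:
  assumes "s \<in> ops" "x \<in> K"
  shows "x \<otimes>\<^bsub>L\<^esub> s \<in> K"
proof -
  have "adj (adj s \<otimes>\<^bsub>L\<^esub> adj x) \<in> K" by (intro K_adj K_mult_left adj_closed assms)
  then show ?thesis using L.star_mult[of "adj s" "adj x"] assms K_ops[OF assms(2)] by (simp add: L.star_star)
qed

text \<open>The inductive set \<open>finite_rank\<close> has no clause for zero; the zero operator
  is reached as a multiple of a rank-one operator.\<close>

lemma K_zero: "\<zero>\<^bsub>L\<^esub> \<in> K"
proof -
  have "rank_one A (l2_zero A) (l2_zero A) \<in> K"
  proof (rule KI)
    show r: "rank_one A (l2_zero A) (l2_zero A) \<in> ops" by (rule rank_one_ops) simp_all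
    show "\<exists>y\<in>finite_rank A. lev n (y \<ominus>\<^bsub>L\<^esub> rank_one A (l2_zero A) (l2_zero A)) < e" if "e > 0" for n e
      using that r finite_rank.rank_one[of "l2_zero A" A "l2_zero A"]
      by (intro bexI[of _ "rank_one A (l2_zero A) (l2_zero A)"]) (simp_all add: LT.minus_self LT.s_zero)
  qed
  then have "\<zero>\<^bsub>L\<^esub> \<otimes>\<^bsub>L\<^esub> rank_one A (l2_zero A) (l2_zero A) \<in> K" by (rule K_mult_left[OF zero_ops])
  then show ?thesis using L.l_null[of "rank_one A (l2_zero A) (l2_zero A)"] rank_one_ops by simp
qed

lemma ideal_K: "ideal K L"
proof (rule idealI)
  show "Ring.ring L" by (rule ring_L)
  show "subgroup K (add_monoid L)"
  proof (rule L.add.subgroupI)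
    show "K \<subseteq> carrier L" using K_ops by auto
    show "K \<noteq> {}" using K_zero by blast
    show "\<ominus>\<^bsub>L\<^esub> x \<in> K" if "x \<in> K" for x
      using K_mult_left[of "\<ominus>\<^bsub>L\<^esub> \<one>\<^bsub>L\<^esub>" x] that K_ops[OF that] L.l_minus[of "\<one>\<^bsub>L\<^esub>" x] L.a_inv_closed[of "\<one>\<^bsub>L\<^esub>"]
      by simp
    show "x \<oplus>\<^bsub>L\<^esub> y \<in> K" if "x \<in> K" "y \<in> K" for x y using that by (rule K_add)
  qed
qed (use K_mult_left K_mult_right in auto)

end

section \<open>Cosets, unitaries, open sets and continuous paths in the quotient\<close>

section \<open>The quotient algebra\<close>

context sigma_cstar_algebra
begin

abbreviation coset :: "'a l2_op \<Rightarrow> 'a l2_op set" where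
  "coset t \<equiv> K +>\<^bsub>L\<^esub> t"

lemma coset_eq_iff: "\<lbrakk>s \<in> ops; t \<in> ops\<rbrakk> \<Longrightarrow> coset s = coset t \<longleftrightarrow> s \<ominus>\<^bsub>L\<^esub> t \<in> K"
  using L.quotient_eq_iff_same_a_r_cos[OF ideal_K, of s t] by simp

lemma mem_coset: "s \<in> ops \<Longrightarrow> t \<in> coset s \<Longrightarrow> t \<in> ops \<and> coset t = coset s"
proof -
  assume s: "s \<in> ops" and t: "t \<in> coset s"
  interpret I: ideal K L by (rule ideal_K)
  obtain k where k: "k \<in> K" "t = k \<oplus>\<^bsub>L\<^esub> s" using t by (auto simp: a_r_coset_def')
  then show ?thesis
    using s t K_ops[OF k(1)] I.a_repr_independence'[of t s] by simp
qed

lemma coset_self: "s \<in> ops \<Longrightarrow> s \<in> coset s"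
proof -
  assume s: "s \<in> ops"
  interpret I: ideal K L by (rule ideal_K)
  show ?thesis using I.a_rcos_self[of s] s by simp
qed

lemma Q_carrier: "carrier (Q_alg A) = coset ` ops"
  by (auto simp: Q_alg_def quotient_tsalg_def FactRing_def A_RCOSETS_def')

lemma Q_one: "\<one>\<^bsub>Q_alg A\<^esub> = coset \<one>\<^bsub>L\<^esub>"
  by (simp add: Q_alg_def quotient_tsalg_def FactRing_def)

lemma Q_mult: "\<lbrakk>s \<in> ops; t \<in> ops\<rbrakk> \<Longrightarrow> coset s \<otimes>\<^bsub>Q_alg A\<^esub> coset t = coset (s \<otimes>\<^bsub>L\<^esub> t)"
  using ideal.rcoset_mult_add[OF ideal_K, of s t] by (simp add: Q_alg_def quotient_tsalg_def FactRing_def)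

lemma Q_star:
  assumes t: "t \<in> ops"
  shows "star (Q_alg A) (coset t) = coset (adj t)"
proof -
  have "coset (adj s) = coset (adj t)" if "s \<in> coset t" for s
  proof -
    have s: "s \<in> ops" "coset s = coset t" using mem_coset[OF t that] by auto
    then have "s \<ominus>\<^bsub>L\<^esub> t \<in> K" using coset_eq_iff t by blast
    then have "adj s \<ominus>\<^bsub>L\<^esub> adj t \<in> K" using K_adj L.star_diff[of s t] s t by fastforce
    then show ?thesis using coset_eq_iff[of "adj s" "adj t"] s t by simp
  qed
  then have "(\<Union>s\<in>coset t. coset (adj s)) = (\<Union>s\<in>coset t. coset (adj t))" by simp
  also have "\<dots> = coset (adj t)" using coset_self[OF t] by blast
  finally show ?thesis by (simp add: Q_alg_def quotient_tsalg_def)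
qed

lemma Q_unitary:
  assumes "u \<in> unitaries (Q_alg A)"
  obtains r where "r \<in> ops" "u = coset r" "adj r \<otimes>\<^bsub>L\<^esub> r \<ominus>\<^bsub>L\<^esub> \<one>\<^bsub>L\<^esub> \<in> K" "r \<otimes>\<^bsub>L\<^esub> adj r \<ominus>\<^bsub>L\<^esub> \<one>\<^bsub>L\<^esub> \<in> K"
proof -
  obtain r where r: "r \<in> ops" "u = coset r" using assms by (auto simp: unitaries_def Q_carrier)
  have "coset (adj r \<otimes>\<^bsub>L\<^esub> r) = coset \<one>\<^bsub>L\<^esub>" "coset (r \<otimes>\<^bsub>L\<^esub> adj r) = coset \<one>\<^bsub>L\<^esub>"
    using assms r(1) unfolding unitaries_def r(2) by (simp_all add: Q_star Q_mult Q_one)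
  then show thesis using that[OF r] coset_eq_iff r(1) by (metis adj_closed mult_ops one_ops)
qed

lemma Q_tpl: "tpl (Q_alg A) = quotient_topology (tpl L) coset"
  by (simp add: Q_alg_def quotient_tsalg_def)

lemma coset_shift:
  assumes "x \<in> ops" "y \<in> ops" "r \<in> ops" "k \<in> ops"
  shows "x \<ominus>\<^bsub>L\<^esub> r \<oplus>\<^bsub>L\<^esub> ((y \<ominus>\<^bsub>L\<^esub> x) \<oplus>\<^bsub>L\<^esub> k) = (y \<ominus>\<^bsub>L\<^esub> r) \<oplus>\<^bsub>L\<^esub> k"
proof -
  have c: "x \<in> carrier L" "y \<in> carrier L" "k \<in> carrier L" "r \<in> carrier L" using assms by simp_all
  have "x \<ominus>\<^bsub>L\<^esub> r \<oplus>\<^bsub>L\<^esub> (y \<ominus>\<^bsub>L\<^esub> x) = (y \<ominus>\<^bsub>L\<^esub> x) \<oplus>\<^bsub>L\<^esub> (x \<ominus>\<^bsub>L\<^esub> r)"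
    by (intro L.a_comm L.minus_closed c)
  also have "\<dots> = y \<ominus>\<^bsub>L\<^esub> r" by (rule LT.minus_trans[symmetric]) (intro c)+
  finally show ?thesis
    using L.a_assoc[OF L.minus_closed[OF c(1,4)] L.minus_closed[OF c(2,1)] c(3)] by simp
qed

lemma Q_ball_open:
  assumes r: "r \<in> ops" and e: "e > 0"
  shows "openin (tpl (Q_alg A)) (coset ` {y \<in> ops. \<exists>k\<in>K. lev n (y \<ominus>\<^bsub>L\<^esub> r \<oplus>\<^bsub>L\<^esub> k) < e})"
proof -
  define W where "W = {y \<in> ops. \<exists>k\<in>K. lev n (y \<ominus>\<^bsub>L\<^esub> r \<oplus>\<^bsub>L\<^esub> k) < e}"
  have shift: "y \<ominus>\<^bsub>L\<^esub> (r \<ominus>\<^bsub>L\<^esub> k) = y \<ominus>\<^bsub>L\<^esub> r \<oplus>\<^bsub>L\<^esub> k" if "y \<in> ops" "k \<in> ops" for y k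
  proof -
    have "y \<in> carrier L" "k \<in> carrier L" "r \<in> carrier L" using that r by simp_all
    then show ?thesis by (simp add: a_minus_def L.minus_add L.a_assoc del: L_alg_simps)
  qed
  have "W = (\<Union>k\<in>K. {y \<in> carrier L. lev n (y \<ominus>\<^bsub>L\<^esub> (r \<ominus>\<^bsub>L\<^esub> k)) < e})"
    using K_ops by (auto simp: W_def shift)
  moreover have "openin (tpl L) {y \<in> carrier L. lev n (y \<ominus>\<^bsub>L\<^esub> (r \<ominus>\<^bsub>L\<^esub> k)) < e}" if "k \<in> K" for k
    unfolding tpl_L by (rule LT.s_open[OF L.minus_closed e]) (use r K_ops[OF that] in simp_all)
  ultimately have W: "openin (tpl L) W" by (auto intro: openin_Union)
  have "{x \<in> topspace (tpl L). coset x \<in> coset ` W} = W"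
  proof
    show "W \<subseteq> {x \<in> topspace (tpl L). coset x \<in> coset ` W}"
      by (auto simp: W_def tpl_L LT.topspace_T)
    show "{x \<in> topspace (tpl L). coset x \<in> coset ` W} \<subseteq> W"
    proof
      fix x assume "x \<in> {x \<in> topspace (tpl L). coset x \<in> coset ` W}"
      then obtain y where x: "x \<in> ops" and y: "y \<in> W" "coset x = coset y"
        by (auto simp: tpl_L LT.topspace_T)
      then obtain k where k: "k \<in> K" "lev n (y \<ominus>\<^bsub>L\<^esub> r \<oplus>\<^bsub>L\<^esub> k) < e" and yo: "y \<in> ops" by (auto simp: W_def)
      have d: "y \<ominus>\<^bsub>L\<^esub> x \<in> K" using y(2) x yo coset_eq_iff by metis
      have "x \<ominus>\<^bsub>L\<^esub> r \<oplus>\<^bsub>L\<^esub> ((y \<ominus>\<^bsub>L\<^esub> x) \<oplus>\<^bsub>L\<^esub> k) = (y \<ominus>\<^bsub>L\<^esub> r) \<oplus>\<^bsub>L\<^esub> k"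
        by (rule coset_shift[OF x yo r K_ops[OF k(1)]])
      then have "lev n (x \<ominus>\<^bsub>L\<^esub> r \<oplus>\<^bsub>L\<^esub> ((y \<ominus>\<^bsub>L\<^esub> x) \<oplus>\<^bsub>L\<^esub> k)) < e" using k by simp
      then show "x \<in> W" unfolding W_def using x K_add[OF d k(1)] by blast
    qed
  qed
  moreover have "coset ` W \<subseteq> coset ` topspace (tpl L)" by (auto simp: W_def tpl_L LT.topspace_T)
  ultimately show ?thesis
    unfolding Q_tpl openin_quotient_topology W_def[symmetric] using W by simp
qed

text \<open>The representatives \<open>r t\<close> need not depend continuously on \<open>t\<close>;
  continuity of \<open>g\<close> becomes visible only after a correction by an element of
  \<open>K\<close>, which is what the quotient seminorms measure.\<close>

lemma Q_path_continuous:
  assumes g: "pathin (subtopology (tpl (Q_alg A)) (unitaries (Q_alg A))) g"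
    and r: "\<And>t. t \<in> {0..1} \<Longrightarrow> r t \<in> ops \<and> g t = coset (r t)"
    and t: "t \<in> {0..1}" and e: "e > 0"
  shows "\<exists>d>0. \<forall>s\<in>{0..1}. \<bar>s - t\<bar> < d \<longrightarrow> (\<exists>k\<in>K. lev n (r s \<ominus>\<^bsub>L\<^esub> r t \<oplus>\<^bsub>L\<^esub> k) < e)"
proof -
  have rt: "r t \<in> ops" using r[OF t] by simp
  define W where "W = {y \<in> ops. \<exists>k\<in>K. lev n (y \<ominus>\<^bsub>L\<^esub> r t \<oplus>\<^bsub>L\<^esub> k) < e}"
  have "continuous_map (top_of_set {0..1}) (tpl (Q_alg A)) g"
    using g by (simp add: pathin_def continuous_map_in_subtopology)
  then have "openin (top_of_set {0..1}) {s \<in> topspace (top_of_set {0..1}). g s \<in> coset ` W}"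
    by (rule openin_continuous_map_preimage) (unfold W_def, rule Q_ball_open[OF rt e])
  moreover have "r t \<in> W"
  proof -
    have "r t \<ominus>\<^bsub>L\<^esub> r t \<oplus>\<^bsub>L\<^esub> \<zero>\<^bsub>L\<^esub> = \<zero>\<^bsub>L\<^esub>" using rt by (simp add: LT.minus_self)
    then show ?thesis using rt e K_zero by (auto simp: W_def LT.s_zero intro!: bexI[of _ "\<zero>\<^bsub>L\<^esub>"])
  qed
  then have "t \<in> {s \<in> topspace (top_of_set {0..1}). g s \<in> coset ` W}" using t r by auto
  ultimately have "\<exists>d>0. \<forall>s\<in>{0..1}. dist s t < d \<longrightarrow> s \<in> {s \<in> topspace (top_of_set {0..1}). g s \<in> coset ` W}"
    unfolding openin_euclidean_subtopology_iff by (elim conjE) (drule (1) bspec)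
  then obtain d where d: "d > 0"
    "\<And>s. s \<in> {0..1} \<Longrightarrow> dist s t < d \<Longrightarrow> s \<in> {s \<in> topspace (top_of_set {0..1}). g s \<in> coset ` W}"
    by meson
  have "\<exists>k\<in>K. lev n (r s \<ominus>\<^bsub>L\<^esub> r t \<oplus>\<^bsub>L\<^esub> k) < e" if s: "s \<in> {0..1}" "\<bar>s - t\<bar> < d" for s
  proof -
    have "g s \<in> coset ` W" using d(2)[OF s(1)] s(2) by (simp add: dist_real_def)
    then obtain y where y: "y \<in> W" "coset (r s) = coset y" using r[OF s(1)] by auto
    then obtain k where k: "k \<in> K" "lev n (y \<ominus>\<^bsub>L\<^esub> r t \<oplus>\<^bsub>L\<^esub> k) < e" and yo: "y \<in> ops" by (auto simp: W_def)
    have rs: "r s \<in> ops" using r[OF s(1)] by simp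
    have dK: "y \<ominus>\<^bsub>L\<^esub> r s \<in> K" using y(2) rs yo coset_eq_iff by metis
    have "r s \<ominus>\<^bsub>L\<^esub> r t \<oplus>\<^bsub>L\<^esub> ((y \<ominus>\<^bsub>L\<^esub> r s) \<oplus>\<^bsub>L\<^esub> k) = (y \<ominus>\<^bsub>L\<^esub> r t) \<oplus>\<^bsub>L\<^esub> k"
      by (rule coset_shift[OF rs yo rt K_ops[OF k(1)]])
    then show ?thesis using K_add[OF dK k(1)] k(2) by metis
  qed
  then show ?thesis using d(1) by blast
qed

end

section \<open>From the trivial class to a path, and from the path to the unitary lift\<close>

theorem lemma3p2:
  fixes A :: "'a tsalg" and u :: "'a l2_op set"
  assumes "sigma_cstar_algebra A"
    and "u \<in> unitaries (Q_alg A)"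
    and "RK0_class A u = \<one>\<^bsub>RK0 A\<^esub>"
  shows "\<exists>w \<in> unitaries (L_alg A). K_ideal A +>\<^bsub>L_alg A\<^esub> w = u"
proof -
  interpret sigma_cstar_algebra A by fact
  let ?Q = "Q_alg A"
  have one_coset: "\<one>\<^bsub>?Q\<^esub> \<otimes>\<^bsub>?Q\<^esub> coset t = coset t" if "t \<in> ops" for t
    using that L.l_one[of t] by (simp add: Q_one Q_mult)
  have star_one: "adj \<one>\<^bsub>L\<^esub> = \<one>\<^bsub>L\<^esub>" by (rule L.star_one)
  have "\<one>\<^bsub>?Q\<^esub> \<in> unitaries ?Q"
    using one_coset[OF one_ops] one_ops by (simp add: unitaries_def Q_carrier Q_one Q_star star_one)
  moreover have "topspace (tpl ?Q) = carrier ?Q"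
    by (simp add: Q_tpl topspace_quotient_topology Q_carrier tpl_L LT.topspace_T)
  ultimately have "\<one>\<^bsub>?Q\<^esub> \<in> topspace (subtopology (tpl ?Q) (unitaries ?Q))"
    by (auto simp: unitaries_def)
  then have "\<one>\<^bsub>?Q\<^esub> \<in> unitary_component ?Q"
    by (simp add: unitary_component_def path_component_of_refl)
  moreover have "\<one>\<^bsub>?Q\<^esub> \<otimes>\<^bsub>?Q\<^esub> u = u"
    using assms(2) one_coset by (auto simp: unitaries_def Q_carrier)
  \<comment> \<open>The class of \<open>u\<close> is a coset containing \<open>u\<close>, since 1
    lies in the path component. Triviality of the class identifies this coset with the component,
    and so supplies a path from 1 to \<open>u\<close>.\<close>
  ultimately have "u \<in> RK0_class A u"
    unfolding RK0_class_def r_coset_def unitary_group_def by force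
  also have "RK0_class A u = unitary_component ?Q"
    using assms(3) by (simp add: RK0_def FactGroup_def)
  finally obtain g where g: "pathin (subtopology (tpl ?Q) (unitaries ?Q)) g" "g 0 = \<one>\<^bsub>?Q\<^esub>" "g 1 = u"
    by (auto simp: unitary_component_def path_component_of_def)
  have gU: "g t \<in> unitaries ?Q" if "t \<in> {0..1}" for t
    using g(1) that by (auto simp: pathin_def continuous_map_in_subtopology)
  have "\<exists>r. r \<in> ops \<and> g t = coset r \<and> adj r \<otimes>\<^bsub>L\<^esub> r \<ominus>\<^bsub>L\<^esub> \<one>\<^bsub>L\<^esub> \<in> K \<and> r \<otimes>\<^bsub>L\<^esub> adj r \<ominus>\<^bsub>L\<^esub> \<one>\<^bsub>L\<^esub> \<in> K"
    if "t \<in> {0..1}" for t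
    using Q_unitary[OF gU[OF that]] by metis
  then obtain r where r: "\<And>t. t \<in> {0..1} \<Longrightarrow> r t \<in> ops \<and> g t = coset (r t)"
    "\<And>t. t \<in> {0..1} \<Longrightarrow> adj (r t) \<otimes>\<^bsub>L\<^esub> r t \<ominus>\<^bsub>L\<^esub> \<one>\<^bsub>L\<^esub> \<in> K"
    "\<And>t. t \<in> {0..1} \<Longrightarrow> r t \<otimes>\<^bsub>L\<^esub> adj (r t) \<ominus>\<^bsub>L\<^esub> \<one>\<^bsub>L\<^esub> \<in> K"
    by metis
  \<comment> \<open>The index is shifted by one: the zero seminorm is put in front, and
    \<open>p (Suc m)\<close> is \<open>lev m\<close> after evaluation.\<close>
  define p :: "nat \<Rightarrow> 'a l2_op free_star \<Rightarrow> real"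
    where "p n f = (case n of 0 \<Rightarrow> 0 | Suc m \<Rightarrow> lev m (L.free_eval f))" for n f
  define KT where "KT = {f. L.free_eval f \<in> K}"
  interpret C: complete_star_ring free_adj free_J p KT
  proof (intro complete_star_ring.intro complex_star_ring_free complete_star_ring_axioms.intro)
    fix n
    show "cstar_seminormed free_adj free_J (p n)"
    proof (cases n)
      case 0
      then have "p n = (\<lambda>_. 0)" by (simp add: p_def fun_eq_iff)
      then show ?thesis using cstar_seminormed_zero[OF complex_star_ring_free] by simp
    next
      case (Suc m)
      then have "p n = (\<lambda>f. lev m (L.free_eval f))" by (simp add: p_def fun_eq_iff)
      then show ?thesis using L.cstar_seminormed_free_eval[OF lev_cstar] by simp
    qed
    fix x
    show "p n x \<le> p (Suc n) x"
      using LT.s_mono[of "L.free_eval x"] LT.s_nonneg[of "L.free_eval x"]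
      by (cases n) (simp_all add: p_def del: L_alg_simps level.simps)
    show "p 0 x = 0" by (simp add: p_def)
  next
    fix s :: "nat \<Rightarrow> 'a l2_op free_star"
    assume c: "\<And>n e. e > 0 \<Longrightarrow> \<exists>N. \<forall>i\<ge>N. \<forall>j\<ge>N. p n (s i - s j) < e"
    have "L.free_eval (s i) \<in> ops" for i using L.free_eval_closed[of "s i"] by simp
    moreover have "\<exists>J. \<forall>i\<ge>J. \<forall>j\<ge>J. lev n (L.free_eval (s i) \<ominus>\<^bsub>L\<^esub> L.free_eval (s j)) < e" if "e > 0" for n e
      using c[OF that, of "Suc n"] by (simp add: p_def L.free_eval_diff)
    ultimately obtain t where t: "t \<in> ops" "\<And>n. (\<lambda>i. lev n (L.free_eval (s i) \<ominus>\<^bsub>L\<^esub> t)) \<longlonglongrightarrow> 0"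
      using L_complete[of "\<lambda>i. L.free_eval (s i)"] by blast
    \<comment> \<open>The generator \<open>gen t\<close> serves as a limit in the free algebra
      because it evaluates to \<open>t\<close>.\<close>
    have "(\<lambda>i. p n (s i - gen t)) \<longlonglongrightarrow> 0" for n
      using t by (cases n) (simp_all add: p_def L.free_eval_diff)
    then show "\<exists>l. \<forall>n. (\<lambda>i. p n (s i - l)) \<longlonglongrightarrow> 0" by blast
  next
    show "0 \<in> KT" using K_zero by (simp add: KT_def)
    fix x y
    have c: "L.free_eval y \<in> ops" using L.free_eval_closed[of y] by simp
    show "x \<in> KT \<Longrightarrow> y \<in> KT \<Longrightarrow> x + y \<in> KT" by (simp add: KT_def L.free_eval_add K_add)
    show "x \<in> KT \<Longrightarrow> y * x \<in> KT" using c by (simp add: KT_def L.free_eval_mult K_mult_left)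
    show "x \<in> KT \<Longrightarrow> x * y \<in> KT" using c by (simp add: KT_def L.free_eval_mult K_mult_right)
    show "x \<in> KT \<Longrightarrow> free_adj x \<in> KT" by (simp add: KT_def L.free_eval_adj K_adj)
  next
    fix x assume a: "\<And>n e. e > 0 \<Longrightarrow> \<exists>k\<in>KT. p n (x - k) < e"
    have "L.free_eval x \<in> K"
    proof (rule K_limit)
      show "L.free_eval x \<in> ops" using L.free_eval_closed[of x] by simp
      fix n and e :: real assume "e > 0"
      then obtain k where "k \<in> KT" "p (Suc n) (x - k) < e" using a by blast
      then show "\<exists>y\<in>K. lev n (L.free_eval x \<ominus>\<^bsub>L\<^esub> y) < e"
        by (auto simp: KT_def p_def L.free_eval_diff)
    qed
    then show "x \<in> KT" by (simp add: KT_def)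
  qed
  define x where "x t = gen (r t)" for t
  have ev: "L.free_eval (x t) = r t" if "t \<in> {0..1}" for t using r(1)[OF that] by (simp add: x_def)
  have "C.unit_path x"
  proof (rule C.unit_pathI)
    show "C.unitK (x t)" if "t \<in> {0..1}" for t
      using r(2,3)[OF that] ev[OF that]
      unfolding C.unitK_def unfolding KT_def by (simp add: L.free_eval_diff L.free_eval_mult L.free_eval_adj)
    have "coset (r 0) = coset \<one>\<^bsub>L\<^esub>" using r(1)[of 0] g(2) by (simp add: Q_one)
    then have "r 0 \<ominus>\<^bsub>L\<^esub> \<one>\<^bsub>L\<^esub> \<in> K" using r(1)[of 0] coset_eq_iff[OF _ one_ops] by simp
    then show "x 0 - 1 \<in> KT" using ev[of 0] by (simp add: KT_def L.free_eval_diff)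
    fix m and t e :: real assume t: "t \<in> {0..1}" and e: "e > 0"
    show "\<exists>d>0. \<forall>s\<in>{0..1}. \<bar>s - t\<bar> < d \<longrightarrow> C.q m (x s - x t) < e"
    proof (cases m)
      case 0
      have "C.q m y < e" for y using C.q_le_p[of m y] e 0 by (simp add: p_def)
      then show ?thesis using zero_less_one by blast
    next
      case (Suc n)
      obtain d where d: "d > 0"
        "\<And>s. s \<in> {0..1} \<Longrightarrow> \<bar>s - t\<bar> < d \<Longrightarrow> \<exists>k\<in>K. lev n (r s \<ominus>\<^bsub>L\<^esub> r t \<oplus>\<^bsub>L\<^esub> k) < e"
        using Q_path_continuous[OF g(1) r(1) t e] by metis
      have "C.q m (x s - x t) < e" if s: "s \<in> {0..1}" "\<bar>s - t\<bar> < d" for s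
      proof -
        obtain k where k: "k \<in> K" "lev n (r s \<ominus>\<^bsub>L\<^esub> r t \<oplus>\<^bsub>L\<^esub> k) < e" using d(2)[OF s] by blast
        have gk: "L.free_eval (gen k) = k" using K_ops[OF k(1)] by simp
        have "C.q m (x s - x t) \<le> p m (x s - x t + gen k)"
          by (rule C.q_le) (simp add: KT_def gk k(1))
        also have "\<dots> < e"
          using k(2) by (simp add: p_def Suc L.free_eval_add L.free_eval_diff ev[OF s(1)] ev[OF t] gk)
        finally show ?thesis .
      qed
      then show ?thesis using d(1) by blast
    qed
  qed
  then obtain w where w: "C.unit w" "x 1 - w \<in> KT" by (rule C.unit_path_endpoint_lift)
  define W where "W = L.free_eval w"
  have Wo: "W \<in> ops" using L.free_eval_closed[of w] by (simp add: W_def)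
  \<comment> \<open>The index \<open>Suc n\<close> skips the zero seminorm; vanishing of all
    \<open>lev n\<close> becomes equality because these seminorms separate operators.\<close>
  have "lev n (adj W \<otimes>\<^bsub>L\<^esub> W \<ominus>\<^bsub>L\<^esub> \<one>\<^bsub>L\<^esub>) = 0" "lev n (W \<otimes>\<^bsub>L\<^esub> adj W \<ominus>\<^bsub>L\<^esub> \<one>\<^bsub>L\<^esub>) = 0" for n
    using w(1)[unfolded C.unit_def, rule_format, of "Suc n"]
    by (simp_all add: p_def W_def L.free_eval_diff L.free_eval_mult L.free_eval_adj)
  then have "adj W \<otimes>\<^bsub>L\<^esub> W = \<one>\<^bsub>L\<^esub>" "W \<otimes>\<^bsub>L\<^esub> adj W = \<one>\<^bsub>L\<^esub>"
    using Wo by (auto intro!: L_separation)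
  then have "W \<in> unitaries L" using Wo by (simp add: unitaries_def)
  moreover have "coset W = u"
  proof -
    have "r 1 \<ominus>\<^bsub>L\<^esub> W \<in> K" using w(2) ev[of 1] by (simp add: KT_def L.free_eval_diff W_def)
    then have "coset (r 1) = coset W" using coset_eq_iff[OF _ Wo] r(1)[of 1] by simp
    then show ?thesis using r(1)[of 1] g(3) by simp
  qed
  ultimately show ?thesis by blast
qed

end
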